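(* Assume Baumgartner's Axiom $\mathsf{BA}$. If $K$ is a separable compact line of weight $\omega_1$, then $C_p(K)$ is linearly homeomorphic to $C_p(K)\times C_p(K)$.
   Context: A compact line is a linearly ordered set whose order topology is compact, regarded as a topological space. $C_p(X)$ is the space of continuous real-valued functions on $X$ with the topology of pointwise convergence. A subset $A\subset\mathbb{R}$ is $\omega_1$-dense if $|A\cap U|=\omega_1$ for every nonempty open $U\subset \mathbb{R}$. $\mathsf{BA}$ is the statement: every two $\omega_1$-dense subsets of $\mathbb{R}$ are order isomorphic. *)

theory Defs
  imports "HOL-Analysis.Analysis"
begin

unbundle cardinal_syntax

text \<open>The first uncountable cardinal, as a cardinal-order relation; a set \<open>A\<close> has
  cardinality \<open>\<omega>\<^sub>1\<close> iff \<open>|A| =o omega1\<close>.\<close>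

definition omega1 :: "nat set rel" where
  "omega1 = cardSuc natLeq"

definition omega1_dense :: "real set \<Rightarrow> bool" where
  "omega1_dense A \<longleftrightarrow> (\<forall>U. open U \<and> U \<noteq> {} \<longrightarrow> |A \<inter> U| =o omega1)"

definition order_isomorphic :: "'a::order set \<Rightarrow> 'b::order set \<Rightarrow> bool" where
  "order_isomorphic A B \<longleftrightarrow>
    (\<exists>f. bij_betw f A B \<and> (\<forall>x\<in>A. \<forall>y\<in>A. x \<le> y \<longleftrightarrow> f x \<le> f y))"

definition BA :: bool where
  "BA \<longleftrightarrow> (\<forall>A B. omega1_dense A \<and> omega1_dense B \<longrightarrow> order_isomorphic A B)"

text \<open>\<open>weight_is TYPE('a) r\<close>: the least cardinality of a base of \<open>'a\<close> is the cardinal \<open>r\<close>.\<close>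

definition weight_is :: "'a::topological_space itself \<Rightarrow> 'k rel \<Rightarrow> bool" where
  "weight_is _ r \<longleftrightarrow>
    (\<exists>B::'a set set. topological_basis B \<and> |B| =o r) \<and>
    (\<forall>B::'a set set. topological_basis B \<longrightarrow> r \<le>o |B| )"

text \<open>The class \<open>linorder_topology\<close> fixes the topology of the type to be the order topology.\<close>

definition compact_line :: "'a::linorder_topology itself \<Rightarrow> bool" where
  "compact_line _ \<longleftrightarrow> compact (UNIV :: 'a set)"

text \<open>\<open>'a Cp\<close> is the set of continuous functions \<open>'a \<Rightarrow> real\<close> with pointwise linear
  operations and the subspace topology inherited from the function type, whose library
  topology is the product topology, i.e. the topology of pointwise convergence.\<close>

typedef (overloaded) 'a Cp = "{f :: 'a::topological_space \<Rightarrow> real. continuous_on UNIV f}"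
  morphisms apply_Cp Abs_Cp
  by (rule exI[of _ "\<lambda>_. 0"]) simp

setup_lifting type_definition_Cp

instantiation Cp :: (topological_space) real_vector
begin

lift_definition zero_Cp :: "'a Cp" is "\<lambda>_. 0"
  by simp

lift_definition plus_Cp :: "'a Cp \<Rightarrow> 'a Cp \<Rightarrow> 'a Cp" is "\<lambda>f g x. f x + g x"
  by (rule continuous_on_add)

lift_definition minus_Cp :: "'a Cp \<Rightarrow> 'a Cp \<Rightarrow> 'a Cp" is "\<lambda>f g x. f x - g x"
  by (rule continuous_on_diff)

lift_definition uminus_Cp :: "'a Cp \<Rightarrow> 'a Cp" is "\<lambda>f x. - f x"
  by (rule continuous_on_minus)

lift_definition scaleR_Cp :: "real \<Rightarrow> 'a Cp \<Rightarrow> 'a Cp" is "\<lambda>c f x. c * f x"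
  by (rule continuous_on_mult_left)

instance
  by standard (transfer; simp add: fun_eq_iff algebra_simps)+

end

instantiation Cp :: (topological_space) topological_space
begin

definition open_Cp :: "'a Cp set \<Rightarrow> bool" where
  "open_Cp U \<longleftrightarrow> (\<exists>V. open V \<and> U = apply_Cp -` V)"

instance
proof
  show "open (UNIV :: 'a Cp set)"
    unfolding open_Cp_def by (rule exI[of _ UNIV]) simp
next
  fix S T :: "'a Cp set"
  assume "open S" "open T"
  then obtain V W where "open V" "S = apply_Cp -` V" "open W" "T = apply_Cp -` W"
    unfolding open_Cp_def by blast
  then have "open (V \<inter> W)" "S \<inter> T = apply_Cp -` (V \<inter> W)"
    by auto
  then show "open (S \<inter> T)"
    unfolding open_Cp_def by blast
next
  fix \<U> :: "'a Cp set set"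
  assume "\<forall>S\<in>\<U>. open S"
  then obtain V where "\<forall>S\<in>\<U>. open (V S) \<and> S = apply_Cp -` V S"
    unfolding open_Cp_def by metis
  then have "open (\<Union>S\<in>\<U>. V S)" "\<Union>\<U> = apply_Cp -` (\<Union>S\<in>\<U>. V S)"
    by auto
  then show "open (\<Union>\<U>)"
    unfolding open_Cp_def by blast
qed

end

definition linear_homeomorphism ::
    "('a::{real_vector,topological_space} \<Rightarrow> 'b::{real_vector,topological_space}) \<Rightarrow> bool" where
  "linear_homeomorphism T \<longleftrightarrow> linear T \<and> (\<exists>S. homeomorphism UNIV UNIV T S)"

end

theory Submission
  imports Defs
begin

text \<open>Let \<open>X\<close> be the space of continuous functions on a separable compact line \<open>K\<close> of weight
  \<open>\<omega>\<^sub>1\<close>, with the pointwise topology. Call a point jump free if it is interior to an interval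
  without jumps (pairs of adjacent points), let \<open>O\<close> be the open set of these points and
  \<open>N = K - O\<close>. For every closed \<open>S \<subseteq> K\<close> there is a linear extension operator from \<open>S\<close> to \<open>K\<close> which
  fills each gap of \<open>S\<close> by a Urysohn function (\<open>extension_operator\<close>), so
  \<open>X \<simeq> C(S) \<times> {f \<in> X. f = 0 on S}\<close>. In particular \<open>X \<simeq> C(N) \<times> C_van O\<close>, where \<open>C_van O\<close> consists
  of the functions vanishing off \<open>O\<close>. The theorem follows if \<open>X\<close> absorbs both factors, i.e. if
  \<open>X \<simeq> X \<times> C(N)\<close> and \<open>X \<simeq> X \<times> C_van O\<close>, since then \<open>X \<times> X \<simeq> X \<times> C(N) \<times> C_van O \<simeq> X\<close>.

  The second absorption (\<open>jump_free_absorbed\<close>) takes place on the real line, if \<open>O\<close> is not empty. A monotone map into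
  \<open>\<real>\<close> identifies \<open>O\<close> with a bounded open set \<open>V\<close>, and any jump-free interval with an interval.
  Inside that interval there is room for a sequence of shrinking copies of \<open>V\<close>, and adding one more
  copy to the sequence changes nothing.

  The first absorption (\<open>core_absorbed\<close>) uses Baumgartner's axiom. It suffices to embed \<open>N\<close> in \<open>K\<close>
  infinitely often, the copies converging to a point: their union \<open>M\<close> together with that point
  satisfies \<open>C(M) \<simeq> C(M) \<times> C(N)\<close> by a shift. To embed \<open>N\<close>, collapse those intervals of \<open>K\<close>
  which contain only countably many jumps. The quotient is \<open>[0,1]\<close>, and the set \<open>A\<close> of its points with
  more than one preimage is \<open>\<omega>\<^sub>1\<close>-dense there (\<open>omega1_dense_quotient\<close>). On the other hand, \<open>N\<close> has a
  monotone map onto a nowhere dense set \<open>E\<close> of reals which identifies nothing except the two points of certain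
  jumps (\<open>core_projection\<close>); let \<open>B\<close> be the set of points with two preimages.
  Since \<open>E\<close> is nowhere dense, \<open>B\<close> extends to an \<open>\<omega>\<^sub>1\<close>-dense set without new points in \<open>E\<close>, and
  the isomorphism provided by the axiom extends to a homeomorphism \<open>h\<close> of the line onto an interval,
  with \<open>h \<tau> \<in> A\<close> iff \<open>\<tau> \<in> B\<close>, for \<open>\<tau> \<in> E\<close> (\<open>BA_embedding\<close>). So \<open>h\<close> respects which points are
  split, and lifts to an order embedding of \<open>N\<close> in \<open>K\<close> (\<open>lift_embedding\<close>).\<close>

section \<open>Continuous linear isomorphisms of spaces of real functions\<close>

text \<open>The spaces involved live on different domains, so they are represented as sets of functions
  \<open>'x \<Rightarrow> real\<close> with the subspace topology of the product, and a map between them is tested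
  coordinatewise. The prefix \<open>cl\<close> stands for continuous linear.\<close>
definition cl_functional :: "('x \<Rightarrow> real) set \<Rightarrow> (('x \<Rightarrow> real) \<Rightarrow> real) \<Rightarrow> bool" where
  "cl_functional E \<phi> \<longleftrightarrow> continuous_on E \<phi> \<and>
     (\<forall>f\<in>E. \<forall>g\<in>E. \<phi> (\<lambda>x. f x + g x) = \<phi> f + \<phi> g) \<and>
     (\<forall>c. \<forall>f\<in>E. \<phi> (\<lambda>x. c * f x) = c * \<phi> f)"

lemma cl_eval [intro, simp]: "cl_functional E (\<lambda>f. f x)"
  unfolding cl_functional_def
  by (auto intro: continuous_on_subset[OF continuous_on_product_coordinates])

lemma cl_zero [intro, simp]: "cl_functional E (\<lambda>f. 0)"
  unfolding cl_functional_def by auto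

lemma cl_add [intro]:
  "cl_functional E \<phi> \<Longrightarrow> cl_functional E \<psi> \<Longrightarrow> cl_functional E (\<lambda>f. \<phi> f + \<psi> f)"
  unfolding cl_functional_def by (auto intro: continuous_on_add simp: algebra_simps)

lemma cl_diff [intro]:
  "cl_functional E \<phi> \<Longrightarrow> cl_functional E \<psi> \<Longrightarrow> cl_functional E (\<lambda>f. \<phi> f - \<psi> f)"
  unfolding cl_functional_def by (auto intro: continuous_on_diff simp: algebra_simps)

lemma cl_mult [intro]:
  "cl_functional E \<phi> \<Longrightarrow> cl_functional E (\<lambda>f. c * \<phi> f)"
  unfolding cl_functional_def by (auto intro: continuous_on_mult_left simp: algebra_simps)

lemma cl_if [intro]:
  "(b \<Longrightarrow> cl_functional E \<phi>) \<Longrightarrow> (\<not> b \<Longrightarrow> cl_functional E \<psi>) \<Longrightarrow>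
   cl_functional E (\<lambda>f. if b then \<phi> f else \<psi> f)"
  by (cases b) auto

lemma cl_case_sum [intro]:
  "(\<And>x. y = Inl x \<Longrightarrow> cl_functional E (\<lambda>f. U f x)) \<Longrightarrow>
   (\<And>x. y = Inr x \<Longrightarrow> cl_functional E (\<lambda>f. V f x)) \<Longrightarrow>
   cl_functional E (\<lambda>f. case y of Inl x \<Rightarrow> U f x | Inr x \<Rightarrow> V f x)"
  by (cases y) auto

definition cl_map :: "('x \<Rightarrow> real) set \<Rightarrow> ('y \<Rightarrow> real) set \<Rightarrow> (('x \<Rightarrow> real) \<Rightarrow> 'y \<Rightarrow> real) \<Rightarrow> bool" where
  "cl_map E F T \<longleftrightarrow> T \<in> E \<rightarrow> F \<and> (\<forall>y. cl_functional E (\<lambda>f. T f y))"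

lemma cl_map_continuous_on: "cl_map E F T \<Longrightarrow> continuous_on E T"
  unfolding cl_map_def cl_functional_def
  by (intro continuous_on_coordinatewise_then_product) auto

lemma cl_map_add:
  "cl_map E F T \<Longrightarrow> f \<in> E \<Longrightarrow> g \<in> E \<Longrightarrow> T (\<lambda>x. f x + g x) = (\<lambda>y. T f y + T g y)"
  unfolding cl_map_def cl_functional_def by (auto simp: fun_eq_iff)

lemma cl_map_scale:
  "cl_map E F T \<Longrightarrow> f \<in> E \<Longrightarrow> T (\<lambda>x. c * f x) = (\<lambda>y. c * T f y)"
  unfolding cl_map_def cl_functional_def by (auto simp: fun_eq_iff)

lemma cl_functional_compose:
  assumes T: "cl_map E F T" and \<psi>: "cl_functional F \<psi>"
  shows "cl_functional E (\<lambda>f. \<psi> (T f))"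
proof -
  have "T ` E \<subseteq> F" using T by (auto simp: cl_map_def)
  then have "continuous_on E (\<lambda>f. \<psi> (T f))"
    using continuous_on_compose2[OF _ cl_map_continuous_on[OF T]] \<psi>
    by (auto simp: cl_functional_def)
  then show ?thesis
    using T \<psi> \<open>T ` E \<subseteq> F\<close>
    by (auto simp: cl_functional_def cl_map_add[OF T] cl_map_scale[OF T] image_subset_iff)
qed

lemma cl_map_compose: "cl_map E F T \<Longrightarrow> cl_map F G S \<Longrightarrow> cl_map E G (\<lambda>f. S (T f))"
  using cl_functional_compose[of E F T "\<lambda>f. S f y" for y] by (auto simp: cl_map_def Pi_iff)

definition cl_iso :: "('x \<Rightarrow> real) set \<Rightarrow> ('y \<Rightarrow> real) set \<Rightarrow> bool" (infix "\<simeq>" 50) where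
  "E \<simeq> F \<longleftrightarrow> (\<exists>T S. cl_map E F T \<and> cl_map F E S \<and> (\<forall>f\<in>E. S (T f) = f) \<and> (\<forall>g\<in>F. T (S g) = g))"

lemma cl_isoI:
  assumes "\<And>f. f \<in> E \<Longrightarrow> T f \<in> F" "\<And>g. g \<in> F \<Longrightarrow> S g \<in> E"
    and "\<And>y. cl_functional E (\<lambda>f. T f y)" "\<And>x. cl_functional F (\<lambda>g. S g x)"
    and "\<And>f x. f \<in> E \<Longrightarrow> S (T f) x = f x" "\<And>g y. g \<in> F \<Longrightarrow> T (S g) y = g y"
  shows "E \<simeq> F"
  unfolding cl_iso_def cl_map_def using assms by (intro exI[of _ T] exI[of _ S]) (auto simp: fun_eq_iff)

lemma cl_iso_refl: "E \<simeq> E"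
  by (rule cl_isoI[where T = "\<lambda>f. f" and S = "\<lambda>f. f"]) auto

lemma cl_iso_sym: "E \<simeq> F \<Longrightarrow> F \<simeq> E"
  unfolding cl_iso_def by blast

lemma cl_iso_trans [trans]: "E \<simeq> F \<Longrightarrow> F \<simeq> G \<Longrightarrow> E \<simeq> G"
proof -
  assume "E \<simeq> F" "F \<simeq> G"
  then obtain T S T' S' where
    *: "cl_map E F T" "cl_map F E S" "\<forall>f\<in>E. S (T f) = f" "\<forall>g\<in>F. T (S g) = g"
      "cl_map F G T'" "cl_map G F S'" "\<forall>f\<in>F. S' (T' f) = f" "\<forall>g\<in>G. T' (S' g) = g"
    unfolding cl_iso_def by blast
  show "E \<simeq> G"
    unfolding cl_iso_def
    using cl_map_compose[OF *(1,5)] cl_map_compose[OF *(6,2)] *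
    by (intro exI[of _ "\<lambda>f. T' (T f)"] exI[of _ "\<lambda>f. S (S' f)"]) (auto simp: cl_map_def Pi_iff)
qed

text \<open>The product of two function spaces is again a function space, on the disjoint sum of the domains.\<close>
definition prod_space :: "('x \<Rightarrow> real) set \<Rightarrow> ('y \<Rightarrow> real) set \<Rightarrow> ('x + 'y \<Rightarrow> real) set"
    (infixr "\<otimes>" 70) where
  "E \<otimes> F = {h. (\<lambda>x. h (Inl x)) \<in> E \<and> (\<lambda>y. h (Inr y)) \<in> F}"

lemma cl_map_Inl: "cl_map (E \<otimes> F) E (\<lambda>h x. h (Inl x))"
  and cl_map_Inr: "cl_map (E \<otimes> F) F (\<lambda>h y. h (Inr y))"
  by (auto simp: cl_map_def prod_space_def)

lemma prod_space_cong:
  assumes "E \<simeq> E'" "F \<simeq> F'" shows "E \<otimes> F \<simeq> E' \<otimes> F'"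
proof -
  obtain T S where T: "cl_map E E' T" and S: "cl_map E' E S"
      and TS: "\<forall>f\<in>E. S (T f) = f" "\<forall>g\<in>E'. T (S g) = g"
    using assms(1) unfolding cl_iso_def by blast
  obtain T' S' where T': "cl_map F F' T'" and S': "cl_map F' F S'"
      and TS': "\<forall>f\<in>F. S' (T' f) = f" "\<forall>g\<in>F'. T' (S' g) = g"
    using assms(2) unfolding cl_iso_def by blast
  have *: "cl_functional (A \<otimes> B) (\<lambda>h. case_sum (U (\<lambda>x. h (Inl x))) (V (\<lambda>x. h (Inr x))) y)"
    if "cl_map A A' U" "cl_map B B' V" for A :: "('p \<Rightarrow> real) set" and B :: "('q \<Rightarrow> real) set"
      and A' :: "('r \<Rightarrow> real) set" and B' :: "('s \<Rightarrow> real) set" and U V y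
    using cl_map_compose[OF cl_map_Inl that(1), of B] cl_map_compose[OF cl_map_Inr that(2), of A]
    by (auto simp: cl_map_def)
  show ?thesis
    by (rule cl_isoI[where T = "\<lambda>h. case_sum (T (\<lambda>x. h (Inl x))) (T' (\<lambda>x. h (Inr x)))"
          and S = "\<lambda>h. case_sum (S (\<lambda>x. h (Inl x))) (S' (\<lambda>x. h (Inr x)))"];
        (rule *[OF T T'] *[OF S S'])?;
        use T S T' S' TS TS' in \<open>auto simp: prod_space_def cl_map_def Pi_iff split: sum.splits\<close>)
qed

lemma prod_space_commute: "E \<otimes> F \<simeq> F \<otimes> E"
  by (rule cl_isoI[where T = "\<lambda>h. case_sum (\<lambda>x. h (Inr x)) (\<lambda>x. h (Inl x))"
        and S = "\<lambda>h. case_sum (\<lambda>x. h (Inr x)) (\<lambda>x. h (Inl x))"])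
    (auto simp: prod_space_def split: sum.splits)

lemma prod_space_assoc: "(E \<otimes> F) \<otimes> G \<simeq> E \<otimes> (F \<otimes> G)"
  by (rule cl_isoI[where
        T = "\<lambda>h. case_sum (\<lambda>x. h (Inl (Inl x))) (case_sum (\<lambda>x. h (Inl (Inr x))) (\<lambda>x. h (Inr x)))"
        and S = "\<lambda>h. case_sum (case_sum (\<lambda>x. h (Inl x)) (\<lambda>x. h (Inr (Inl x)))) (\<lambda>x. h (Inr (Inr x)))"];
      (intro cl_case_sum cl_eval)?; auto simp: prod_space_def split: sum.splits)

lemma prod_space_zero: "E \<simeq> E \<otimes> {\<lambda>_. 0}"
  by (rule cl_isoI[where T = "\<lambda>f. case_sum f (\<lambda>_. 0)" and S = "\<lambda>h x. h (Inl x)"])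
    (auto simp: prod_space_def fun_eq_iff split: sum.split)

text \<open>A summand absorbs on behalf of the whole space: this is how \<open>X\<close> inherits absorption from small
  pieces of \<open>K\<close>.\<close>
lemma absorb_summand:
  assumes "X \<simeq> A \<otimes> Z" "A \<simeq> A \<otimes> B"
  shows "X \<simeq> X \<otimes> B"
proof -
  note assms(1)
  also have "A \<otimes> Z \<simeq> (A \<otimes> B) \<otimes> Z" by (rule prod_space_cong[OF assms(2) cl_iso_refl])
  also have "\<dots> \<simeq> A \<otimes> (B \<otimes> Z)" by (rule prod_space_assoc)
  also have "\<dots> \<simeq> A \<otimes> (Z \<otimes> B)" by (rule prod_space_cong[OF cl_iso_refl prod_space_commute])
  also have "\<dots> \<simeq> (A \<otimes> Z) \<otimes> B" by (rule cl_iso_sym[OF prod_space_assoc])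
  also have "\<dots> \<simeq> X \<otimes> B" by (rule prod_space_cong[OF cl_iso_sym[OF assms(1)] cl_iso_refl])
  finally show ?thesis .
qed

lemma continuous_apply_Cp: "continuous_on UNIV (apply_Cp :: 'a::topological_space Cp \<Rightarrow> _)"
  by (auto simp: continuous_on_open_vimage[OF open_UNIV] open_Cp_def)

lemma continuous_into_Cp:
  fixes \<Phi> :: "'b::topological_space \<Rightarrow> 'a::topological_space Cp"
  assumes "continuous_on UNIV (\<lambda>z. apply_Cp (\<Phi> z))"
  shows "continuous_on UNIV \<Phi>"
  unfolding continuous_on_open_vimage[OF open_UNIV]
proof safe
  fix B :: "'a Cp set" assume "open B"
  then obtain V where V: "open V" "B = apply_Cp -` V" by (auto simp: open_Cp_def)
  have "\<Phi> -` B \<inter> UNIV = (\<lambda>z. apply_Cp (\<Phi> z)) -` V" using V by auto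
  then show "open (\<Phi> -` B \<inter> UNIV)"
    using assms V(1) by (auto simp: continuous_on_open_vimage)
qed

lemma linear_homeomorphism_from_cl_iso:
  assumes "{f :: 'a::topological_space \<Rightarrow> real. continuous_on UNIV f} \<simeq>
           {f :: 'a \<Rightarrow> real. continuous_on UNIV f} \<otimes> {f :: 'a \<Rightarrow> real. continuous_on UNIV f}"
  shows "\<exists>T :: 'a Cp \<Rightarrow> 'a Cp \<times> 'a Cp. linear_homeomorphism T"
proof -
  define X where "X = {f :: 'a \<Rightarrow> real. continuous_on UNIV f}"
  obtain T S where T: "cl_map X (X \<otimes> X) T" and S: "cl_map (X \<otimes> X) X S"
    and TS: "\<forall>f\<in>X. S (T f) = f" "\<forall>g\<in>X \<otimes> X. T (S g) = g"
    using assms unfolding cl_iso_def X_def by blast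
  have app: "apply_Cp u \<in> X" for u using apply_Cp[of u] by (simp add: X_def)
  have absapp: "apply_Cp (Abs_Cp f) = f" if "f \<in> X" for f
    using that by (simp add: X_def Abs_Cp_inverse)
  define L where "L u = (\<lambda>x. T (apply_Cp u) (Inl x))" for u
  define R where "R u = (\<lambda>x. T (apply_Cp u) (Inr x))" for u
  define J where "J w = case_sum (apply_Cp (fst w)) (apply_Cp (snd w))" for w :: "'a Cp \<times> 'a Cp"
  have LX: "L u \<in> X" "R u \<in> X" for u
    using T app[of u] by (auto simp: L_def R_def cl_map_def prod_space_def)
  have JX: "J w \<in> X \<otimes> X" for w
    using app by (simp add: J_def prod_space_def)
  define \<T> where "\<T> u = (Abs_Cp (L u), Abs_Cp (R u))" for u
  define \<S> where "\<S> w = Abs_Cp (S (J w))" for w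
  have SX: "S (J w) \<in> X" for w using S JX[of w] by (auto simp: cl_map_def)
  have J\<T>: "J (\<T> u) = T (apply_Cp u)" for u
    by (simp add: J_def \<T>_def absapp LX) (auto simp: fun_eq_iff L_def R_def split: sum.split)
  have inv1: "\<S> (\<T> u) = u" for u
    using TS(1) app[of u] by (simp add: \<S>_def J\<T> apply_Cp_inverse)
  have inv2: "\<T> (\<S> w) = w" for w
  proof -
    have "T (apply_Cp (\<S> w)) = J w" using TS(2) JX[of w] SX[of w] by (simp add: \<S>_def absapp)
    then have "L (\<S> w) = apply_Cp (fst w)" "R (\<S> w) = apply_Cp (snd w)"
      by (simp_all add: L_def R_def J_def)
    then show ?thesis by (simp add: \<T>_def apply_Cp_inverse)
  qed
  have c0: "continuous_on UNIV (\<lambda>u. T (apply_Cp u) z)" for z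
    using cl_map_continuous_on[OF T] continuous_apply_Cp app
      continuous_on_compose2[of X T UNIV apply_Cp]
    by (auto dest: continuous_on_product_then_coordinatewise)
  have "continuous_on UNIV L" "continuous_on UNIV R"
    unfolding L_def R_def using c0
    by (auto intro!: continuous_on_coordinatewise_then_product)
  then have cT: "continuous_on UNIV \<T>"
    unfolding \<T>_def
    by (intro continuous_on_Pair continuous_into_Cp) (simp_all add: absapp LX)
  have c1: "continuous_on UNIV (\<lambda>w. J w z)" for z
  proof -
    have fs: "continuous_on UNIV (\<lambda>w :: 'a Cp \<times> 'a Cp. apply_Cp (fst w))"
      "continuous_on UNIV (\<lambda>w :: 'a Cp \<times> 'a Cp. apply_Cp (snd w))"
      using continuous_on_compose2[OF continuous_apply_Cp continuous_on_fst[OF continuous_on_id]]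
        continuous_on_compose2[OF continuous_apply_Cp continuous_on_snd[OF continuous_on_id]]
      by auto
    show ?thesis
      using continuous_on_product_then_coordinatewise[OF fs(1)]
        continuous_on_product_then_coordinatewise[OF fs(2)]
      by (cases z) (auto simp: J_def)
  qed
  then have "continuous_on UNIV J"
    by (intro continuous_on_coordinatewise_then_product) auto
  moreover have "range J \<subseteq> X \<otimes> X" using JX by blast
  ultimately have cS: "continuous_on UNIV \<S>"
    using cl_map_continuous_on[OF S] continuous_on_compose2[of "X \<otimes> X" S UNIV J]
    by (intro continuous_into_Cp) (auto simp: \<S>_def absapp SX)
  have "linear \<T>"
  proof
    fix u v :: "'a Cp" and c :: real
    have "T (apply_Cp (u + v)) = (\<lambda>z. T (apply_Cp u) z + T (apply_Cp v) z)"
      using cl_map_add[OF T app app, of u v] by (simp add: plus_Cp.rep_eq)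
    then have "L (u + v) = (\<lambda>x. L u x + L v x)" "R (u + v) = (\<lambda>x. R u x + R v x)"
      by (simp_all add: L_def R_def)
    then have "apply_Cp (Abs_Cp (L (u + v))) = apply_Cp (Abs_Cp (L u) + Abs_Cp (L v))"
      "apply_Cp (Abs_Cp (R (u + v))) = apply_Cp (Abs_Cp (R u) + Abs_Cp (R v))"
      unfolding plus_Cp.rep_eq absapp[OF LX(1)] absapp[OF LX(2)] by simp_all
    then show "\<T> (u + v) = \<T> u + \<T> v"
      by (simp add: \<T>_def apply_Cp_inject)
    have "T (apply_Cp (c *\<^sub>R u)) = (\<lambda>z. c * T (apply_Cp u) z)"
      using cl_map_scale[OF T app, of c u] by (simp add: scaleR_Cp.rep_eq)
    then have "L (c *\<^sub>R u) = (\<lambda>x. c * L u x)" "R (c *\<^sub>R u) = (\<lambda>x. c * R u x)"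
      by (simp_all add: L_def R_def)
    then have "apply_Cp (Abs_Cp (L (c *\<^sub>R u))) = apply_Cp (c *\<^sub>R Abs_Cp (L u))"
      "apply_Cp (Abs_Cp (R (c *\<^sub>R u))) = apply_Cp (c *\<^sub>R Abs_Cp (R u))"
      unfolding scaleR_Cp.rep_eq absapp[OF LX(1)] absapp[OF LX(2)] by simp_all
    then show "\<T> (c *\<^sub>R u) = c *\<^sub>R \<T> u"
      by (simp add: \<T>_def apply_Cp_inject)
  qed
  moreover have "homeomorphism UNIV UNIV \<T> \<S>"
    unfolding homeomorphism_def using cT cS inv1 inv2 by (metis UNIV_I surj_def)
  ultimately show ?thesis unfolding linear_homeomorphism_def by blast
qed

section \<open>Splitting off a closed subset of a compact line\<close>

text \<open>Values outside \<open>S\<close> are fixed to be zero so that a continuous function on \<open>S\<close> has exactly one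
  representative.\<close>
definition C_on :: "'a::topological_space set \<Rightarrow> ('a \<Rightarrow> real) set" where
  "C_on S = {f. continuous_on S f \<and> (\<forall>x. x \<notin> S \<longrightarrow> f x = 0)}"

definition C_van :: "'a::topological_space set \<Rightarrow> ('a \<Rightarrow> real) set" where
  "C_van U = {f. continuous_on UNIV f \<and> (\<forall>x. x \<notin> U \<longrightarrow> f x = 0)}"

text \<open>The sets \<open>e ` N\<close> and \<open>\<sigma> ` M\<close> are compact and partition \<open>M\<close>, so \<open>M\<close> is homeomorphic to the
  disjoint sum of \<open>M\<close> and \<open>N\<close>. For the application, \<open>\<sigma>\<close> shifts a sequence of copies of \<open>N\<close> by one
  and \<open>e\<close> is the first copy.\<close>
lemma C_on_split:
  fixes M :: "'a::t2_space set" and N :: "'b::t2_space set"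
  assumes M: "compact M" and N: "compact N"
    and e: "continuous_on N e" "inj_on e N"
    and \<sigma>: "continuous_on M \<sigma>" "inj_on \<sigma> M"
    and disj: "e ` N \<inter> \<sigma> ` M = {}" and cover: "e ` N \<union> \<sigma> ` M = M"
  shows "C_on M \<simeq> C_on M \<otimes> C_on N"
proof (rule cl_isoI[where T = "\<lambda>f. case_sum (\<lambda>x. if x \<in> M then f (\<sigma> x) else 0) (\<lambda>x. if x \<in> N then f (e x) else 0)"
      and S = "\<lambda>h x. if x \<in> \<sigma> ` M then h (Inl (inv_into M \<sigma> x)) else if x \<in> e ` N then h (Inr (inv_into N e x)) else 0"])
  fix f assume f: "f \<in> C_on M"
  have "continuous_on M (\<lambda>x. f (\<sigma> x))" "continuous_on N (\<lambda>x. f (e x))"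
    using f cover \<sigma>(1) e(1) by (auto simp: C_on_def intro: continuous_on_compose2[of M f])
  then show "case_sum (\<lambda>x. if x \<in> M then f (\<sigma> x) else 0) (\<lambda>x. if x \<in> N then f (e x) else 0) \<in> C_on M \<otimes> C_on N"
    by (simp add: prod_space_def C_on_def cong: continuous_on_cong)
next
  fix h assume h: "h \<in> C_on M \<otimes> C_on N"
  let ?S = "\<lambda>x. if x \<in> \<sigma> ` M then h (Inl (inv_into M \<sigma> x)) else if x \<in> e ` N then h (Inr (inv_into N e x)) else 0"
  have hl: "continuous_on M (\<lambda>x. h (Inl x))" and hr: "continuous_on N (\<lambda>x. h (Inr x))"
    using h by (auto simp: prod_space_def C_on_def)
  have c: "continuous_on (\<sigma> ` M) (inv_into M \<sigma>)" "continuous_on (e ` N) (inv_into N e)"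
    using M N e \<sigma> by (auto intro!: continuous_on_inv)
  have "continuous_on (\<sigma> ` M) (\<lambda>x. h (Inl (inv_into M \<sigma> x)))"
    by (rule continuous_on_compose2[OF hl c(1)]) (auto intro: inv_into_into)
  then have 1: "continuous_on (\<sigma> ` M) ?S"
    by (rule continuous_on_cong[THEN iffD1, rotated -1]) auto
  have "continuous_on (e ` N) (\<lambda>x. h (Inr (inv_into N e x)))"
    by (rule continuous_on_compose2[OF hr c(2)]) (auto intro: inv_into_into)
  then have 2: "continuous_on (e ` N) ?S"
    by (rule continuous_on_cong[THEN iffD1, rotated -1]) (use disj in auto)
  have "closed (\<sigma> ` M)" "closed (e ` N)"
    using M N e \<sigma> by (auto intro!: compact_imp_closed compact_continuous_image)
  then have "continuous_on (e ` N \<union> \<sigma> ` M) ?S"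
    using 1 2 by (intro continuous_on_closed_Un)
  then show "?S \<in> C_on M"
    using cover by (auto simp: C_on_def)
next
  show "cl_functional (C_on M)
      (\<lambda>f. case y of Inl x \<Rightarrow> if x \<in> M then f (\<sigma> x) else 0 | Inr x \<Rightarrow> if x \<in> N then f (e x) else 0)" for y
    by (intro cl_case_sum cl_if cl_eval cl_zero)
  show "cl_functional (C_on M \<otimes> C_on N)
      (\<lambda>h. if x \<in> \<sigma> ` M then h (Inl (inv_into M \<sigma> x))
           else if x \<in> e ` N then h (Inr (inv_into N e x)) else 0)" for x
    by (intro cl_if cl_eval cl_zero)
next
  fix f x assume "f \<in> C_on M"
  then show "(if x \<in> \<sigma> ` M
        then case_sum (\<lambda>x. if x \<in> M then f (\<sigma> x) else 0) (\<lambda>x. if x \<in> N then f (e x) else 0) (Inl (inv_into M \<sigma> x))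
        else if x \<in> e ` N
        then case_sum (\<lambda>x. if x \<in> M then f (\<sigma> x) else 0) (\<lambda>x. if x \<in> N then f (e x) else 0) (Inr (inv_into N e x))
        else 0) = f x"
    using cover by (auto simp: C_on_def f_inv_into_f inv_into_into)
next
  fix h y assume h: "h \<in> C_on M \<otimes> C_on N"
  have "e z \<notin> \<sigma> ` M" if "z \<in> N" for z using disj that by blast
  then show "(case y of
         Inl x \<Rightarrow> if x \<in> M then if \<sigma> x \<in> \<sigma> ` M then h (Inl (inv_into M \<sigma> (\<sigma> x)))
             else if \<sigma> x \<in> e ` N then h (Inr (inv_into N e (\<sigma> x))) else 0 else 0
       | Inr x \<Rightarrow> if x \<in> N then if e x \<in> \<sigma> ` M then h (Inl (inv_into M \<sigma> (e x)))
             else if e x \<in> e ` N then h (Inr (inv_into N e (e x))) else 0 else 0) = h y"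
    using h e(2) \<sigma>(2) by (auto simp: C_on_def prod_space_def inv_into_f_f split: sum.split)
qed

lemma compact_line_gap_function:
  fixes a b :: "'a::linorder_topology"
  assumes K: "compact (UNIV :: 'a set)" and "a \<noteq> b"
  shows "\<exists>w :: 'a \<Rightarrow> real. continuous_on UNIV w \<and> range w \<subseteq> {0..1} \<and> w a = 0 \<and> w b = 1"
proof -
  have "Hausdorff_space (euclidean :: 'a topology)"
    using hausdorff[where 'a = 'a] unfolding Hausdorff_space_def by (simp add: disjnt_def)
  then have "normal_space (euclidean :: 'a topology)"
    using K by (intro compact_Hausdorff_or_regular_imp_normal_space) (auto simp: compact_space_def)
  then obtain f where "continuous_map euclidean (top_of_set {0..1::real}) f" "f ` {a} \<subseteq> {0}" "f ` {b} \<subseteq> {1}"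
    using Urysohn_lemma[of "euclidean :: 'a topology" "{a}" "{b}" 0 1] \<open>a \<noteq> b\<close> by (auto simp: disjnt_def)
  then show ?thesis
    by (intro exI[of _ f]) (auto simp: continuous_map_in_subtopology)
qed


lemma convex_combination_close:
  fixes a b :: real
  assumes "\<bar>a - c\<bar> < e" "\<bar>b - c\<bar> < e" "0 \<le> t" "t \<le> 1"
  shows "\<bar>a + t * (b - a) - c\<bar> < e"
proof -
  have "a + t * (b - a) = (1 - t) * a + t * b" by (simp add: algebra_simps)
  moreover have "(1 - t) *\<^sub>R a + t *\<^sub>R b \<in> ball c e"
    using assms by (intro convexD[OF convex_ball]) (auto simp: dist_real_def)
  ultimately show ?thesis by (simp add: dist_real_def)
qed

text \<open>A continuous function on \<open>S\<close> is interpolated in each gap of \<open>S\<close> between its values at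
  the two ends, with a Urysohn function as weight, and is continued by a constant beyond the ends of \<open>S\<close>.
  Values in a gap lie between the end values, which gives continuity at points of \<open>S\<close> that are limits
  of gaps. Only two values of the function are used at each point, hence the operator is continuous for
  the pointwise topology.\<close>
lemma extension_operator:
  fixes S :: "'a::linorder_topology set"
  assumes K: "compact (UNIV :: 'a set)" and S: "closed S"
  shows "\<exists>E. cl_map (C_on S) (C_on UNIV) E \<and> (\<forall>f\<in>C_on S. \<forall>x\<in>S. E f x = f x)"
proof (cases "S = {}")
  case True
  then show ?thesis
    by (intro exI[of _ "\<lambda>_ _. 0"]) (auto simp: cl_map_def C_on_def)
next
  case False
  have cS: "compact T" if "closed T" for T :: "'a set"
    using compact_Int_closed[OF K that] by simp
  have mx: "\<exists>m. m \<in> T \<and> (\<forall>z\<in>T. z \<le> m)" and mn: "\<exists>m. m \<in> T \<and> (\<forall>z\<in>T. m \<le> z)"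
    if "closed T" "T \<noteq> {}" for T :: "'a set"
    using compact_attains_sup[OF cS that(2)] compact_attains_inf[OF cS that(2)] that(1) by blast+
  have cl: "closed (S \<inter> {..x})" "closed (S \<inter> {x..})" for x
    using S by (auto intro: closed_Int)
  obtain lo where lo: "\<And>x. S \<inter> {..x} \<noteq> {} \<Longrightarrow> lo x \<in> S \<inter> {..x} \<and> (\<forall>z\<in>S \<inter> {..x}. z \<le> lo x)"
    using mx[OF cl(1)] by metis
  obtain hi where hi: "\<And>x. S \<inter> {x..} \<noteq> {} \<Longrightarrow> hi x \<in> S \<inter> {x..} \<and> (\<forall>z\<in>S \<inter> {x..}. hi x \<le> z)"
    using mn[OF cl(2)] by metis
  have "\<exists>w :: 'a \<Rightarrow> real. continuous_on UNIV w \<and> (\<forall>x. 0 \<le> w x \<and> w x \<le> 1) \<and> w a = 0 \<and> (a \<noteq> b \<longrightarrow> w b = 1)" for a b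
  proof (cases "a = b")
    case True
    then show ?thesis by (intro exI[of _ "\<lambda>_. 0"]) auto
  next
    case False
    then show ?thesis using compact_line_gap_function[OF K False] by (auto simp: image_subset_iff)
  qed
  then obtain w :: "'a \<Rightarrow> 'a \<Rightarrow> 'a \<Rightarrow> real" where
    wc: "\<And>a b. continuous_on UNIV (w a b)" and w01: "\<And>a b x. 0 \<le> w a b x" "\<And>a b x. w a b x \<le> 1"
    and w0: "\<And>a b. w a b a = 0" and w1: "\<And>a b. a \<noteq> b \<Longrightarrow> w a b b = 1"
    by metis
  \<comment> \<open>Beyond the last or before the first point of \<open>S\<close> both neighbours are the nearest end, so that the interpolation is constant there.\<close>
  define l where "l x = (if S \<inter> {..x} \<noteq> {} then lo x else hi x)" for x
  define r where "r x = (if S \<inter> {x..} \<noteq> {} then hi x else lo x)" for x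
  have ne: "S \<inter> {..x} \<noteq> {} \<or> S \<inter> {x..} \<noteq> {}" for x using False linear[of _ x] by blast
  have lS: "l x \<in> S" "r x \<in> S" for x
    using lo[of x] hi[of x] ne[of x] by (auto simp: l_def r_def)
  have lx: "l x \<in> S \<inter> {..x}" "\<And>z. z \<in> S \<Longrightarrow> z \<le> x \<Longrightarrow> z \<le> l x" if "S \<inter> {..x} \<noteq> {}" for x
    using lo[OF that] that by (auto simp: l_def)
  have rx: "r x \<in> S \<inter> {x..}" "\<And>z. z \<in> S \<Longrightarrow> x \<le> z \<Longrightarrow> r x \<le> z" if "S \<inter> {x..} \<noteq> {}" for x
    using hi[OF that] that by (auto simp: r_def)
  have lrS: "l x = x" "r x = x" if "x \<in> S" for x
  proof -
    have "S \<inter> {..x} \<noteq> {}" "S \<inter> {x..} \<noteq> {}" using that by auto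
    then show "l x = x" "r x = x" using lx[of x] rx[of x] that by (auto intro: antisym)
  qed
  have lohi: "lo u = lo v \<or> S \<inter> {..u} = {}" "hi u = hi v \<or> S \<inter> {v..} = {}"
    "S \<inter> {..u} = {} \<longleftrightarrow> S \<inter> {..v} = {}" "S \<inter> {u..} = {} \<longleftrightarrow> S \<inter> {v..} = {}"
    if "u \<le> v" "S \<inter> {u..v} = {}" for u v
  proof -
    have "S \<inter> {..u} = S \<inter> {..v}" "S \<inter> {u..} = S \<inter> {v..}"
      using that by (auto simp: set_eq_iff) (meson linear order_trans)+
    then show "S \<inter> {..u} = {} \<longleftrightarrow> S \<inter> {..v} = {}" "S \<inter> {u..} = {} \<longleftrightarrow> S \<inter> {v..} = {}"
      "lo u = lo v \<or> S \<inter> {..u} = {}" "hi u = hi v \<or> S \<inter> {v..} = {}"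
      using lo[of u] lo[of v] hi[of u] hi[of v] by (metis antisym)+
  qed
  have LR: "l u = l v" "r u = r v" if "u \<le> v" "S \<inter> {u..v} = {}" for u v
    using lohi[OF that] ne[of u] by (auto simp: l_def r_def)
  define E where "E f x = f (l x) + w (l x) (r x) x * (f (r x) - f (l x))" for f :: "'a \<Rightarrow> real" and x
  have ES: "E f x = f x" if "x \<in> S" for f x
    using that by (simp add: E_def lrS)
  \<comment> \<open>On a one-sided neighbourhood disjoint from \<open>S\<close> the neighbours are constant, and there \<open>E f\<close> agrees with this continuous function.\<close>
  define G where "G f a b x = f a + w a b x * (f b - f a)" for f :: "'a \<Rightarrow> real" and a b x
  have Glim: "(G f a b \<longlongrightarrow> G f a b x0) (at x0 within T)" for f a b x0 T
    unfolding G_def using wc[of a b]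
    by (auto intro!: tendsto_intros simp: continuous_on_def intro: tendsto_within_subset)
  have EG: "E f x = G f (l x) (r x) x" for f x by (simp add: E_def G_def)
  have Eclose: "\<bar>E f x - f x0\<bar> < e" if "\<bar>f (l x) - f x0\<bar> < e" "\<bar>f (r x) - f x0\<bar> < e" for f x x0 e
    unfolding E_def using that w01 by (intro convex_combination_close)
  have right: "(E f \<longlongrightarrow> E f x0) (at_right x0)" if f: "continuous_on S f" for f x0
  proof (cases "\<exists>y>x0. S \<inter> {x0<..<y} = {}")
    case True
    then obtain y where y: "y > x0" "S \<inter> {x0<..<y} = {}" by blast
    show ?thesis
    proof (cases "\<exists>x. x0 < x \<and> x < y")
      case False
      then have "eventually (\<lambda>x. False) (at_right x0)"
        using y by (subst eventually_at_right[OF y(1)]) auto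
      then show ?thesis by (metis eventually_False tendsto_bot)
    next
      case True
      then obtain x' where x': "x0 < x'" "x' < y" by blast
      have const: "l x = l x'" "r x = r x'" if "x0 < x" "x < y" for x
      proof -
        have "{min x x'..max x x'} \<subseteq> {x0<..<y}"
          using x' that by (auto simp: min_def max_def split: if_splits)
        then have "S \<inter> {min x x'..max x x'} = {}" using y(2) by blast
        from LR[OF _ this] show "l x = l x'" "r x = r x'" by (cases "x \<le> x'"; simp)+
      qed
      have "eventually (\<lambda>x. G f (l x') (r x') x = E f x) (at_right x0)"
        using y(1) const by (subst eventually_at_right[OF y(1)]) (auto simp: EG)
      moreover have "G f (l x') (r x') x0 = E f x0"
      proof (cases "x0 \<in> S")
        case True
        then have ne': "S \<inter> {..x'} \<noteq> {}" using x' by (auto intro: less_imp_le)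
        have "x0 \<le> l x'" using lx(2)[OF ne' True] x' by simp
        moreover have "\<not> x0 < l x'" using lx(1)[OF ne'] y(2) x' by auto
        ultimately have "l x' = x0" by simp
        then show ?thesis using True by (simp add: ES G_def w0)
      next
        case False
        moreover have "{x0..x'} \<subseteq> insert x0 {x0<..<y}" using x' by auto
        ultimately have "S \<inter> {x0..x'} = {}" using y(2) by blast
        from LR[OF _ this] x' show ?thesis by (simp add: EG less_imp_le)
      qed
      ultimately show ?thesis
        using Lim_transform_eventually[OF Glim] by metis
    qed
  next
    case False
    show ?thesis
    proof (cases "{x0<..} = {}")
      case True
      then show ?thesis by simp
    next
      case False
      then obtain y0 where y0: "y0 > x0" by auto
      have x0: "x0 \<in> S"
      proof (rule ccontr)
        assume "x0 \<notin> S"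
        then obtain b where "b > x0" "{x0..<b} \<subseteq> - S"
          using open_right[of "- S" x0 y0] S y0 by auto
        then have "b > x0" "S \<inter> {x0<..<b} = {}" by (auto simp: subset_iff)
        with \<open>\<not> (\<exists>y>x0. S \<inter> {x0<..<y} = {})\<close> show False by blast
      qed
      show ?thesis
      proof (rule tendstoI)
        fix e :: real assume "e > 0"
        obtain U where U: "open U" "x0 \<in> U" "\<forall>z\<in>S \<inter> U. \<bar>f z - f x0\<bar> < e"
          using f x0 \<open>e > 0\<close> unfolding continuous_on_topological
          by (metis IntD1 IntD2 centre_in_ball dist_commute dist_real_def mem_ball open_ball)
        obtain b where b: "b > x0" "{x0..<b} \<subseteq> U"
          using open_right[OF U(1,2) y0] by blast
        have "S \<inter> {x0<..<b} \<noteq> {}"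
          using \<open>\<not> (\<exists>y>x0. S \<inter> {x0<..<y} = {})\<close> b(1) by blast
        then obtain y where y: "y \<in> S" "x0 < y" "y < b" by auto
        have "dist (E f x) (E f x0) < e" if x: "x0 < x" "x < y" for x
        proof -
          have ne1: "S \<inter> {..x} \<noteq> {}" and ne2: "S \<inter> {x..} \<noteq> {}"
            using x0 y x by (auto intro: less_imp_le)
          have "x0 \<le> l x" "l x \<le> x" "x \<le> r x" "r x \<le> y"
            using lx[OF ne1] rx[OF ne2] x0 x y by auto
          then have "x0 \<le> l x" "l x < b" "x0 \<le> r x" "r x < b" using x y by order+
          then have "l x \<in> S \<inter> U" "r x \<in> S \<inter> U" using lS b(2) by (auto simp: subset_iff)
          then show ?thesis using U(3) Eclose by (simp add: dist_real_def ES[OF x0])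
        qed
        then show "eventually (\<lambda>x. dist (E f x) (E f x0) < e) (at_right x0)"
          using y by (subst eventually_at_right[OF y(2)]) auto
      qed
    qed
  qed
  have left: "(E f \<longlongrightarrow> E f x0) (at_left x0)" if f: "continuous_on S f" for f x0
  proof (cases "\<exists>y<x0. S \<inter> {y<..<x0} = {}")
    case True
    then obtain y where y: "y < x0" "S \<inter> {y<..<x0} = {}" by blast
    show ?thesis
    proof (cases "\<exists>x. y < x \<and> x < x0")
      case False
      then have "eventually (\<lambda>x. False) (at_left x0)"
        using y by (subst eventually_at_left[OF y(1)]) auto
      then show ?thesis by (metis eventually_False tendsto_bot)
    next
      case True
      then obtain x' where x': "y < x'" "x' < x0" by blast
      have const: "l x = l x'" "r x = r x'" if "y < x" "x < x0" for x
      proof -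
        have "{min x x'..max x x'} \<subseteq> {y<..<x0}"
          using x' that by (auto simp: min_def max_def split: if_splits)
        then have "S \<inter> {min x x'..max x x'} = {}" using y(2) by blast
        from LR[OF _ this] show "l x = l x'" "r x = r x'" by (cases "x \<le> x'"; simp)+
      qed
      have "eventually (\<lambda>x. G f (l x') (r x') x = E f x) (at_left x0)"
        using y(1) const by (subst eventually_at_left[OF y(1)]) (auto simp: EG)
      moreover have "G f (l x') (r x') x0 = E f x0"
      proof (cases "x0 \<in> S")
        case True
        then have ne': "S \<inter> {x'..} \<noteq> {}" using x' by (auto intro: less_imp_le)
        have "r x' \<le> x0" using rx(2)[OF ne' True] x' by simp
        moreover have "\<not> r x' < x0" using rx(1)[OF ne'] y(2) x' by auto
        ultimately have "r x' = x0" by simp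
        then show ?thesis using True by (cases "l x' = x0") (simp_all add: ES G_def w1)
      next
        case False
        moreover have "{x'..x0} \<subseteq> insert x0 {y<..<x0}" using x' by auto
        ultimately have "S \<inter> {x'..x0} = {}" using y(2) by blast
        from LR[OF _ this] x' show ?thesis by (simp add: EG less_imp_le)
      qed
      ultimately show ?thesis
        using Lim_transform_eventually[OF Glim] by metis
    qed
  next
    case False
    show ?thesis
    proof (cases "{..<x0} = {}")
      case True
      then show ?thesis by simp
    next
      case False
      then obtain y0 where y0: "y0 < x0" by auto
      have x0: "x0 \<in> S"
      proof (rule ccontr)
        assume "x0 \<notin> S"
        then obtain b where "b < x0" "{b<..x0} \<subseteq> - S"
          using open_left[of "- S" x0 y0] S y0 by auto
        then have "b < x0" "S \<inter> {b<..<x0} = {}" by (auto simp: subset_iff)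
        with \<open>\<not> (\<exists>y<x0. S \<inter> {y<..<x0} = {})\<close> show False by blast
      qed
      show ?thesis
      proof (rule tendstoI)
        fix e :: real assume "e > 0"
        obtain U where U: "open U" "x0 \<in> U" "\<forall>z\<in>S \<inter> U. \<bar>f z - f x0\<bar> < e"
          using f x0 \<open>e > 0\<close> unfolding continuous_on_topological
          by (metis IntD1 IntD2 centre_in_ball dist_commute dist_real_def mem_ball open_ball)
        obtain b where b: "b < x0" "{b<..x0} \<subseteq> U"
          using open_left[OF U(1,2) y0] by blast
        have "S \<inter> {b<..<x0} \<noteq> {}"
          using \<open>\<not> (\<exists>y<x0. S \<inter> {y<..<x0} = {})\<close> b(1) by blast
        then obtain y where y: "y \<in> S" "y < x0" "b < y" by auto
        have "dist (E f x) (E f x0) < e" if x: "y < x" "x < x0" for x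
        proof -
          have ne1: "S \<inter> {..x} \<noteq> {}" and ne2: "S \<inter> {x..} \<noteq> {}"
            using x0 y x by (auto intro: less_imp_le)
          have "y \<le> l x" "l x \<le> x" "x \<le> r x" "r x \<le> x0"
            using lx[OF ne1] rx[OF ne2] x0 x y by auto
          then have "b < l x" "l x \<le> x0" "b < r x" "r x \<le> x0" using x y by order+
          then have "l x \<in> S \<inter> U" "r x \<in> S \<inter> U" using lS b(2) by (auto simp: subset_iff)
          then show ?thesis using U(3) Eclose by (simp add: dist_real_def ES[OF x0])
        qed
        then show "eventually (\<lambda>x. dist (E f x) (E f x0) < e) (at_left x0)"
          using y by (subst eventually_at_left[OF y(2)]) auto
      qed
    qed
  qed
  have "continuous_on UNIV (E f)" if "f \<in> C_on S" for f
    using left[of f] right[of f] that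
    by (auto simp: C_on_def continuous_on_def filterlim_at_split)
  then have "cl_map (C_on S) (C_on UNIV) E"
    unfolding cl_map_def by (auto simp: C_on_def[of UNIV] E_def intro!: cl_add cl_mult cl_diff)
  with ES show ?thesis by blast
qed

text \<open>The restriction to \<open>S\<close> and the defect \<open>f - E (f|S)\<close> of the extension determine \<open>f\<close>.\<close>
lemma C_on_decompose:
  fixes S :: "'a::linorder_topology set"
  assumes K: "compact (UNIV :: 'a set)" and S: "closed S"
  shows "(C_on UNIV :: ('a \<Rightarrow> real) set) \<simeq> C_on S \<otimes> C_van (- S)"
proof -
  obtain E where E: "cl_map (C_on S) (C_on UNIV) E" and ES: "\<And>f x. f \<in> C_on S \<Longrightarrow> x \<in> S \<Longrightarrow> E f x = f x"
    using extension_operator[OF assms] by blast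
  let ?R = "\<lambda>f x. if x \<in> S then f x else 0 :: real"
  have R: "cl_map (C_on UNIV) (C_on S) ?R"
    by (auto simp: cl_map_def C_on_def cong: continuous_on_cong intro: continuous_on_subset[OF _ subset_UNIV])
  have RS: "?R f \<in> C_on S" if "f \<in> C_on UNIV" for f using R that by (auto simp: cl_map_def)
  have EC: "continuous_on UNIV (E f)" if "f \<in> C_on S" for f
    using E that by (auto simp: cl_map_def C_on_def)
  show ?thesis
  proof (rule cl_isoI[where T = "\<lambda>f. case_sum (?R f) (\<lambda>x. f x - E (?R f) x)"
        and S = "\<lambda>h x. E (\<lambda>x. h (Inl x)) x + h (Inr x)"])
    show "case_sum (?R f) (\<lambda>x. f x - E (?R f) x) \<in> C_on S \<otimes> C_van (- S)" if "f \<in> C_on UNIV" for f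
      using RS[OF that] EC[OF RS[OF that]] ES[OF RS[OF that]] that
      by (auto simp: prod_space_def C_van_def C_on_def intro!: continuous_on_diff)
    show "(\<lambda>x. E (\<lambda>x. h (Inl x)) x + h (Inr x)) \<in> C_on UNIV" if "h \<in> C_on S \<otimes> C_van (- S)" for h
      using EC that by (auto simp: prod_space_def C_van_def C_on_def intro!: continuous_on_add)
    have "cl_functional (C_on UNIV) (\<lambda>f. E (?R f) x)" for x
      using cl_map_compose[OF R E] by (auto simp: cl_map_def)
    then show "cl_functional (C_on UNIV) (\<lambda>f. case y of Inl x \<Rightarrow> ?R f x | Inr x \<Rightarrow> f x - E (?R f) x)" for y
      by (intro cl_case_sum cl_diff cl_if cl_eval cl_zero)
    have "cl_functional (C_on S \<otimes> C_van (- S)) (\<lambda>h. E (\<lambda>x. h (Inl x)) x)" for x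
      using cl_map_compose[OF cl_map_Inl E] by (auto simp: cl_map_def)
    then show "cl_functional (C_on S \<otimes> C_van (- S)) (\<lambda>h. E (\<lambda>x. h (Inl x)) x + h (Inr x))" for x
      by (intro cl_add cl_eval)
    fix h y assume h: "h \<in> C_on S \<otimes> C_van (- S)"
    have h1: "(\<lambda>x. h (Inl x)) \<in> C_on S" and h2: "x \<in> S \<Longrightarrow> h (Inr x) = 0" for x
      using h by (auto simp: prod_space_def C_van_def)
    have "?R (\<lambda>x. E (\<lambda>x. h (Inl x)) x + h (Inr x)) = (\<lambda>x. h (Inl x))"
      using ES[OF h1] h1 h2 by (auto simp: fun_eq_iff C_on_def)
    note R_eq = this
    show "(case y of Inl x \<Rightarrow> ?R (\<lambda>x. E (\<lambda>x. h (Inl x)) x + h (Inr x)) x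
       | Inr x \<Rightarrow> E (\<lambda>x. h (Inl x)) x + h (Inr x) - E (?R (\<lambda>x. E (\<lambda>x. h (Inl x)) x + h (Inr x))) x) = h y"
      unfolding R_eq using fun_cong[OF R_eq] by (cases y) simp_all
  qed simp
qed

section \<open>Functions vanishing off an open set, and self-similar open sets of reals\<close>

text \<open>Functions vanishing off \<open>g -` V\<close> are constant on the fibres of \<open>g\<close>, because the fibres over \<open>V\<close>
  are single points. Such a function therefore factors through \<open>g\<close>; the factor is continuous because \<open>g\<close> is a closed
  map and \<open>V\<close> is open in the whole real line, not only in the range of \<open>g\<close>.\<close>
lemma C_van_transport:
  fixes g :: "'a::topological_space \<Rightarrow> real"
  assumes K: "compact (UNIV :: 'a set)" and g: "continuous_on UNIV g"
    and V: "open V" "V \<subseteq> range g"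
    and inj: "\<And>x y. g x \<in> V \<Longrightarrow> g x = g y \<Longrightarrow> x = y"
  shows "C_van (g -` V) \<simeq> C_van V"
proof (rule cl_isoI[where T = "\<lambda>f t. if t \<in> V then f (inv g t) else 0" and S = "\<lambda>h x. h (g x)"])
  fix f assume f: "f \<in> C_van (g -` V)"
  let ?T = "\<lambda>t. if t \<in> V then f (inv g t) else 0"
  have eq: "?T (g x) = f x" for x
  proof (cases "g x \<in> V")
    case True
    moreover have "g (inv g (g x)) = g x" by (simp add: f_inv_into_f)
    ultimately have "inv g (g x) = x" using inj[of "inv g (g x)" x] by metis
    with True show ?thesis by simp
  next
    case False
    then show ?thesis using f by (simp add: C_van_def)
  qed
  have "closed (?T -` B)" if B: "closed B" for B
  proof -
    have "closed (f -` B)"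
      using f B by (simp add: C_van_def continuous_on_closed_vimage[OF closed_UNIV])
    then have "compact (f -` B)" using compact_Int_closed[OF K, of "f -` B"] by simp
    then have "compact (g ` (f -` B))"
      by (rule compact_continuous_image[OF continuous_on_subset[OF g subset_UNIV]])
    then have cl: "closed (g ` (f -` B))" by (rule compact_imp_closed)
    have vim: "?T -` B = g ` (f -` B) \<union> (if 0 \<in> B then - V else {})"
    proof (intro equalityI subsetI)
      fix t assume t: "t \<in> ?T -` B"
      show "t \<in> g ` (f -` B) \<union> (if 0 \<in> B then - V else {})"
      proof (cases "t \<in> V")
        case True
        then obtain x where x: "t = g x" using V(2) by blast
        then have "?T (g x) \<in> B" using t by blast
        then have "f x \<in> B" by (simp only: eq)
        with x show ?thesis by blast
      next
        case False
        with t show ?thesis by (cases "0 \<in> B") auto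
      qed
    next
      fix t assume t: "t \<in> g ` (f -` B) \<union> (if 0 \<in> B then - V else {})"
      show "t \<in> ?T -` B"
      proof (cases "t \<in> g ` (f -` B)")
        case True
        then obtain x where "t = g x" "f x \<in> B" by auto
        then have "?T t \<in> B" by (simp only: eq)
        then show ?thesis by (rule vimageI2)
      next
        case False
        with t show ?thesis by (cases "0 \<in> B") auto
      qed
    qed
    have "closed (if 0 \<in> B then - V else {})" using V(1) by (simp add: closed_Compl)
    with cl show ?thesis unfolding vim by (rule closed_Un)
  qed
  then have "continuous_on UNIV ?T" by (simp add: continuous_on_closed_vimage[OF closed_UNIV])
  then show "?T \<in> C_van V" by (simp add: C_van_def)
next
  show "(\<lambda>x. h (g x)) \<in> C_van (g -` V)" if "h \<in> C_van V" for h
  proof -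
    have "continuous_on UNIV (\<lambda>x. h (g x))"
      by (rule continuous_on_compose2[OF _ g subset_UNIV]) (use that in \<open>auto simp: C_van_def\<close>)
    then show ?thesis using that by (simp add: C_van_def)
  qed
next
  show "cl_functional (C_van (g -` V)) (\<lambda>f. if t \<in> V then f (inv g t) else 0)" for t
    by (intro cl_if cl_eval cl_zero)
next
  fix f x assume f: "f \<in> C_van (g -` V)"
  show "(if g x \<in> V then f (inv g (g x)) else 0) = f x"
  proof (cases "g x \<in> V")
    case True
    moreover have "g (inv g (g x)) = g x" by (simp add: f_inv_into_f)
    ultimately have "inv g (g x) = x" using inj[of "inv g (g x)" x] by metis
    with True show ?thesis by simp
  next
    case False
    then show ?thesis using f by (simp add: C_van_def)
  qed
next
  fix h t assume "h \<in> C_van V"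
  moreover have "g (inv g t) = t" if "t \<in> V" using V(2) that by (intro f_inv_into_f) blast
  ultimately show "(if t \<in> V then h (g (inv g t)) else 0) = h t" by (simp add: C_van_def)
qed auto

lemma C_van_affine:
  fixes V :: "real set" and c d :: real
  assumes "c \<noteq> 0"
  shows "C_van ((\<lambda>t. c * t + d) -` V) \<simeq> C_van V"
proof -
  have "continuous_on UNIV (\<lambda>t. f ((t - d) / c))" if "continuous_on UNIV f" for f :: "real \<Rightarrow> real"
    by (rule continuous_on_compose2[OF that _ subset_UNIV])
      (intro continuous_on_divide continuous_on_diff continuous_on_id continuous_on_const, use assms in simp)
  moreover have "continuous_on UNIV (\<lambda>t. f (c * t + d))" if "continuous_on UNIV f" for f :: "real \<Rightarrow> real"
    by (rule continuous_on_compose2[OF that _ subset_UNIV])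
      (intro continuous_on_add continuous_on_mult continuous_on_id continuous_on_const)
  moreover have "c * ((t - d) / c) + d = t" "(c * t + d - d) / c = t" for t
    using assms by auto
  ultimately show ?thesis
    by (intro cl_isoI[where T = "\<lambda>f t. f ((t - d) / c)" and S = "\<lambda>h t. h (c * t + d)"])
      (simp_all add: C_van_def)
qed

text \<open>Take for \<open>H\<close> the union of the copies of \<open>G\<close> in the intervals
  \<open>(1 - 2\<^sup>-\<^sup>n, 1 - 2\<^sup>-\<^sup>n\<^sup>-\<^sup>1)\<close>. The left half of \<open>H\<close> is a copy of \<open>G\<close>, the right half is a copy of
  \<open>H\<close>, and the midpoint is not in \<open>H\<close>, so that functions vanishing off \<open>H\<close> split there.\<close>
lemma self_similar_open_set:
  fixes G :: "real set"
  assumes G: "open G" "G \<subseteq> {0<..<1}"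
  shows "\<exists>H :: real set. open H \<and> H \<subseteq> {0<..<1} \<and> C_van H \<simeq> C_van H \<otimes> C_van G"
proof -
  define H where "H = (\<Union>n. (\<lambda>t. 2 ^ Suc n * (t - 1) + 2) -` G)"
  have H_iff: "t \<in> H \<longleftrightarrow> (\<exists>n. 2 ^ Suc n * (t - 1) + 2 \<in> G)" for t by (auto simp: H_def)
  have "open ((\<lambda>t. 2 ^ Suc n * (t - 1) + 2) -` G)" for n :: nat
    by (rule open_vimage[OF G(1)]) (intro continuous_intros)
  then have "open H" unfolding H_def by blast
  have H01: "H \<subseteq> {0<..<1}"
  proof
    fix t assume "t \<in> H"
    then obtain n where "2 ^ Suc n * (t - 1) + 2 \<in> G" by (auto simp: H_iff)
    moreover define k :: real where "k = 2 ^ Suc n"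
    ultimately have n: "0 < k * (t - 1) + 2" "k * (t - 1) + 2 < 1" using G(2) by auto
    have k: "k \<ge> 2" using one_le_power[of "2::real" n] by (simp add: k_def)
    have "t < 1"
    proof (rule ccontr)
      assume "\<not> t < 1"
      then have "0 \<le> k * (t - 1)" using k by (intro mult_nonneg_nonneg) auto
      with n(2) show False by linarith
    qed
    moreover have "t > 0"
    proof (rule ccontr)
      assume "\<not> t > 0"
      then have "k * (t - 1) \<le> k * (- 1)" using k by (intro mult_left_mono) auto
      then show False using n(1) k by linarith
    qed
    ultimately show "t \<in> {0<..<1}" by simp
  qed
  have upper: "(1 + t) / 2 \<in> H \<longleftrightarrow> t \<in> H" if "t > 0" for t
  proof
    assume "(1 + t) / 2 \<in> H"
    then obtain n where n: "2 ^ Suc n * ((1 + t) / 2 - 1) + 2 \<in> G" unfolding H_iff by blast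
    show "t \<in> H"
    proof (cases n)
      case 0
      have eq: "2 ^ Suc n * ((1 + t) / 2 - 1) + 2 = t + 1" using 0 by (simp add: field_simps)
      have "t + 1 \<in> G" using n unfolding eq .
      then show ?thesis using G(2) that by auto
    next
      case (Suc m)
      have eq: "2 ^ Suc n * ((1 + t) / 2 - 1) + 2 = 2 ^ Suc m * (t - 1) + 2" using Suc by (simp add: field_simps)
      show ?thesis using n unfolding eq H_iff by (rule exI)
    qed
  next
    assume "t \<in> H"
    then obtain n where n: "2 ^ Suc n * (t - 1) + 2 \<in> G" unfolding H_iff by blast
    have eq: "2 ^ Suc n * (t - 1) + 2 = 2 ^ Suc (Suc n) * ((1 + t) / 2 - 1) + 2" by (simp add: field_simps)
    show "(1 + t) / 2 \<in> H" using n unfolding eq H_iff by (rule exI)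
  qed
  have lower: "t / 2 \<in> H \<longleftrightarrow> t \<in> G" if "t \<le> 1" for t
  proof
    assume "t / 2 \<in> H"
    then obtain n where n: "2 ^ Suc n * (t / 2 - 1) + 2 \<in> G" unfolding H_iff by blast
    show "t \<in> G"
    proof (cases n)
      case 0
      then show ?thesis using n by simp
    next
      case (Suc m)
      have "2 ^ Suc n * (t / 2 - 1) \<le> 2 ^ Suc n * (- 1 / 2)" using that by (intro mult_left_mono) auto
      also have "\<dots> \<le> - 2" using Suc one_le_power[of "2::real" m] by simp
      finally show ?thesis using n G(2) by auto
    qed
  next
    assume "t \<in> G"
    then show "t / 2 \<in> H" unfolding H_iff by (intro exI[of _ 0]) simp
  qed
  have half: "1 / 2 \<notin> H" using lower[of 1] G(2) by auto
  let ?T1 = "\<lambda>f t. if 0 \<le> t then f ((1 + t) / 2) else 0 :: real"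
  let ?T2 = "\<lambda>f t. if t \<le> 1 then f (t / 2) else 0 :: real"
  let ?S = "\<lambda>h t. h (Inl (2 * t - 1)) + h (Inr (2 * t)) :: real"
  have "C_van H \<simeq> C_van H \<otimes> C_van G"
  proof (rule cl_isoI[where T = "\<lambda>f. case_sum (?T1 f) (?T2 f)" and S = ?S])
    fix f assume f: "f \<in> C_van H"
    then have cf: "continuous_on UNIV f" and f0: "\<And>t. t \<notin> H \<Longrightarrow> f t = 0" by (auto simp: C_van_def)
    have f2: "continuous_on A (\<lambda>t. f ((1 + t) / 2))" "continuous_on A (\<lambda>t. f (t / 2))" for A
      by (rule continuous_on_compose2[OF cf]; auto intro!: continuous_intros)+
    have "continuous_on ({0..} \<union> {..0}) (?T1 f)"
      by (rule continuous_on_cases) (use f0 half f2 in auto)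
    moreover have "{0..} \<union> {..0} = (UNIV :: real set)" by auto
    ultimately have 1: "continuous_on UNIV (?T1 f)" by simp
    have "continuous_on ({..1} \<union> {1..}) (?T2 f)"
      by (rule continuous_on_cases) (use f0 half f2 in auto)
    moreover have "{..1} \<union> {1..} = (UNIV :: real set)" by auto
    ultimately have 2: "continuous_on UNIV (?T2 f)" by simp
    have "?T1 f t = 0" if "t \<notin> H" for t
      using f0 half upper[of t] that by (cases "t = 0") auto
    moreover have "?T2 f t = 0" if "t \<notin> G" for t using f0 lower[of t] that by auto
    ultimately show "case_sum (?T1 f) (?T2 f) \<in> C_van H \<otimes> C_van G"
      using 1 2 by (simp add: prod_space_def C_van_def)
  next
    fix h assume h: "h \<in> C_van H \<otimes> C_van G"
    then have c1: "continuous_on UNIV (\<lambda>t. h (Inl t))" and z1: "\<And>t. t \<notin> H \<Longrightarrow> h (Inl t) = 0"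
      and c2: "continuous_on UNIV (\<lambda>t. h (Inr t))" and z2: "\<And>t. t \<notin> G \<Longrightarrow> h (Inr t) = 0"
      by (auto simp: prod_space_def C_van_def)
    have "continuous_on UNIV (?S h)"
      by (rule continuous_on_add; rule continuous_on_compose2[OF c1] continuous_on_compose2[OF c2];
          auto intro!: continuous_intros)
    moreover have "?S h t = 0" if t: "t \<notin> H" for t
    proof -
      have "2 * t - 1 \<notin> H" using upper[of "2 * t - 1"] t H01 by auto
      moreover have "2 * t \<notin> G" using lower[of "2 * t"] t G(2) by auto
      ultimately show ?thesis using z1 z2 by simp
    qed
    ultimately show "?S h \<in> C_van H" by (simp add: C_van_def)
    fix y
    have a: "?T1 (?S h) t = h (Inl t)" for t
    proof -
      have "2 * ((1 + t) / 2) - 1 = t" "2 * ((1 + t) / 2) = 1 + t" by (simp_all add: field_simps)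
      moreover have "1 + t \<notin> G" if "0 \<le> t" using that G(2) by auto
      moreover have "t \<notin> H" if "\<not> 0 \<le> t" using that H01 by auto
      ultimately show ?thesis using z1[of t] z2[of "1 + t"] by (simp only: split: if_split) simp
    qed
    have b: "?T2 (?S h) t = h (Inr t)" for t
    proof -
      have "2 * (t / 2) = t" by simp
      moreover have "t - 1 \<notin> H" if "t \<le> 1" using that H01 by auto
      moreover have "t \<notin> G" if "\<not> t \<le> 1" using that G(2) by auto
      ultimately show ?thesis using z1[of "t - 1"] z2[of t] by (simp only: split: if_split) simp
    qed
    show "case_sum (?T1 (?S h)) (?T2 (?S h)) y = h y"
      by (cases y) (simp_all only: sum.case a b)
  next
    show "cl_functional (C_van H) (\<lambda>f. case_sum (?T1 f) (?T2 f) y)" for y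
      by (intro cl_case_sum cl_if cl_eval cl_zero)
    show "cl_functional (C_van H \<otimes> C_van G) (\<lambda>h. ?S h t)" for t
      by (intro cl_add cl_eval)
  next
    fix f t assume f: "f \<in> C_van H"
    then have f0: "\<And>t. t \<notin> H \<Longrightarrow> f t = 0" by (auto simp: C_van_def)
    show "?S (case_sum (?T1 f) (?T2 f)) t = f t"
    proof (cases t "1/2 :: real" rule: linorder_cases)
      case equal
      show ?thesis unfolding equal using f0[OF half] by simp
    qed (use f0[OF half] in auto)
  qed
  with \<open>open H\<close> H01 show ?thesis by blast
qed

lemma absorbing_open_subset:
  fixes V :: "real set"
  assumes V: "open V" "bounded V" and "\<alpha> < (\<beta> :: real)"
  shows "\<exists>W :: real set. open W \<and> W \<subseteq> {\<alpha><..<\<beta>} \<and> C_van W \<simeq> C_van W \<otimes> C_van V"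
proof -
  obtain M where M: "M > 0" "\<And>t. t \<in> V \<Longrightarrow> \<bar>t\<bar> < M"
    using bounded_pos_less[of V] V(2) by auto
  define G where "G = (\<lambda>t. 2 * M * t + - M) -` V"
  have G: "open G" "G \<subseteq> {0<..<1}"
  proof -
    show "open G" unfolding G_def by (rule open_vimage[OF V(1)]) (intro continuous_intros)
    show "G \<subseteq> {0<..<1}"
    proof
      fix t assume "t \<in> G"
      then have "2 * M * t + - M \<in> V" unfolding G_def vimage_def mem_Collect_eq .
      then have "\<bar>2 * M * t + - M\<bar> < M" by (rule M(2))
      then have *: "2 * M * t + - M < M" "- M < 2 * M * t + - M" unfolding abs_less_iff by linarith+
      have "0 < M * t" using * by linarith
      then have "0 < t" using M(1) by (rule zero_less_mult_pos)
      have "M * t < M * 1" using * by linarith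
      then have "t < 1" using M(1) by simp
      with \<open>0 < t\<close> show "t \<in> {0<..<1}" by simp
    qed
  qed
  have "2 * M \<noteq> 0" using M(1) by simp
  then have GV: "C_van G \<simeq> C_van V" unfolding G_def by (rule C_van_affine)
  from self_similar_open_set[OF G] obtain H :: "real set"
    where "open H \<and> H \<subseteq> {0<..<1} \<and> C_van H \<simeq> C_van H \<otimes> C_van G" ..
  then have H: "open H" "H \<subseteq> {0<..<1}" "C_van H \<simeq> C_van H \<otimes> C_van G" by simp_all
  define c where "c = 1 / (\<beta> - \<alpha>)"
  have c: "c > 0" "c * (\<beta> - \<alpha>) = 1" using \<open>\<alpha> < \<beta>\<close> by (auto simp: c_def)
  define W where "W = (\<lambda>t. c * t + - c * \<alpha>) -` H"
  have "c \<noteq> 0" using c(1) by simp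
  then have WH: "C_van W \<simeq> C_van H" unfolding W_def by (rule C_van_affine)
  have "open W" unfolding W_def by (rule open_vimage[OF H(1)]) (intro continuous_intros)
  moreover have "W \<subseteq> {\<alpha><..<\<beta>}"
  proof
    fix t assume "t \<in> W"
    then have "c * t + - c * \<alpha> \<in> H" unfolding W_def vimage_def mem_Collect_eq .
    then have "c * t + - c * \<alpha> \<in> {0<..<1}" using H(2) by (rule subsetD[rotated])
    moreover have "c * t + - c * \<alpha> = c * (t - \<alpha>)" by (simp add: algebra_simps)
    ultimately have *: "0 < c * (t - \<alpha>)" "c * (t - \<alpha>) < c * (\<beta> - \<alpha>)" using c(2) by simp_all
    have "0 < t - \<alpha>" using *(1) c(1) by (rule zero_less_mult_pos)
    moreover have "t - \<alpha> < \<beta> - \<alpha>" using *(2) c(1) by (rule mult_less_cancel_left_pos[THEN iffD1, rotated])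
    ultimately show "t \<in> {\<alpha><..<\<beta>}" by simp
  qed
  moreover have "C_van W \<simeq> C_van W \<otimes> C_van V"
    by (rule cl_iso_trans[OF cl_iso_trans[OF WH H(3)] prod_space_cong[OF cl_iso_sym[OF WH] GV]])
  ultimately show ?thesis by (intro exI[of _ W] conjI)
qed

section \<open>Embedding countable dense orders in the reals\<close>

text \<open>The congruence rule lets the termination proof see that only indices below \<open>n\<close> are used.\<close>
declare image_cong [fundef_cong]

text \<open>A countable dense order without end points, enumerated by \<open>d\<close>, is mapped into \<open>(0,1)\<close> greedily: each
  point is sent to the midpoint between its neighbours among the values assigned before, where \<open>0\<close> and
  \<open>1\<close> stand in for missing neighbours.\<close>
function greedy :: "(nat \<Rightarrow> 'a::linorder) \<Rightarrow> nat \<Rightarrow> real" where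
  "greedy d n = (Max (insert 0 (greedy d ` {i. i < n \<and> d i < d n})) +
                 Min (insert 1 (greedy d ` {i. i < n \<and> d n < d i}))) / 2"
  by auto
termination by (relation "Wellfounded.measure (\<lambda>(d, n). n)") auto

declare greedy.simps [simp del]

lemma greedy_strict_mono:
  assumes "inj d"
  shows "0 < greedy d n \<and> greedy d n < 1 \<and>
    (\<forall>i<n. (d i < d n \<longrightarrow> greedy d i < greedy d n) \<and> (d n < d i \<longrightarrow> greedy d n < greedy d i))"
proof (induction n rule: less_induct)
  case (less n)
  define L where "L = insert 0 (greedy d ` {i. i < n \<and> d i < d n})"
  define U where "U = insert 1 (greedy d ` {i. i < n \<and> d n < d i})"
  have fin: "finite L" "finite U" "L \<noteq> {}" "U \<noteq> {}" by (auto simp: L_def U_def)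
  have LU: "x < y" if "x \<in> L" "y \<in> U" for x y
  proof -
    have "greedy d i < greedy d j" if "i < n" "j < n" "d i < d j" for i j
      using less[OF that(1)] less[OF that(2)] that(3) by (cases i j rule: linorder_cases) auto
    then show ?thesis
      using that less unfolding L_def U_def by (force intro: order.strict_trans)
  qed
  have "Max L < Min U" using LU Max_in[OF fin(1,3)] Min_in[OF fin(2,4)] by blast
  moreover have "greedy d n = (Max L + Min U) / 2" by (simp add: L_def U_def greedy.simps[of d n])
  ultimately have mid: "Max L < greedy d n" "greedy d n < Min U" by auto
  have "x < greedy d n" if "x \<in> L" for x using Max_ge[OF fin(1) that] mid(1) by linarith
  moreover have "greedy d n < x" if "x \<in> U" for x using Min_le[OF fin(2) that] mid(2) by linarith
  ultimately show ?case by (auto simp: L_def U_def)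
qed

lemma finite_cut_between:
  fixes D :: "'a::linorder set"
  assumes dense: "\<And>x y. x \<in> D \<Longrightarrow> y \<in> D \<Longrightarrow> x < y \<Longrightarrow> \<exists>z\<in>D. x < z \<and> z < y"
    and nomax: "\<And>x. x \<in> D \<Longrightarrow> \<exists>y\<in>D. x < y" and nomin: "\<And>x. x \<in> D \<Longrightarrow> \<exists>y\<in>D. y < x"
    and "D \<noteq> {}" and "finite A" "A \<subseteq> D" "finite B" "B \<subseteq> D"
    and AB: "\<And>x y. x \<in> A \<Longrightarrow> y \<in> B \<Longrightarrow> x < y"
  shows "\<exists>z\<in>D. (\<forall>x\<in>A. x < z) \<and> (\<forall>y\<in>B. z < y)"
proof -
  consider "A = {}" "B = {}" | "A = {}" "B \<noteq> {}" | "A \<noteq> {}" "B = {}" | "A \<noteq> {}" "B \<noteq> {}" by blast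
  then show ?thesis
  proof cases
    case 1
    then show ?thesis using \<open>D \<noteq> {}\<close> by auto
  next
    case 2
    then have "Min B \<in> D" using Min_in[of B] assms by blast
    then obtain z where "z \<in> D" "z < Min B" using nomin by blast
    then show ?thesis using 2 assms(7) by (intro bexI[of _ z]) auto
  next
    case 3
    then have "Max A \<in> D" using Max_in[of A] assms by blast
    then obtain z where "z \<in> D" "Max A < z" using nomax by blast
    then show ?thesis using 3 assms(5) by (intro bexI[of _ z]) auto
  next
    case 4
    then have "Max A \<in> A" "Min B \<in> B" using assms(5,7) by auto
    then have "Max A < Min B" "Max A \<in> D" "Min B \<in> D" using AB assms(6,8) by blast+
    then obtain z where "z \<in> D" "Max A < z" "z < Min B" using dense by blast
    then show ?thesis using 4 assms(5,7) by (intro bexI[of _ z]) auto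
  qed
qed

text \<open>Taking midpoints makes the image dense. If the values omitted the interval \<open>(s,t)\<close>, let
  \<open>(a,b)\<close> be the largest omitted interval around it. At some stage the values already chosen come
  within \<open>e = b - a\<close> of both \<open>a\<close> and \<open>b\<close>; the next point of the order that falls in this gap is sent
  to a midpoint which lies strictly between \<open>a\<close> and \<open>b\<close>.\<close>
lemma countable_dense_order_embedding:
  fixes D :: "'a::linorder set"
  assumes "countable D" "D \<noteq> {}"
    and dense: "\<And>x y. x \<in> D \<Longrightarrow> y \<in> D \<Longrightarrow> x < y \<Longrightarrow> \<exists>z\<in>D. x < z \<and> z < y"
    and nomax: "\<And>x. x \<in> D \<Longrightarrow> \<exists>y\<in>D. x < y" and nomin: "\<And>x. x \<in> D \<Longrightarrow> \<exists>y\<in>D. y < x"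
  shows "\<exists>\<phi> :: 'a \<Rightarrow> real. strict_mono_on D \<phi> \<and> \<phi> ` D \<subseteq> {0<..<1} \<and>
    (\<forall>s t. 0 \<le> s \<longrightarrow> s < t \<longrightarrow> t \<le> 1 \<longrightarrow> (\<exists>x\<in>D. s < \<phi> x \<and> \<phi> x < t))"
proof -
  have "infinite D"
  proof
    assume "finite D"
    then have "Max D \<in> D" using \<open>D \<noteq> {}\<close> by simp
    then obtain y where "y \<in> D" "Max D < y" using nomax by blast
    with \<open>finite D\<close> show False by (simp add: leD)
  qed
  define d where "d = from_nat_into D"
  have bij: "bij_betw d UNIV D"
    unfolding d_def using \<open>countable D\<close> \<open>infinite D\<close> by (rule bij_betw_from_nat_into)
  then have inj: "inj d" and dD: "range d = D" by (auto simp: bij_betw_def)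
  define v where "v = greedy d"
  have v01: "0 < v n" "v n < 1" for n using greedy_strict_mono[OF inj, of n] by (auto simp: v_def)
  have vmono: "v i < v j" if "d i < d j" for i j
    using greedy_strict_mono[OF inj, of i] greedy_strict_mono[OF inj, of j] that
    by (cases i j rule: linorder_cases) (auto simp: v_def)
  have vmono': "v i \<le> v j" if "d i \<le> d j" for i j
    using vmono[of i j] that injD[OF inj, of i j] by (cases "i = j") (auto simp: le_less)
  have vless: "d i < d j" if "v i < v j" for i j
    using vmono'[of j i] that by (meson leD le_less_linear)
  have hit: "\<exists>n. s < v n \<and> v n < t" if st: "0 \<le> s" "s < t" "t \<le> 1" for s t
  proof (rule ccontr)
    assume "\<not> ?thesis"
    then have out: "v n \<le> s \<or> t \<le> v n" for n by (meson not_le)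
    define a where "a = Sup (insert 0 {v i |i. v i \<le> s})"
    define b where "b = Inf (insert 1 {v i |i. t \<le> v i})"
    have bdd: "bdd_above (insert 0 {v i |i. v i \<le> s})" "bdd_below (insert 1 {v i |i. t \<le> v i})"
      using st by (auto intro!: bdd_aboveI[of _ s] bdd_belowI[of _ t])
    have a: "a \<le> s" "0 \<le> a" "\<And>i. v i \<le> s \<Longrightarrow> v i \<le> a"
      unfolding a_def using bdd(1) st by (auto intro!: cSup_least cSup_upper)
    have b: "t \<le> b" "b \<le> 1" "\<And>i. t \<le> v i \<Longrightarrow> b \<le> v i"
      unfolding b_def using bdd(2) st by (auto intro!: cInf_greatest cInf_lower)
    define e where "e = b - a"
    have "e > 0" using a(1) b(1) st(2) by (simp add: e_def)
    have "\<exists>x\<in>insert 0 {v i |i. v i \<le> s}. a - e < x"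
      using less_cSup_iff[OF _ bdd(1), of "a - e"] \<open>e > 0\<close> by (simp add: a_def[symmetric])
    then have "\<exists>N. 0 > a - e \<or> (v N \<le> s \<and> v N > a - e)" by auto
    then obtain N1 where N1: "0 > a - e \<or> (v N1 \<le> s \<and> v N1 > a - e)" by blast
    have "\<exists>x\<in>insert 1 {v i |i. t \<le> v i}. x < b + e"
      using cInf_less_iff[OF _ bdd(2), of "b + e"] \<open>e > 0\<close> by (simp add: b_def[symmetric])
    then have "\<exists>N. 1 < b + e \<or> (t \<le> v N \<and> v N < b + e)" by auto
    then obtain N2 where N2: "1 < b + e \<or> (t \<le> v N2 \<and> v N2 < b + e)" by blast
    define N where "N = Suc (max N1 N2)"
    have N12: "N1 < N" "N2 < N" by (auto simp: N_def)
    define A where "A = d ` {i. i < N \<and> v i \<le> s}"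
    define B where "B = d ` {i. i < N \<and> t \<le> v i}"
    define Q where "Q n \<longleftrightarrow> (\<forall>x\<in>A. x < d n) \<and> (\<forall>y\<in>B. d n < y)" for n
    have "\<exists>z\<in>D. (\<forall>x\<in>A. x < z) \<and> (\<forall>y\<in>B. z < y)"
    proof (rule finite_cut_between[OF dense nomax nomin \<open>D \<noteq> {}\<close>])
      show "x < y" if "x \<in> A" "y \<in> B" for x y
        using that st(2) by (auto simp: A_def B_def intro!: vless)
    qed (auto simp: A_def B_def dD[symmetric])
    then have ex: "\<exists>n. Q n" using dD unfolding Q_def by blast
    define n where "n = (LEAST n. Q n)"
    have Qn: "Q n" unfolding n_def using ex by (rule LeastI_ex)
    have nQ: "\<not> Q i" if "i < n" for i using that unfolding n_def by (rule not_less_Least)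
    have "N \<le> n"
    proof (rule ccontr)
      assume "\<not> N \<le> n"
      then have "d n \<in> A \<or> d n \<in> B" using out[of n] by (auto simp: A_def B_def)
      with Qn show False by (auto simp: Q_def)
    qed
    define L where "L = insert 0 (v ` {i. i < n \<and> d i < d n})"
    define U where "U = insert 1 (v ` {i. i < n \<and> d n < d i})"
    have fin: "finite L" "finite U" "L \<noteq> {}" "U \<noteq> {}" by (auto simp: L_def U_def)
    \<comment> \<open>Between stage \<open>N\<close> and stage \<open>n\<close> no point fell in the gap, so the neighbours of \<open>d n\<close> are still those of stage \<open>N\<close>.\<close>
    have side: "(d i < d n \<longrightarrow> v i \<le> s) \<and> (d n < d i \<longrightarrow> t \<le> v i)" if i: "i < n" for i
    proof -
      obtain j where j: "j < N" "(v j \<le> s \<and> d i \<le> d j) \<or> (t \<le> v j \<and> d j \<le> d i)"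
        using nQ[OF i] by (auto simp: Q_def A_def B_def not_less)
      from j(2) show ?thesis
      proof
        assume *: "v j \<le> s \<and> d i \<le> d j"
        then have "d j < d n" using Qn j(1) by (auto simp: Q_def A_def)
        then show ?thesis using * vmono'[of i j] by auto
      next
        assume *: "t \<le> v j \<and> d j \<le> d i"
        then have "d n < d j" using Qn j(1) by (auto simp: Q_def B_def)
        then show ?thesis using * vmono'[of j i] by auto
      qed
    qed
    have "Max L \<le> a" using a side fin by (subst Max_le_iff) (auto simp: L_def)
    have "b \<le> Min U" using b side fin by (subst Min_ge_iff) (auto simp: U_def)
    have "a - e < Max L"
    proof -
      have "0 \<in> L" by (simp add: L_def)
      moreover have "v N1 \<in> L" if "v N1 \<le> s"
        using that N12 \<open>N \<le> n\<close> Qn by (auto simp: L_def Q_def A_def)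
      ultimately have "0 \<le> Max L" "v N1 \<le> s \<Longrightarrow> v N1 \<le> Max L" using fin by auto
      then show ?thesis using N1 by linarith
    qed
    have "Min U < b + e"
    proof -
      have "1 \<in> U" by (simp add: U_def)
      moreover have "v N2 \<in> U" if "t \<le> v N2"
        using that N12 \<open>N \<le> n\<close> Qn by (auto simp: U_def Q_def B_def)
      ultimately have "Min U \<le> 1" "t \<le> v N2 \<Longrightarrow> Min U \<le> v N2" using fin by auto
      then show ?thesis using N2 by linarith
    qed
    have vn: "v n = (Max L + Min U) / 2" unfolding L_def U_def v_def by (rule greedy.simps)
    have "a < v n" "v n < b"
      unfolding vn using \<open>Max L \<le> a\<close> \<open>b \<le> Min U\<close> \<open>a - e < Max L\<close> \<open>Min U < b + e\<close>
      by (simp_all add: e_def field_simps)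
    with a(3)[of n] b(3)[of n] out[of n] show False by linarith
  qed
  define \<phi> where "\<phi> x = v (inv d x)" for x
  have \<phi>d: "\<phi> (d n) = v n" for n by (simp add: \<phi>_def inj)
  show ?thesis
  proof (intro exI[of _ \<phi>] conjI allI impI)
    show "strict_mono_on D \<phi>"
      unfolding dD[symmetric] by (rule strict_mono_onI) (auto simp: \<phi>d intro: vmono)
    show "\<phi> ` D \<subseteq> {0<..<1}" unfolding dD[symmetric] using v01 by (auto simp: \<phi>d)
    show "\<exists>x\<in>D. s < \<phi> x \<and> \<phi> x < t" if "0 \<le> s" "s < t" "t \<le> 1" for s t
      using hit[OF that] unfolding dD[symmetric] by (auto simp: \<phi>d)
  qed
qed

text \<open>A monotone function can be discontinuous only by jumping over an interval of values.\<close>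
lemma mono_dense_range_continuous:
  fixes q :: "'a::linorder_topology \<Rightarrow> real"
  assumes "mono q" and range: "range q \<subseteq> {\<alpha>..\<beta>}"
    and hit: "\<And>s t. \<alpha> \<le> s \<Longrightarrow> s < t \<Longrightarrow> t \<le> \<beta> \<Longrightarrow> \<exists>x. s < q x \<and> q x < t"
  shows "continuous_on UNIV q"
  unfolding continuous_on_def
proof
  fix x
  have r: "\<alpha> \<le> q y" "q y \<le> \<beta>" for y using range by (simp_all add: image_subset_iff)
  show "(q \<longlongrightarrow> q x) (at x)"
  proof (rule order_tendstoI)
    fix a assume a: "a < q x"
    show "eventually (\<lambda>y. a < q y) (at x)"
    proof (cases "a < \<alpha>")
      case True
      then show ?thesis using r(1) by (intro always_eventually) (auto intro: less_le_trans)
    next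
      case False
      then obtain z where z: "a < q z" "q z < q x" using hit[of a "q x"] a r(2) by auto
      then have "z < x" using monoD[OF \<open>mono q\<close>, of x z] by (meson leD le_less_linear)
      then have "eventually (\<lambda>y. z < y) (at x)" using order_tendstoD(1)[OF tendsto_ident_at] by blast
      then show ?thesis
        by (rule eventually_mono) (use z(1) monoD[OF \<open>mono q\<close>] in \<open>auto intro: less_le_trans dest: less_imp_le\<close>)
    qed
  next
    fix a assume a: "q x < a"
    show "eventually (\<lambda>y. q y < a) (at x)"
    proof (cases "\<beta> < a")
      case True
      then show ?thesis using r(2) by (intro always_eventually) (auto intro: le_less_trans)
    next
      case False
      then obtain z where z: "q z < a" "q x < q z" using hit[of "q x" a] a r(1) by auto
      then have "x < z" using monoD[OF \<open>mono q\<close>, of z x] by (meson leD le_less_linear)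
      then have "eventually (\<lambda>y. y < z) (at x)" using order_tendstoD(2)[OF tendsto_ident_at] by blast
      then show ?thesis
        by (rule eventually_mono) (use z(1) monoD[OF \<open>mono q\<close>] in \<open>auto intro: le_less_trans dest: less_imp_le\<close>)
    qed
  qed
qed

lemma monotone_continuous_extension:
  fixes D :: "'a::linorder_topology set" and \<phi> :: "'a \<Rightarrow> real"
  assumes \<phi>: "strict_mono_on D \<phi>" and range: "\<phi> ` D \<subseteq> {\<alpha><..<\<beta>}" and "\<alpha> < \<beta>"
    and hit: "\<And>s t. \<alpha> \<le> s \<Longrightarrow> s < t \<Longrightarrow> t \<le> \<beta> \<Longrightarrow> \<exists>x\<in>D. s < \<phi> x \<and> \<phi> x < t"
  shows "\<exists>q. mono q \<and> continuous_on UNIV q \<and> range q \<subseteq> {\<alpha>..\<beta>} \<and> (\<forall>x\<in>D. q x = \<phi> x)"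
proof -
  define q where "q x = Sup (insert \<alpha> (\<phi> ` {d\<in>D. d \<le> x}))" for x
  have bdd: "bdd_above (insert \<alpha> (\<phi> ` {d\<in>D. d \<le> x}))" for x
    using range \<open>\<alpha> < \<beta>\<close> by (intro bdd_aboveI[of _ \<beta>]) (auto simp: image_subset_iff less_imp_le)
  have "mono q"
    unfolding q_def by (intro monoI cSup_subset_mono bdd) (auto intro: order_trans)
  moreover have rq: "range q \<subseteq> {\<alpha>..\<beta>}"
    unfolding q_def using range \<open>\<alpha> < \<beta>\<close> bdd
    by (auto intro!: cSup_upper cSup_least simp: image_subset_iff less_imp_le)
  moreover have qD: "q x = \<phi> x" if x: "x \<in> D" for x
  proof -
    have "\<phi> d \<le> \<phi> x" if "d \<in> D" "d \<le> x" for d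
      using strict_mono_onD[OF \<phi> that(1) x] that(2) by (cases "d = x") (auto simp: le_less)
    then show ?thesis
      unfolding q_def using x range by (intro cSup_eq_maximum) (auto simp: image_subset_iff less_imp_le)
  qed
  moreover have "continuous_on UNIV q"
    using hit qD by (intro mono_dense_range_continuous[OF \<open>mono q\<close> rq]) metis
  ultimately show ?thesis by blast
qed

section \<open>Baumgartner's axiom and nowhere dense sets\<close>

lemma Cinfinite_omega1: "Cinfinite omega1"
  unfolding omega1_def by (rule Cinfinite_cardSuc) (rule natLeq_Cinfinite)

lemma countable_iff_le_natLeq: "countable X \<longleftrightarrow> |X| \<le>o natLeq"
proof -
  have "countable X \<longleftrightarrow> |X| \<le>o |UNIV :: nat set|"
    unfolding countable_def by (simp flip: card_of_ordLeq)
  then show ?thesis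
    using card_of_nat ordIso_symmetric ordLeq_ordIso_trans by blast
qed

lemma uncountable_iff_omega1_le: "uncountable X \<longleftrightarrow> omega1 \<le>o |X|"
proof -
  have "omega1 \<le>o |X| \<longleftrightarrow> natLeq <o |X|"
    unfolding omega1_def by (rule cardSuc_ordLess_ordLeq[symmetric]) (auto simp: natLeq_Card_order card_of_Card_order)
  also have "\<dots> \<longleftrightarrow> \<not> |X| \<le>o natLeq"
    by (metis card_of_Well_order natLeq_Well_order not_ordLeq_iff_ordLess)
  finally show ?thesis by (simp add: countable_iff_le_natLeq)
qed

lemma countable_le_omega1: "countable X \<Longrightarrow> |X| \<le>o omega1"
  unfolding omega1_def
  by (meson cardSuc_greater natLeq_Card_order countable_iff_le_natLeq ordLeq_ordLess_trans ordLess_imp_ordLeq)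

lemma card_eq_omega1_iff: "|X| =o omega1 \<longleftrightarrow> uncountable X \<and> |X| \<le>o omega1"
  by (auto simp: uncountable_iff_omega1_le ordIso_iff_ordLeq)

lemma interval_chart:
  fixes s t :: real
  assumes "s < t"
  shows "\<exists>\<gamma> :: real \<Rightarrow> real. strict_mono \<gamma> \<and> continuous_on UNIV \<gamma> \<and> range \<gamma> = {s<..<t}"
proof (intro exI conjI)
  define \<gamma> where "\<gamma> x = s + (t - s) * (arctan x / pi + 1 / 2)" for x
  show "strict_mono \<gamma>"
    using assms by (auto simp: strict_mono_def \<gamma>_def arctan_less_iff divide_strict_right_mono)
  show "continuous_on UNIV \<gamma>" unfolding \<gamma>_def by (intro continuous_intros) auto
  show "range \<gamma> = {s<..<t}"
  proof (intro equalityI subsetI)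
    fix y assume "y \<in> range \<gamma>"
    then obtain x where y: "y = \<gamma> x" by blast
    have "- 1 / 2 < arctan x / pi" "arctan x / pi < 1 / 2"
      using arctan_lbound[of x] arctan_ubound[of x] by (auto simp: field_simps)
    then have "0 < arctan x / pi + 1 / 2" "arctan x / pi + 1 / 2 < 1" by linarith+
    then have "0 < (t - s) * (arctan x / pi + 1 / 2)" "(t - s) * (arctan x / pi + 1 / 2) < (t - s) * 1"
      using assms by (intro mult_pos_pos mult_strict_left_mono; simp)+
    then show "y \<in> {s<..<t}" by (simp add: y \<gamma>_def)
  next
    fix y assume y: "y \<in> {s<..<t}"
    define u where "u = (y - s) / (t - s) - 1 / 2"
    have u: "- 1 / 2 < u" "u < 1 / 2" using y by (auto simp: u_def field_simps)
    have "arctan (tan (pi * u)) = pi * u"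
      using mult_strict_left_mono[OF u(1) pi_gt_zero] mult_strict_left_mono[OF u(2) pi_gt_zero]
      by (intro arctan_tan) auto
    then have "\<gamma> (tan (pi * u)) = y" using assms by (simp add: \<gamma>_def u_def)
    then show "y \<in> range \<gamma>" by (metis rangeI)
  qed
qed

text \<open>Let \<open>A'\<close> be the part of \<open>A\<close> in \<open>(s,t)\<close>, carried over to the whole line. To ensure that a point of
  \<open>E\<close> is mapped into \<open>A\<close> only if it belongs to \<open>B\<close>, the set \<open>B\<close> is enlarged to an \<open>\<omega>\<^sub>1\<close>-dense set \<open>B'\<close> by points outside
  \<open>E\<close> only; this is possible as \<open>E\<close> is closed and nowhere dense. An isomorphism from \<open>B'\<close> onto \<open>A'\<close>
  extends to a strictly increasing continuous function, which by injectivity maps no point outside \<open>B'\<close> into \<open>A\<close>.\<close>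
lemma BA_embedding:
  fixes A B E :: "real set"
  assumes BA and st: "0 \<le> s" "s < t" "t \<le> 1"
    and A: "\<And>V. open V \<Longrightarrow> V \<noteq> {} \<Longrightarrow> V \<subseteq> {0<..<1} \<Longrightarrow> |A \<inter> V| =o omega1"
    and E: "closed E" "\<And>a b. a < b \<Longrightarrow> \<exists>x. a < x \<and> x < b \<and> x \<notin> E"
    and B: "B \<subseteq> E" "|B| \<le>o omega1"
  shows "\<exists>h :: real \<Rightarrow> real. strict_mono h \<and> continuous_on UNIV h \<and> range h \<subseteq> {s<..<t} \<and>
    (\<forall>\<tau>\<in>E. h \<tau> \<in> A \<longleftrightarrow> \<tau> \<in> B)"
proof -
  obtain \<gamma> :: "real \<Rightarrow> real" where \<gamma>: "strict_mono \<gamma>" "continuous_on UNIV \<gamma>" "range \<gamma> = {s<..<t}"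
    using interval_chart[OF st(2)] by blast
  have inj: "inj \<gamma>" using \<gamma>(1) by (rule strict_mono_imp_inj_on)
  define A' where "A' = \<gamma> -` A"
  have A': "omega1_dense A'"
    unfolding omega1_dense_def
  proof (intro allI impI)
    fix U :: "real set" assume U: "open U \<and> U \<noteq> {}"
    have "open (\<gamma> ` U)"
      using injective_eq_1d_open_map_UNIV[of UNIV \<gamma>] \<gamma>(2) inj U by (simp add: is_interval_univ)
    moreover have "\<gamma> ` U \<subseteq> {0<..<1}" 
    proof -
      have "range \<gamma> \<subseteq> {0<..<1}" using st unfolding \<gamma>(3) by auto
      then show ?thesis by blast
    qed
    ultimately have "|A \<inter> \<gamma> ` U| =o omega1" using A U by blast
    moreover have "bij_betw \<gamma> (A' \<inter> U) (A \<inter> \<gamma> ` U)"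
      using inj by (auto simp: bij_betw_def A'_def inj_on_def)
    then have "|A' \<inter> U| =o |A \<inter> \<gamma> ` U|" by (rule card_of_ordIsoI)
    ultimately show "|A' \<inter> U| =o omega1" by (rule ordIso_transitive[rotated])
  qed
  define B' where "B' = B \<union> (A' - E)"
  have B': "omega1_dense B'"
    unfolding omega1_dense_def
  proof (intro allI impI)
    fix U :: "real set" assume U: "open U \<and> U \<noteq> {}"
    have "|A' \<inter> U| \<le>o omega1" using A' U by (auto simp: omega1_dense_def ordIso_imp_ordLeq)
    then have "|B \<union> (A' \<inter> U)| \<le>o omega1" using B(2) Cinfinite_omega1 by (intro Un_Cinfinite_bound)
    moreover have "|B' \<inter> U| \<le>o |B \<union> (A' \<inter> U)|" by (rule card_of_mono1) (auto simp: B'_def)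
    ultimately have le: "|B' \<inter> U| \<le>o omega1" by (rule ordLeq_transitive[rotated])
    have "U - E \<noteq> {}"
    proof -
      obtain x where "x \<in> U" using U by blast
      then obtain e where e: "e > 0" "ball x e \<subseteq> U" using U open_contains_ball by blast
      then obtain y where "x < y" "y < x + e" "y \<notin> E" using E(2)[of x "x + e"] by auto
      moreover from this have "y \<in> ball x e" by (auto simp: dist_real_def)
      ultimately show ?thesis using e(2) by blast
    qed
    then have "|A' \<inter> (U - E)| =o omega1"
      using A' open_Diff[of U E] U E(1) by (simp add: omega1_dense_def)
    then have "uncountable (A' \<inter> (U - E))" by (simp add: card_eq_omega1_iff)
    moreover have "A' \<inter> (U - E) \<subseteq> B' \<inter> U" by (auto simp: B'_def)
    ultimately have "uncountable (B' \<inter> U)" using countable_subset by blast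
    with le show "|B' \<inter> U| =o omega1" by (simp add: card_eq_omega1_iff)
  qed
  obtain f where f: "bij_betw f B' A'" "\<forall>x\<in>B'. \<forall>y\<in>B'. x \<le> y \<longleftrightarrow> f x \<le> f y"
    using \<open>BA\<close> A' B' unfolding BA_def order_isomorphic_def by blast
  have hitU: "\<exists>x\<in>X. x \<in> U" if "omega1_dense X" "open U" "U \<noteq> {}" for X U :: "real set"
  proof -
    have "uncountable (X \<inter> U)" using that by (auto simp: omega1_dense_def card_eq_omega1_iff)
    then have "X \<inter> U \<noteq> {}" by (metis countable_empty)
    then show ?thesis by blast
  qed
  have sm: "strict_mono_on B' (\<lambda>x. \<gamma> (f x))"
  proof (rule strict_mono_onI)
    fix x y assume "x \<in> B'" "y \<in> B'" "x < y"
    then have "f x < f y" using f(2) by (meson leD le_less_linear)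
    then show "\<gamma> (f x) < \<gamma> (f y)" using \<gamma>(1) by (simp add: strict_mono_def)
  qed
  have "\<exists>q. mono q \<and> continuous_on UNIV q \<and> range q \<subseteq> {s..t} \<and> (\<forall>x\<in>B'. q x = \<gamma> (f x))"
  proof (rule monotone_continuous_extension[OF sm _ st(2)])
    show "(\<lambda>x. \<gamma> (f x)) ` B' \<subseteq> {s<..<t}" using \<gamma>(3) by auto
    fix s' t' :: real assume st': "s \<le> s'" "s' < t'" "t' \<le> t"
    have "open (\<gamma> -` {s'<..<t'})" using \<gamma>(2) by (intro open_vimage) auto
    moreover have "\<gamma> -` {s'<..<t'} \<noteq> {}"
    proof -
      have "(s' + t') / 2 \<in> range \<gamma>" using st' by (auto simp: \<gamma>(3))
      then obtain x where "\<gamma> x = (s' + t') / 2" by (metis imageE)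
      then have "x \<in> \<gamma> -` {s'<..<t'}" using st'(2) by simp
      then show ?thesis by blast
    qed
    ultimately obtain a where a: "a \<in> A'" "\<gamma> a \<in> {s'<..<t'}" using hitU[OF A'] by blast
    then obtain x where "x \<in> B'" "a = f x" using f(1) by (auto simp: bij_betw_def)
    then show "\<exists>x\<in>B'. s' < \<gamma> (f x) \<and> \<gamma> (f x) < t'" using a by auto
  qed
  then obtain h where h: "mono h" "continuous_on UNIV h" "\<And>x. x \<in> B' \<Longrightarrow> h x = \<gamma> (f x)" by blast
  have between: "\<exists>b\<in>B'. x < b \<and> b < y" if "x < y" for x y
    using hitU[OF B', of "{x<..<y}"] that by auto
  have hsm: "strict_mono h"
  proof (rule strict_monoI)
    fix x y :: real assume "x < y"
    then obtain b where b: "b \<in> B'" "x < b" "b < y" using between by blast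
    then obtain c where c: "c \<in> B'" "b < c" "c < y" using between by blast
    have "h x \<le> h b" "h c \<le> h y" using monoD[OF h(1)] b c by auto
    moreover have "h b < h c" using strict_mono_onD[OF sm b(1) c(1) c(2)] h(3) b c by simp
    ultimately show "h x < h y" by simp
  qed
  have hr: "h x \<in> {s<..<t}" for x
  proof -
    obtain b c where "b \<in> B'" "b < x" "c \<in> B'" "x < c" using between[of "x - 1" x] between[of x "x + 1"] by auto
    moreover have "\<gamma> z \<in> {s<..<t}" for z using \<gamma>(3) by blast
    ultimately have "h b < h x" "h x < h c" "h b \<in> {s<..<t}" "h c \<in> {s<..<t}"
      using strict_monoD[OF hsm] h(3) by metis+
    then show ?thesis by auto
  qed
  have "h \<tau> \<in> A \<longleftrightarrow> \<tau> \<in> B" if \<tau>: "\<tau> \<in> E" for \<tau>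
  proof
    assume "h \<tau> \<in> A"
    obtain a where a: "h \<tau> = \<gamma> a" using hr[of \<tau>] \<gamma>(3) by blast
    then have "a \<in> A'" using \<open>h \<tau> \<in> A\<close> by (simp add: A'_def)
    then obtain b where b: "b \<in> B'" "a = f b" using f(1) by (auto simp: bij_betw_def)
    then have "h b = h \<tau>" using h(3) a by simp
    then have "b = \<tau>" using hsm by (simp add: strict_mono_eq)
    then show "\<tau> \<in> B" using b(1) \<tau> by (simp add: B'_def)
  next
    assume "\<tau> \<in> B"
    then have "\<tau> \<in> B'" by (simp add: B'_def)
    moreover then have "f \<tau> \<in> A'" using f(1) by (auto simp: bij_betw_def)
    ultimately show "h \<tau> \<in> A" using h(3) by (simp add: A'_def)
  qed
  then show ?thesis using hsm h(2) hr by blast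
qed

text \<open>The weighted sum \<open>\<Sum>n. 2\<^sup>-\<^sup>n f\<^sub>n\<close> separates exactly the points separated by some \<open>f\<^sub>n\<close>.\<close>
lemma countable_monotone_sum:
  fixes F :: "('a::linorder_topology \<Rightarrow> real) set"
  assumes "countable F"
    and F: "\<And>f. f \<in> F \<Longrightarrow> mono_on S f \<and> continuous_on S f \<and> f ` S \<subseteq> {0..1}"
  shows "\<exists>p :: 'a \<Rightarrow> real. mono_on S p \<and> continuous_on S p \<and>
    (\<forall>x\<in>S. \<forall>y\<in>S. x < y \<longrightarrow> (p x < p y \<longleftrightarrow> (\<exists>f\<in>F. f x < f y)))"
proof (cases "F = {}")
  case True
  then show ?thesis by (intro exI[of _ "\<lambda>_. 0"]) (auto simp: mono_on_def)
next
  case False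
  define f where "f = from_nat_into F"
  have rf: "range f = F" unfolding f_def using False \<open>countable F\<close> by (rule range_from_nat_into)
  have fm: "f n x \<le> f n y" if "x \<in> S" "y \<in> S" "x \<le> y" for n x y
    using F[of "f n"] rf that by (auto simp: mono_on_def)
  have fc: "continuous_on S (f n)" for n using F[of "f n"] rf by auto
  have f01: "0 \<le> f n x" "f n x \<le> 1" if "x \<in> S" for n x
    using F[of "f n"] rf that by (auto simp: image_subset_iff)
  have sg: "summable (\<lambda>n. (1 / 2 :: real) ^ n)" by (rule summable_geometric) simp
  have bd: "norm ((1 / 2) ^ n * f n x) \<le> (1 / 2) ^ n" if "x \<in> S" for n x
    using f01[OF that, of n] by (simp add: norm_mult mult_left_le)
  have sm: "summable (\<lambda>n. (1 / 2) ^ n * f n x)" if "x \<in> S" for x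
    by (rule summable_comparison_test'[OF sg, of 0]) (rule bd[OF that])
  define p where "p x = (\<Sum>n. (1 / 2) ^ n * f n x)" for x
  have "uniform_limit S (\<lambda>n x. \<Sum>i<n. (1 / 2) ^ i * f i x) p sequentially"
    unfolding p_def by (rule Weierstrass_m_test[OF bd sg])
  then have "continuous_on S p"
    by (rule uniform_limit_theorem[rotated])
      (auto intro!: always_eventually continuous_intros fc)
  have diff: "p y - p x = (\<Sum>n. (1 / 2) ^ n * (f n y - f n x))"
    and sd: "summable (\<lambda>n. (1 / 2) ^ n * (f n y - f n x))" if "x \<in> S" "y \<in> S" for x y
    using suminf_diff[OF sm[OF that(2)] sm[OF that(1)]] summable_diff[OF sm[OF that(2)] sm[OF that(1)]]
    by (simp_all add: p_def right_diff_distrib)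
  have "mono_on S p"
    unfolding mono_on_def
  proof (intro allI impI)
    fix x y assume xy: "x \<in> S \<and> y \<in> S \<and> x \<le> y"
    then have "0 \<le> p y - p x"
      unfolding diff[OF xy[THEN conjunct1] xy[THEN conjunct2, THEN conjunct1]]
      using sd fm by (intro suminf_nonneg) auto
    then show "p x \<le> p y" by simp
  qed
  moreover have "p x < p y \<longleftrightarrow> (\<exists>f\<in>F. f x < f y)" if xy: "x \<in> S" "y \<in> S" "x < y" for x y
  proof -
    have "p x < p y \<longleftrightarrow> 0 < (\<Sum>n. (1 / 2) ^ n * (f n y - f n x))"
      using diff[OF xy(1,2)] by linarith
    also have "\<dots> \<longleftrightarrow> (\<exists>n. 0 < (1 / 2) ^ n * (f n y - f n x))"
      using xy fm by (intro suminf_pos_iff sd) auto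
    also have "\<dots> \<longleftrightarrow> (\<exists>n. f n x < f n y)" by (simp add: zero_less_mult_iff)
    finally show ?thesis unfolding rf[symmetric] by simp
  qed
  ultimately show ?thesis using \<open>continuous_on S p\<close> by blast
qed

section \<open>Jumps of a separable compact line\<close>

text \<open>A jump is represented by the left one of its two adjacent points.\<close>
definition jumps :: "'a::linorder set" where
  "jumps = {c. \<exists>d>c. {c<..<d} = {}}"

text \<open>For a jump \<open>c\<close> the set \<open>{..c}\<close> is open, so the base contains a set with maximum \<open>c\<close>; different jumps
  need different sets.\<close>
lemma card_jumps_le_basis:
  fixes B :: "'a::linorder_topology set set"
  assumes "topological_basis B"
  shows "|jumps :: 'a set| \<le>o |B|"
proof -
  have "\<exists>U\<in>B. c \<in> U \<and> U \<subseteq> {..c}" if c: "c \<in> jumps" for c :: 'a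
  proof -
    obtain d where d: "d > c" "{c<..<d} = {}" using c by (auto simp: jumps_def)
    then have "{..c} = {..<d}" by (auto simp: set_eq_iff) (meson not_le)+
    then have "open {..c}" by simp
    from topological_basisE[OF assms this, of c] show ?thesis by (metis atMost_iff order_refl)
  qed
  then obtain U where U: "\<And>c. c \<in> jumps \<Longrightarrow> U c \<in> B \<and> c \<in> U c \<and> U c \<subseteq> {..(c::'a)}" by metis
  have "inj_on U jumps"
  proof (rule inj_onI)
    fix c c' :: 'a assume c: "c \<in> jumps" "c' \<in> jumps" "U c = U c'"
    then have "c \<in> U c'" "c' \<in> U c" using U[of c] U[of c'] by simp_all
    then have "c \<le> c'" "c' \<le> c" using U[OF c(1)] U[OF c(2)] by blast+
    then show "c = c'" by (rule order_antisym)
  qed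
  moreover have "U ` jumps \<subseteq> B" using U by blast
  ultimately show ?thesis unfolding card_of_ordLeq[symmetric] by (intro exI[of _ U] conjI)
qed

locale separable_compact_line =
  fixes D :: "'a::linorder_topology set"
  assumes compact_line: "compact (UNIV :: 'a set)"
    and countable_D: "countable D"
    and dense_D: "\<And>U. open U \<Longrightarrow> U \<noteq> {} \<Longrightarrow> \<exists>d\<in>D. d \<in> U"
begin

lemma closed_has_max: "closed T \<Longrightarrow> T \<noteq> {} \<Longrightarrow> \<exists>m\<in>T. \<forall>x\<in>T. x \<le> m" for T :: "'a set"
  using compact_attains_sup[of T] compact_Int_closed[OF compact_line, of T] by auto

lemma closed_has_min: "closed T \<Longrightarrow> T \<noteq> {} \<Longrightarrow> \<exists>m\<in>T. \<forall>x\<in>T. m \<le> x" for T :: "'a set"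
  using compact_attains_inf[of T] compact_Int_closed[OF compact_line, of T] by auto

lemma dense_between: "{x<..<y} \<noteq> {} \<Longrightarrow> \<exists>d\<in>D. x < d \<and> d < y" for x y :: 'a
  using dense_D[OF open_greaterThanLessThan, of x y] by simp

text \<open>Intervals with end points in \<open>D\<close> or at jumps form a base: an open interval next to a point either
  meets \<open>D\<close> or is empty, in which case its ends form a jump.\<close>
lemma countable_basis_if_countable_jumps:
  assumes "countable (jumps :: 'a set)"
  shows "\<exists>B :: 'a set set. topological_basis B \<and> countable B"
proof -
  define succ where "succ c = (SOME d. c < d \<and> {c<..<d} = {})" for c :: 'a
  have succ: "c < succ c \<and> {c<..<succ c} = {}" if "c < d" "{c<..<d} = {}" for c d
    unfolding succ_def by (rule someI[of _ d]) (use that in simp)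
  have succ_eq: "succ c = d" if "c < d" "{c<..<d} = {}" for c d
    using succ[OF that] that by (cases "succ c" d rule: linorder_cases) auto
  define D' where "D' = D \<union> jumps \<union> succ ` jumps"
  have "countable D'" using assms countable_D by (simp add: D'_def)
  define \<L> where "\<L> = insert UNIV (greaterThan ` D')"
  define \<R> where "\<R> = insert UNIV (lessThan ` D')"
  define B where "B = (\<lambda>(L, R). L \<inter> R) ` (\<L> \<times> \<R>)"
  have "countable B" using \<open>countable D'\<close> by (simp add: B_def \<L>_def \<R>_def)
  moreover have "topological_basis B"
  proof (rule topological_basisI)
    show "open U" if "U \<in> B" for U using that by (auto simp: B_def \<L>_def \<R>_def)
    fix O' :: "'a set" and x assume O: "open O'" "x \<in> O'"
    have "\<exists>L\<in>\<L>. x \<in> L \<and> (\<forall>z\<in>L. z \<le> x \<longrightarrow> z \<in> O')"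
    proof (cases "\<exists>y. y < x")
      case False
      then show ?thesis using O(2) by (intro bexI[of _ UNIV]) (auto simp: \<L>_def not_less dest: order_antisym)
    next
      case True
      then obtain y where y: "y < x" "{y<..x} \<subseteq> O'" using open_left[OF O] by blast
      have "\<exists>a\<in>D'. y \<le> a \<and> a < x"
      proof (cases "{y<..<x} = {}")
        case True
        then show ?thesis using y(1) by (intro bexI[of _ y]) (auto simp: D'_def jumps_def)
      next
        case False
        then obtain d where "d \<in> D" "y < d" "d < x" using dense_between by blast
        then show ?thesis by (intro bexI[of _ d]) (auto simp: D'_def)
      qed
      then obtain a where "a \<in> D'" "y \<le> a" "a < x" by blast
      then show ?thesis using y(2) by (intro bexI[of _ "{a<..}"]) (auto simp: \<L>_def subset_iff)
    qed
    then obtain L where L: "L \<in> \<L>" "x \<in> L" "\<And>z. z \<in> L \<Longrightarrow> z \<le> x \<Longrightarrow> z \<in> O'" by blast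
    have "\<exists>R\<in>\<R>. x \<in> R \<and> (\<forall>z\<in>R. x \<le> z \<longrightarrow> z \<in> O')"
    proof (cases "\<exists>y. x < y")
      case False
      then show ?thesis using O(2) by (intro bexI[of _ UNIV]) (auto simp: \<R>_def not_less dest: order_antisym)
    next
      case True
      then obtain y where y: "x < y" "{x..<y} \<subseteq> O'" using open_right[OF O] by blast
      have "\<exists>a\<in>D'. a \<le> y \<and> x < a"
      proof (cases "{x<..<y} = {}")
        case True
        then have "x \<in> jumps" "succ x = y" using y(1) succ_eq by (auto simp: jumps_def)
        then show ?thesis using y(1) by (intro bexI[of _ y]) (auto simp: D'_def)
      next
        case False
        then obtain d where "d \<in> D" "x < d" "d < y" using dense_between by blast
        then show ?thesis by (intro bexI[of _ d]) (auto simp: D'_def)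
      qed
      then obtain a where "a \<in> D'" "a \<le> y" "x < a" by blast
      then show ?thesis using y(2) by (intro bexI[of _ "{..<a}"]) (auto simp: \<R>_def subset_iff)
    qed
    then obtain R where R: "R \<in> \<R>" "x \<in> R" "\<And>z. z \<in> R \<Longrightarrow> x \<le> z \<Longrightarrow> z \<in> O'" by blast
    have "L \<inter> R \<in> B" using L(1) R(1) by (auto simp: B_def)
    moreover have "L \<inter> R \<subseteq> O'" using L(3) R(3) linear by blast
    ultimately show "\<exists>B'\<in>B. x \<in> B' \<and> B' \<subseteq> O'" using L(2) R(2) by blast
  qed
  ultimately show ?thesis by blast
qed

lemma card_jumps_eq_omega1:
  assumes "weight_is TYPE('a) omega1"
  shows "|jumps :: 'a set| =o omega1"
proof -
  obtain B :: "'a set set" where B: "topological_basis B" "|B| =o omega1"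
    using assms unfolding weight_is_def by blast
  have "|jumps :: 'a set| \<le>o omega1" by (rule ordLeq_ordIso_trans[OF card_jumps_le_basis[OF B(1)] B(2)])
  moreover have "uncountable (jumps :: 'a set)"
  proof
    assume "countable (jumps :: 'a set)"
    then obtain B' :: "'a set set" where B': "topological_basis B'" "countable B'"
      using countable_basis_if_countable_jumps by blast
    then have "omega1 \<le>o |B'|" using assms unfolding weight_is_def by blast
    with B'(2) show False using uncountable_iff_omega1_le by blast
  qed
  ultimately show ?thesis by (simp add: card_eq_omega1_iff)
qed

section \<open>The quotient of the line by countable sets of jumps\<close>

text \<open>The negation of \<open>far\<close> (in both directions) is a convex equivalence relation. Collapsing its classes
  leaves a densely ordered quotient.\<close>
definition far :: "'a \<Rightarrow> 'a \<Rightarrow> bool" where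
  "far x y \<longleftrightarrow> x < y \<and> uncountable (jumps \<inter> {x..<y})"

lemma far_less: "far x y \<Longrightarrow> x < y" by (simp add: far_def)

lemma far_mono: "far x y \<Longrightarrow> x' \<le> x \<Longrightarrow> y \<le> y' \<Longrightarrow> far x' y'"
proof -
  assume *: "far x y" "x' \<le> x" "y \<le> y'"
  then have "jumps \<inter> {x..<y} \<subseteq> jumps \<inter> {x'..<y'}" by auto
  then have "uncountable (jumps \<inter> {x'..<y'})" using *(1) countable_subset unfolding far_def by blast
  moreover have "x' < y'" using * far_less[OF *(1)] by order
  ultimately show "far x' y'" by (simp add: far_def)
qed

lemma far_cases: "far x z \<Longrightarrow> far x y \<or> far y z"
proof (rule ccontr)
  assume xz: "far x z" and "\<not> (far x y \<or> far y z)"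
  then have n: "\<not> far x y" "\<not> far y z" by auto
  have "x < y" using n(2) far_mono[OF xz, of y z] by (cases "x < y") auto
  moreover have "y < z" using n(1) far_mono[OF xz, of x y] by (cases "y < z") auto
  ultimately have "countable (jumps \<inter> {x..<y} \<union> jumps \<inter> {y..<z})" using n by (auto simp: far_def)
  moreover have "jumps \<inter> {x..<z} \<subseteq> jumps \<inter> {x..<y} \<union> jumps \<inter> {y..<z}" by auto
  ultimately have "countable (jumps \<inter> {x..<z})" by (rule countable_subset[rotated])
  then show False using xz by (simp add: far_def)
qed

text \<open>If every \<open>e \<in> D\<close> between \<open>x\<close> and \<open>y\<close> had only countably many jumps on one side, these countably many
  countable sets would cover all jumps from \<open>x\<close> to \<open>y\<close>, except for jumps with no point of \<open>D\<close>
  between them. Any two of these exceptions are adjacent points, so there are only finitely many.\<close>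
lemma far_split:
  assumes "far x y"
  shows "\<exists>e\<in>D. far x e \<and> far e y"
proof (rule ccontr)
  assume no: "\<not> ?thesis"
  have xy: "x < y" using assms by (rule far_less)
  define J where "J a b = jumps \<inter> {a..<b}" for a b :: 'a
  define E where "E = {e\<in>D. x < e \<and> e < y}"
  have "countable E" using countable_D by (simp add: E_def)
  define E1 where "E1 = {e\<in>E. countable (J x e)}"
  define E2 where "E2 = {e\<in>E. countable (J e y)}"
  have E12: "E = E1 \<union> E2" using no by (auto simp: E_def E1_def E2_def far_def J_def)
  define C where "C = (\<Union>e\<in>E1. J x e) \<union> (\<Union>e\<in>E2. J e y)"
  have "countable E1" "countable E2" using \<open>countable E\<close> by (simp_all add: E1_def E2_def)
  then have "countable C"
    unfolding C_def by (intro countable_Un countable_UN) (auto simp: E1_def E2_def)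
  define L where "L = J x y - C"
  have adj: "{c1<..<c2} = {}" if c: "c1 \<in> L" "c2 \<in> L" "c1 < c2" for c1 c2
  proof (rule ccontr)
    assume "{c1<..<c2} \<noteq> {}"
    then obtain e where e: "e \<in> D" "c1 < e" "e < c2" using dense_between by blast
    have "e \<in> E" using c e by (auto simp: E_def L_def J_def)
    then consider "e \<in> E1" | "e \<in> E2" using E12 by blast
    then show False
    proof cases
      case 1
      then have "c1 \<in> C" using c e by (auto simp: C_def L_def J_def)
      with c(1) show False by (simp add: L_def)
    next
      case 2
      then have "c2 \<in> C" using c e by (auto simp: C_def L_def J_def)
      with c(2) show False by (simp add: L_def)
    qed
  qed
  have "finite L"
  proof (cases "L = {}")
    case False
    then obtain c where c: "c \<in> L" by blast
    have "\<exists>u. {z\<in>L. c < z} \<subseteq> {u}"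
    proof (cases "{z\<in>L. c < z} = {}")
      case False
      then obtain u where u: "u \<in> L" "c < u" by blast
      have "z = u" if "z \<in> L" "c < z" for z
        using adj[OF c u(1,2)] adj[OF c that] u that by (cases z u rule: linorder_cases) auto
      then show ?thesis by blast
    qed auto
    moreover have "\<exists>u. {z\<in>L. z < c} \<subseteq> {u}"
    proof (cases "{z\<in>L. z < c} = {}")
      case False
      then obtain u where u: "u \<in> L" "u < c" by blast
      have "z = u" if "z \<in> L" "z < c" for z
        using adj[OF u(1) c u(2)] adj[OF that(1) c that(2)] u that by (cases z u rule: linorder_cases) auto
      then show ?thesis by blast
    qed auto
    ultimately have "finite {z\<in>L. c < z}" "finite {z\<in>L. z < c}" by (auto intro: finite_subset)
    moreover have "L \<subseteq> {z\<in>L. c < z} \<union> {z\<in>L. z < c} \<union> {c}" by auto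
    ultimately show ?thesis by (meson finite.emptyI finite.insertI finite_UnI finite_subset)
  qed simp
  then have "countable (C \<union> L)" using \<open>countable C\<close> by (simp add: countable_finite)
  moreover have "J x y \<subseteq> C \<union> L" by (auto simp: L_def)
  ultimately have "countable (J x y)" by (rule countable_subset[rotated])
  with assms show False by (simp add: far_def J_def)
qed

text \<open>Choose one representative from each class that meets \<open>D\<close>, leaving out the classes of the two ends of
  the line. By \<open>far_split\<close> this is a countable dense order without end points. Embed it densely in \<open>(0,1)\<close>
  and extend the embedding to a monotone continuous map \<open>q\<close>.\<close>
lemma quotient_onto_interval:
  assumes unc: "uncountable (jumps :: 'a set)"
  shows "\<exists>q :: 'a \<Rightarrow> real. mono q \<and> continuous_on UNIV q \<and> range q \<subseteq> {0..1} \<and>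
    (\<forall>x y. far x y \<longrightarrow> q x < q y) \<and>
    (\<forall>s t. 0 \<le> s \<longrightarrow> s < t \<longrightarrow> t \<le> 1 \<longrightarrow> (\<exists>x y. far x y \<and> s < q x \<and> q y < t))"
proof -
  obtain b t :: 'a where b: "\<And>x. b \<le> x" and t: "\<And>x. x \<le> t"
    using closed_has_min[of UNIV] closed_has_max[of UNIV] by auto
  have "jumps \<subseteq> {b..<t}"
    using b t by (auto simp: jumps_def) (metis le_less_trans not_le)
  then have "jumps \<inter> {b..<t} = jumps" by blast
  moreover have "b < t"
  proof (rule ccontr)
    assume "\<not> b < t"
    then have "jumps = ({} :: 'a set)" using \<open>jumps \<subseteq> {b..<t}\<close> by auto
    then show False using unc by simp
  qed
  ultimately have bt: "far b t" using unc by (simp add: far_def)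
  define near where "near x y \<longleftrightarrow> \<not> far x y \<and> \<not> far y x" for x y
  have near_sym: "near x y \<Longrightarrow> near y x" for x y by (auto simp: near_def)
  have near_refl: "near x x" for x by (auto simp: near_def far_def)
  have near_trans: "near x y \<Longrightarrow> near y z \<Longrightarrow> near x z" for x y z
    using far_cases unfolding near_def by blast
  have near_far: "near d e \<Longrightarrow> far x e \<Longrightarrow> far x d" "near d e \<Longrightarrow> far e x \<Longrightarrow> far d x" for d e x
    using far_cases unfolding near_def by blast+
  define rep where "rep e = (SOME d. d \<in> D \<and> near d e)" for e
  have rep: "rep e \<in> D" "near (rep e) e" if "e \<in> D" for e
    using someI[of "\<lambda>d. d \<in> D \<and> near d e" e] that near_refl unfolding rep_def by auto
  have rep_eq: "rep e = rep e'" if "near e e'" for e e'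
  proof -
    have "near d e \<longleftrightarrow> near d e'" for d using that near_trans near_sym by blast
    then show ?thesis by (simp add: rep_def)
  qed
  define D1 where "D1 = rep ` {e\<in>D. far b e \<and> far e t}"
  have D1_I: "rep e \<in> D1" if "e \<in> D" "far x e" "far e y" for e x y
    using that far_mono b t unfolding D1_def by blast
  have D1_far: "far b d" "far d t" "d \<in> D" if "d \<in> D1" for d
    using that near_far rep unfolding D1_def by blast+
  have far_D1: "far d d'" if d: "d \<in> D1" "d' \<in> D1" "d < d'" for d d'
  proof (rule ccontr)
    assume "\<not> far d d'"
    then have "near d d'" using d(3) by (auto simp: near_def far_def)
    obtain e e' where e: "e \<in> D" "d = rep e" "e' \<in> D" "d' = rep e'" using d by (auto simp: D1_def)
    then have "near e e'" using \<open>near d d'\<close> rep near_trans near_sym by metis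
    then show False using rep_eq e d(3) by auto
  qed
  have split: "\<exists>d\<in>D1. far x d \<and> far d y" if far: "far x y" for x y
  proof -
    obtain e where e: "e \<in> D" "far x e" "far e y" using far_split[OF far] by blast
    then show ?thesis using D1_I[OF e] near_far[OF rep(2)[OF e(1)]] by blast
  qed
  have "\<exists>\<phi> :: 'a \<Rightarrow> real. strict_mono_on D1 \<phi> \<and> \<phi> ` D1 \<subseteq> {0<..<1} \<and>
    (\<forall>s t. 0 \<le> s \<longrightarrow> s < t \<longrightarrow> t \<le> 1 \<longrightarrow> (\<exists>x\<in>D1. s < \<phi> x \<and> \<phi> x < t))"
  proof (rule countable_dense_order_embedding)
    show "countable D1" using countable_D by (simp add: D1_def)
    show "D1 \<noteq> {}" using split[OF bt] by blast
    show "\<exists>z\<in>D1. x < z \<and> z < y" if "x \<in> D1" "y \<in> D1" "x < y" for x y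
      using split[OF far_D1[OF that]] far_less by blast
    show "\<exists>y\<in>D1. x < y" if "x \<in> D1" for x using split[OF D1_far(2)[OF that]] far_less by blast
    show "\<exists>y\<in>D1. y < x" if "x \<in> D1" for x using split[OF D1_far(1)[OF that]] far_less by blast
  qed
  then obtain \<phi> :: "'a \<Rightarrow> real" where \<phi>: "strict_mono_on D1 \<phi>" "\<phi> ` D1 \<subseteq> {0<..<1}"
    "\<And>s t. 0 \<le> s \<Longrightarrow> s < t \<Longrightarrow> t \<le> 1 \<Longrightarrow> \<exists>x\<in>D1. s < \<phi> x \<and> \<phi> x < t" by blast
  obtain q where q: "mono q" "continuous_on UNIV q" "range q \<subseteq> {0..1}" "\<And>x. x \<in> D1 \<Longrightarrow> q x = \<phi> x"
    using monotone_continuous_extension[OF \<phi>(1,2) zero_less_one \<phi>(3)] by blast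
  have "q x < q y" if xy: "far x y" for x y
  proof -
    obtain d where d: "d \<in> D1" "far x d" "far d y" using split[OF xy] by blast
    obtain d' where d': "d' \<in> D1" "far d d'" "far d' y" using split[OF d(3)] by blast
    have "q x \<le> q d" "q d' \<le> q y"
      using monoD[OF q(1)] d(2) d'(3) by (auto dest!: far_less intro: less_imp_le)
    moreover have "q d < q d'"
      using strict_mono_onD[OF \<phi>(1) d(1) d'(1) far_less[OF d'(2)]] q(4) d(1) d'(1) by simp
    ultimately show ?thesis by linarith
  qed
  moreover have "\<exists>x y. far x y \<and> s < q x \<and> q y < t'" if st: "0 \<le> s" "s < t'" "t' \<le> 1" for s t'
  proof -
    obtain d where d: "d \<in> D1" "s < \<phi> d" "\<phi> d < t'" using \<phi>(3)[OF st] by blast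
    then obtain d' where d': "d' \<in> D1" "\<phi> d < \<phi> d'" "\<phi> d' < t'" using \<phi>(3)[of "\<phi> d" t'] st by auto
    have "d < d'"
      using strict_mono_onD[OF \<phi>(1) d'(1) d(1)] d'(2) by (cases d d' rule: linorder_cases) auto
    have "q d = \<phi> d" "q d' = \<phi> d'" using q(4) d(1) d'(1) by simp_all
    then show ?thesis using far_D1[OF d(1) d'(1) \<open>d < d'\<close>] d(2) d'(3) by metis
  qed
  ultimately show ?thesis using q(1-3) by (intro exI[of _ q] conjI allI impI) simp_all
qed

text \<open>The map \<open>q\<close> skips no interval of values, hence the two points of a jump have the same image, which is therefore a point with several preimages. A
  fibre contains only countably many jumps, whereas there are uncountably many jumps over every interval, so
  these images are uncountable in number. Conversely every nondegenerate fibre contains a jump or a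
  point of \<open>D\<close>.\<close>
lemma omega1_dense_quotient:
  assumes card: "|jumps :: 'a set| =o omega1"
  shows "\<exists>q :: 'a \<Rightarrow> real. mono q \<and> continuous_on UNIV q \<and> {0<..<1} \<subseteq> range q \<and>
    (\<forall>V. open V \<longrightarrow> V \<noteq> {} \<longrightarrow> V \<subseteq> {0<..<1} \<longrightarrow>
       |{\<tau>. \<exists>x y. x < y \<and> q x = \<tau> \<and> q y = \<tau>} \<inter> V| =o omega1)"
proof -
  have unc: "uncountable (jumps :: 'a set)" and le: "|jumps :: 'a set| \<le>o omega1"
    using card by (auto simp: card_eq_omega1_iff)
  obtain q :: "'a \<Rightarrow> real" where q: "mono q" "continuous_on UNIV q" "range q \<subseteq> {0..1}"
    and far_q: "\<And>x y. far x y \<Longrightarrow> q x < q y"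
    and hit: "\<And>s t. 0 \<le> s \<Longrightarrow> s < t \<Longrightarrow> t \<le> 1 \<Longrightarrow> \<exists>x y. far x y \<and> s < q x \<and> q y < t"
    using quotient_onto_interval[OF unc] by blast
  have q01: "0 \<le> q x" "q x \<le> 1" for x using q(3) by (auto simp: image_subset_iff)
  have less_q: "x < y" if "q x < q y" for x y
    using monoD[OF q(1), of y x] that by (meson leD le_less_linear)
  define A where "A = {\<tau>. \<exists>x y. x < y \<and> q x = \<tau> \<and> q y = \<tau>}"
  have onto: "{0<..<1} \<subseteq> range q"
  proof
    fix \<tau> :: real assume \<tau>: "\<tau> \<in> {0<..<1}"
    have "compact (range q)" by (rule compact_continuous_image[OF q(2) compact_line])
    then have "closed (range q)" by (rule compact_imp_closed)
    show "\<tau> \<in> range q"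
    proof (rule ccontr)
      assume "\<tau> \<notin> range q"
      then obtain e where e: "e > 0" "ball \<tau> e \<subseteq> - range q"
        using open_Compl[OF \<open>closed (range q)\<close>] open_contains_ball by blast
      obtain x y where "far x y" "\<tau> < q x" "q y < min 1 (\<tau> + e)" using hit[of \<tau> "min 1 (\<tau> + e)"] \<tau> e(1) by auto
      then have "q x \<in> ball \<tau> e" using far_q[of x y] by (auto simp: dist_real_def)
      with e(2) show False by blast
    qed
  qed
  have fibre: "countable (jumps \<inter> q -` {\<tau>})" for \<tau>
  proof (cases "q -` {\<tau>} = {}")
    case False
    have "closed (q -` {\<tau>})" using q(2) by (simp add: continuous_on_closed_vimage[OF closed_UNIV])
    then obtain u v where u: "u \<in> q -` {\<tau>}" "\<And>x. x \<in> q -` {\<tau>} \<Longrightarrow> u \<le> x"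
      and v: "v \<in> q -` {\<tau>}" "\<And>x. x \<in> q -` {\<tau>} \<Longrightarrow> x \<le> v"
      using closed_has_min closed_has_max False by metis
    have "\<not> far u v" using far_q[of u v] u(1) v(1) by auto
    then have "countable (jumps \<inter> {u..<v})" using u(2)[OF v(1)] by (cases "u = v") (auto simp: far_def)
    then have "countable (insert v (jumps \<inter> {u..<v}))" by simp
    moreover have "jumps \<inter> q -` {\<tau>} \<subseteq> insert v (jumps \<inter> {u..<v})"
    proof
      fix c assume c: "c \<in> jumps \<inter> q -` {\<tau>}"
      then have "u \<le> c" "c \<le> v" using u(2)[of c] v(2)[of c] by blast+
      then show "c \<in> insert v (jumps \<inter> {u..<v})" using c by auto
    qed
    ultimately show ?thesis by (rule countable_subset[rotated])
  qed simp
  have jump_A: "q c \<in> A" if c: "c \<in> jumps" for c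
  proof -
    obtain d where d: "c < d" "{c<..<d} = {}" using c by (auto simp: jumps_def)
    have "\<not> q c < q d"
    proof
      assume "q c < q d"
      then obtain x y where xy: "far x y" "q c < q x" "q y < q d" using hit q01 by metis
      have "c < x" "x < d" using xy less_q far_q[OF xy(1)] by force+
      with d(2) show False by auto
    qed
    then have "q c = q d" using monoD[OF q(1), of c d] d(1) by simp
    then show ?thesis using d(1) by (auto simp: A_def)
  qed
  have "|A| \<le>o omega1"
  proof -
    have "A \<subseteq> q ` (jumps \<union> D)"
    proof
      fix \<tau> assume "\<tau> \<in> A"
      then obtain x y where xy: "x < y" "q x = \<tau>" "q y = \<tau>" by (auto simp: A_def)
      show "\<tau> \<in> q ` (jumps \<union> D)"
      proof (cases "{x<..<y} = {}")
        case True
        then show ?thesis using xy by (auto simp: jumps_def)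
      next
        case False
        then obtain d where d: "d \<in> D" "x < d" "d < y" using dense_between by blast
        then have "q x \<le> q d" "q d \<le> q y" using monoD[OF q(1)] by simp_all
        then have "q d = \<tau>" using xy by simp
        then show ?thesis using d by auto
      qed
    qed
    then have "|A| \<le>o |q ` (jumps \<union> D)|" by (rule card_of_mono1)
    also have "|q ` (jumps \<union> D)| \<le>o |jumps \<union> D|" by (rule card_of_image)
    also have "|jumps \<union> D| \<le>o omega1"
      using le countable_le_omega1[OF countable_D] Cinfinite_omega1 by (rule Un_Cinfinite_bound)
    finally show ?thesis .
  qed
  have "|A \<inter> V| =o omega1" if V: "open V" "V \<noteq> {}" "V \<subseteq> {0<..<1}" for V
  proof -
    have "|A \<inter> V| \<le>o omega1"
      using card_of_mono1[of "A \<inter> V" A] \<open>|A| \<le>o omega1\<close> ordLeq_transitive by blast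
    moreover have "uncountable (A \<inter> V)"
    proof
      assume cAV: "countable (A \<inter> V)"
      obtain v where "v \<in> V" using V(2) by blast
      then obtain e where e: "e > 0" "ball v e \<subseteq> V" using V(1) open_contains_ball by blast
      have "0 \<le> v" "v < min 1 (v + e)" using \<open>v \<in> V\<close> V(3) e(1) by auto
      then obtain x y where xy: "far x y" "v < q x" "q y < min 1 (v + e)" using hit by (metis min.cobounded1)
      have "jumps \<inter> {x..<y} \<subseteq> (\<Union>\<tau>\<in>A \<inter> V. jumps \<inter> q -` {\<tau>})"
      proof
        fix c assume c: "c \<in> jumps \<inter> {x..<y}"
        then have "q x \<le> q c" "q c \<le> q y" using monoD[OF q(1)] by auto
        then have "q c \<in> ball v e" using xy by (auto simp: dist_real_def)
        then show "c \<in> (\<Union>\<tau>\<in>A \<inter> V. jumps \<inter> q -` {\<tau>})" using e(2) jump_A c by auto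
      qed
      moreover have "countable (\<Union>\<tau>\<in>A \<inter> V. jumps \<inter> q -` {\<tau>})" using cAV fibre by blast
      ultimately have "countable (jumps \<inter> {x..<y})" by (rule countable_subset)
      with xy(1) show False by (simp add: far_def)
    qed
    ultimately show ?thesis by (simp add: card_eq_omega1_iff)
  qed
  then show ?thesis using q(1,2) onto unfolding A_def by blast
qed


section \<open>The jump-free part and its complement, the core\<close>

definition jump_free :: "'a set" where
  "jump_free = {x. \<exists>a b. a < x \<and> x < b \<and> jumps \<inter> {a..<b} = {}}"

lemma jump_freeI: "a < x \<Longrightarrow> x < b \<Longrightarrow> jumps \<inter> {a..<b} = {} \<Longrightarrow> x \<in> jump_free"
  unfolding jump_free_def by blast

lemma open_jump_free: "open jump_free"
proof -
  have "\<exists>T. open T \<and> x \<in> T \<and> T \<subseteq> jump_free" if sx: "x \<in> jump_free" for x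
  proof -
    obtain a b where ab: "a < x" "x < b" "jumps \<inter> {a..<b} = {}" using sx unfolding jump_free_def by blast
    then show ?thesis
      by (intro exI[of _ "{a<..<b}"]) (auto intro: jump_freeI[OF _ _ ab(3)])
  qed
  then show ?thesis by (subst open_subopen) blast
qed

lemma jump_ends_in_core:
  assumes "c < d" "{c<..<d} = {}"
  shows "c \<notin> jump_free" "d \<notin> jump_free"
proof -
  have c: "c \<in> jumps" using assms by (auto simp: jumps_def)
  show "c \<notin> jump_free" using c unfolding jump_free_def by auto
  show "d \<notin> jump_free"
  proof
    assume "d \<in> jump_free"
    then obtain a b where ab: "a < d" "d < b" "jumps \<inter> {a..<b} = {}" unfolding jump_free_def by blast
    have "a \<le> c" using assms(2) ab(1) by (metis empty_iff greaterThanLessThan_iff not_le)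
    then show False using c ab assms(1) by auto
  qed
qed

text \<open>The core is zero-dimensional: between two of its points \<open>x < y\<close> either \<open>K\<close> has a jump, whose
  ends belong to the core, or the open interval is jump free and \<open>x\<close>, \<open>y\<close> are adjacent in the core.\<close>
lemma core_cut:
  assumes "x \<notin> jump_free" "y \<notin> jump_free" "x < y"
  shows "\<exists>z. z \<notin> jump_free \<and> x < z \<and> z \<le> y \<and> closed (- jump_free \<inter> {..<z})"
proof (cases "jumps \<inter> {x..<y} = {}")
  case True
  then have "{x<..<y} \<subseteq> jump_free" by (auto intro: jump_freeI)
  moreover have "{..<y} = {..x} \<union> {x<..<y}" using assms(3) by auto
  ultimately have "- jump_free \<inter> {..<y} = - jump_free \<inter> {..x}" by blast
  moreover have "closed (- jump_free \<inter> {..x})" using open_jump_free by (intro closed_Int) auto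
  ultimately have "closed (- jump_free \<inter> {..<y})" by simp
  then show ?thesis using assms by (intro exI[of _ y] conjI order_refl)
next
  case False
  then obtain c where "c \<in> jumps" "x \<le> c" "c < y" by auto
  then obtain d where d: "c < d" "{c<..<d} = {}" unfolding jumps_def by blast
  have "{..<d} = {..c} \<union> {c<..<d}" using d(1) by auto
  then have "{..<d} = {..c}" using d(2) by blast
  then have "closed (- jump_free \<inter> {..<d})" using open_jump_free by (simp add: closed_Int closed_Compl)
  moreover have "d \<le> y" using d(2) \<open>c < y\<close> by (metis empty_iff greaterThanLessThan_iff not_le)
  moreover have "x < d" using d(1) \<open>x \<le> c\<close> by simp
  ultimately show ?thesis using jump_ends_in_core(2)[OF d] by (intro exI[of _ d] conjI)
qed

text \<open>The function \<open>p\<close> is a sum of countably many step functions, whose steps are at points \<open>y \<in> N\<close>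
  that are not limits of \<open>N\<close> from the left, so that the steps are continuous on \<open>N\<close>. The steps \<open>Y\<close>
  are chosen so that every interval of \<open>N\<close> with at least three points contains one, and so that two points of
  \<open>N\<close> with a nonempty gap between them are separated. As \<open>p\<close> increases only by jumping, its image is nowhere
  dense.\<close>
lemma core_projection:
  shows "\<exists>p :: 'a \<Rightarrow> real. mono_on (- jump_free) p \<and> continuous_on (- jump_free) p \<and>
    (\<forall>x\<in>- jump_free. \<forall>y\<in>- jump_free. \<forall>z\<in>- jump_free. x < y \<longrightarrow> y < z \<longrightarrow> p x < p z) \<and>
    (\<forall>a b. a < b \<longrightarrow> (\<exists>t. a < t \<and> t < b \<and> t \<notin> p ` (- jump_free))) \<and>
    (\<forall>x\<in>- jump_free. \<forall>y\<in>- jump_free. x < y \<longrightarrow> p x = p y \<longrightarrow> x \<in> jumps)"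
proof -
  define N where "N = - jump_free"
  have clN: "closed N" using open_jump_free by (simp add: N_def closed_Compl)
  define R where "R = {y\<in>N. closed (N \<inter> {..<y})}"
  have cut: "\<exists>z\<in>R. x < z \<and> z \<le> y" if "x \<in> N" "y \<in> N" "x < y" for x y
    using core_cut[of x y] that by (auto simp: R_def N_def)
  obtain \<alpha> where \<alpha>: "\<And>d. N \<inter> {d..} \<noteq> {} \<Longrightarrow> \<alpha> d \<in> N \<inter> {d..} \<and> (\<forall>x\<in>N \<inter> {d..}. \<alpha> d \<le> x)"
    using closed_has_min[OF closed_Int[OF clN closed_atLeast]] by metis
  obtain c where c: "\<And>x y. x \<in> N \<Longrightarrow> y \<in> N \<Longrightarrow> x < y \<Longrightarrow> c x y \<in> R \<and> x < c x y \<and> c x y \<le> y"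
    using cut by metis
  \<comment> \<open>The three kinds of steps serve isolated points of \<open>N\<close>, gaps of \<open>N\<close>, and intervals with several points of \<open>D\<close>.\<close>
  define Y where "Y = (D \<inter> R) \<union> \<alpha> ` {d\<in>D. d \<notin> N \<and> N \<inter> {d..} \<noteq> {}}
      \<union> (\<lambda>(d, d'). c d d') ` {(d, d') \<in> D \<times> D. d \<in> N \<and> d' \<in> N \<and> d < d'}"
  have "countable Y"
  proof -
    have "countable {(d, d') \<in> D \<times> D. d \<in> N \<and> d' \<in> N \<and> d < d'}"
      by (rule countable_subset[of _ "D \<times> D"]) (use countable_D in auto)
    then show ?thesis using countable_D by (simp add: Y_def)
  qed
  have \<alpha>R: "\<alpha> d \<in> R" if "d \<notin> N" "N \<inter> {d..} \<noteq> {}" for d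
  proof -
    have "N \<inter> {..<\<alpha> d} = N \<inter> {..d}"
    proof (intro equalityI subsetI)
      fix x assume x: "x \<in> N \<inter> {..<\<alpha> d}"
      then have "\<not> d \<le> x" using \<alpha>[OF that(2)] by force
      then show "x \<in> N \<inter> {..d}" using x by simp
    next
      fix x assume x: "x \<in> N \<inter> {..d}"
      then have "x < d" using that(1) by (auto simp: le_less)
      then show "x \<in> N \<inter> {..<\<alpha> d}" using x \<alpha>[OF that(2)] by auto
    qed
    then have "closed (N \<inter> {..<\<alpha> d})" using clN by (simp add: closed_Int)
    then show ?thesis using \<alpha>[OF that(2)] by (auto simp: R_def)
  qed
  have YR: "Y \<subseteq> R" unfolding Y_def using \<alpha>R c by auto
  have nextY: "\<exists>y\<in>Y. x < y \<and> y \<le> z" if xz: "x \<in> N" "z \<in> N" and d: "d \<in> D" "d \<notin> N" "x < d" "d < z" for x z d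
  proof -
    have ne: "N \<inter> {d..} \<noteq> {}" using xz(2) d(4) by auto
    then have "\<alpha> d \<in> Y" using d by (auto simp: Y_def)
    moreover have "x < \<alpha> d" "\<alpha> d \<le> z" using \<alpha>[OF ne] d xz by (auto intro: less_le_trans)
    ultimately show ?thesis by blast
  qed
  have three: "\<exists>y\<in>Y. x1 < y \<and> y \<le> x3" if x: "x1 \<in> N" "x2 \<in> N" "x3 \<in> N" "x1 < x2" "x2 < x3" for x1 x2 x3
  proof (cases "\<exists>d\<in>D. d \<notin> N \<and> x1 < d \<and> d < x3")
    case True
    then show ?thesis using nextY[OF x(1,3)] by blast
  next
    case False
    then have inN: "d \<in> N" if "d \<in> D" "x1 < d" "d < x3" for d using that by blast
    have "{x1<..<x3} \<noteq> {}" using x(4,5) by auto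
    then obtain d where d: "d \<in> D" "x1 < d" "d < x3" using dense_between by blast
    show ?thesis
    proof (cases "\<exists>d'\<in>D. d' \<noteq> d \<and> x1 < d' \<and> d' < x3")
      case True
      then obtain d' where d': "d' \<in> D" "d' \<noteq> d" "x1 < d'" "d' < x3" by blast
      define u v where "u = min d d'" and "v = max d d'"
      have uv: "u \<in> D" "v \<in> D" "u < v" "x1 < u" "v < x3"
        using d d' by (auto simp: u_def v_def min_def max_def)
      then have "u \<in> N" "v \<in> N" using inN by auto
      then have "c u v \<in> Y" "u < c u v" "c u v \<le> v" using c[of u v] uv by (auto simp: Y_def)
      then show ?thesis using uv by (intro bexI[of _ "c u v"]) auto
    next
      case only: False
      have "z = d" if z: "x1 < z" "z < x3" for z
      proof (rule ccontr)
        assume "z \<noteq> d"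
        have "open ({x1<..<x3} - {d})" by auto
        moreover have "z \<in> {x1<..<x3} - {d}" using z \<open>z \<noteq> d\<close> by auto
        ultimately obtain d' where "d' \<in> D" "d' \<in> {x1<..<x3} - {d}" using dense_D by blast
        then show False using only by auto
      qed
      then have "\<not> x1 < z" if "z < d" for z using that d(3) by (metis order.strict_trans less_irrefl)
      then have "N \<inter> {..<d} = N \<inter> {..x1}" using d(2) by (auto simp: not_less)
      moreover have "closed (N \<inter> {..x1})" using clN by (simp add: closed_Int)
      ultimately have "d \<in> Y" using d inN by (auto simp: Y_def R_def)
      then show ?thesis using d by (intro bexI[of _ d]) auto
    qed
  qed
  define f where "f y x = (if y \<le> x then 1 else 0 :: real)" for y x :: 'a
  have "mono_on N (f y) \<and> continuous_on N (f y) \<and> f y ` N \<subseteq> {0..1}" if y: "y \<in> Y" for y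
  proof (intro conjI)
    show "mono_on N (f y)" by (rule mono_onI) (auto simp: f_def intro: order_trans)
    have "continuous_on (N \<inter> {..<y} \<union> N \<inter> {y..}) (f y)"
    proof (rule continuous_on_closed_Un)
      show "closed (N \<inter> {..<y})" "closed (N \<inter> {y..})"
        using y YR clN by (auto simp: R_def closed_Int)
      show "continuous_on (N \<inter> {..<y}) (f y)"
        by (rule continuous_on_cong[THEN iffD1, OF refl _ continuous_on_const[of _ 0]]) (auto simp: f_def)
      show "continuous_on (N \<inter> {y..}) (f y)"
        by (rule continuous_on_cong[THEN iffD1, OF refl _ continuous_on_const[of _ 1]]) (auto simp: f_def)
    qed
    moreover have "N \<inter> {..<y} \<union> N \<inter> {y..} = N" by auto
    ultimately show "continuous_on N (f y)" by simp
    show "f y ` N \<subseteq> {0..1}" by (auto simp: f_def)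
  qed
  then have "\<exists>p :: 'a \<Rightarrow> real. mono_on N p \<and> continuous_on N p \<and>
    (\<forall>x\<in>N. \<forall>y\<in>N. x < y \<longrightarrow> (p x < p y \<longleftrightarrow> (\<exists>g\<in>f ` Y. g x < g y)))"
    using \<open>countable Y\<close> by (intro countable_monotone_sum) auto
  then obtain p :: "'a \<Rightarrow> real" where p: "mono_on N p" "continuous_on N p"
    and pless: "\<And>x z. x \<in> N \<Longrightarrow> z \<in> N \<Longrightarrow> x < z \<Longrightarrow> p x < p z \<longleftrightarrow> (\<exists>g\<in>f ` Y. g x < g z)" by blast
  have pY: "p x < p z \<longleftrightarrow> (\<exists>y\<in>Y. x < y \<and> y \<le> z)" if "x \<in> N" "z \<in> N" "x < z" for x z
  proof -
    have "f y x < f y z \<longleftrightarrow> x < y \<and> y \<le> z" for y using that(3) by (auto simp: f_def not_le)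
    then show ?thesis using pless[OF that] by simp
  qed
  have nowhere: "\<exists>t. a < t \<and> t < b \<and> t \<notin> p ` N" if "a < b" for a b :: real
  proof (rule ccontr)
    assume "\<not> ?thesis"
    then have all: "t \<in> p ` N" if "a < t" "t < b" for t using that by blast
    obtain s where s: "a < s" "s < b" using dense[OF \<open>a < b\<close>] by blast
    obtain t where t: "s < t" "t < b" using dense[OF s(2)] by blast
    obtain x z where xz: "x \<in> N" "s = p x" "z \<in> N" "t = p z" using all[of s] all[of t] s t by auto
    have "x < z" using mono_onD[OF p(1) xz(3,1)] t(1) xz by (meson not_le)
    then obtain y where y: "y \<in> Y" "x < y" "y \<le> z" using pY[of x z] xz t(1) by auto
    have yN: "y \<in> N" and cl: "closed (N \<inter> {..<y})" using y(1) YR by (auto simp: R_def)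
    have "N \<inter> {..<y} \<noteq> {}" using xz(1) y(2) by auto
    then obtain x' where x': "x' \<in> N" "x' < y" "\<And>w. w \<in> N \<Longrightarrow> w < y \<Longrightarrow> w \<le> x'"
      using closed_has_max[OF cl] by auto
    have "p x' < p y" using pY[of x' y] x' y yN by auto
    then obtain r where r: "p x' < r" "r < p y" using dense by blast
    have "p x \<le> p x'" "p y \<le> p z"
      using mono_onD[OF p(1)] xz x' y yN by auto
    then have "a < r" "r < b" using r s t xz by auto
    then obtain w where w: "w \<in> N" "r = p w" using all by blast
    show False
    proof (cases "w < y")
      case True
      then have "p w \<le> p x'" using mono_onD[OF p(1) w(1) x'(1)] x'(3)[OF w(1)] by simp
      then show False using r w by simp
    next
      case False
      then have "p y \<le> p w" using mono_onD[OF p(1) yN w(1)] by simp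
      then show False using r w by simp
    qed
  qed
  have "x \<in> jumps" if xy: "x \<in> N" "y \<in> N" "x < y" "p x = p y" for x y
  proof (rule ccontr)
    assume "x \<notin> jumps"
    then have "{x<..<y} \<noteq> {}" using xy(3) by (auto simp: jumps_def)
    then obtain d where d: "d \<in> D" "x < d" "d < y" using dense_between by blast
    have "\<exists>w\<in>Y. x < w \<and> w \<le> y"
    proof (cases "d \<in> N")
      case True
      then show ?thesis using three[OF xy(1) True xy(2) d(2,3)] by blast
    next
      case False
      then show ?thesis using nextY[OF xy(1,2) d(1) False d(2,3)] by blast
    qed
    then show False using pY[OF xy(1-3)] xy(4) by simp
  qed
  moreover have "p x < p z" if "x \<in> N" "y \<in> N" "z \<in> N" "x < y" "y < z" for x y z
    using pY[of x z] three[OF that] that by auto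
  ultimately show ?thesis
    using p nowhere unfolding N_def by (intro exI[of _ p]) auto
qed

text \<open>Over \<open>h (p x)\<close> the point \<open>x\<close> is sent to the lower or upper end of the fibre of \<open>q\<close>, according
  to whether \<open>x\<close> is the lower or upper point of its fibre of \<open>p\<close>. Both choices agree when the
  fibre of \<open>p\<close> is a single point, because then \<open>match\<close> makes the fibre of \<open>q\<close> a single point too. This is
  what makes the map continuous at points that are limits from both sides.\<close>
lemma lift_embedding:
  fixes p q :: "'a \<Rightarrow> real" and h :: "real \<Rightarrow> real"
  assumes p: "mono_on N p" "continuous_on N p"
    and three: "\<And>x y z. x \<in> N \<Longrightarrow> y \<in> N \<Longrightarrow> z \<in> N \<Longrightarrow> x < y \<Longrightarrow> y < z \<Longrightarrow> p x < p z"
    and q: "mono q" "continuous_on UNIV q"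
    and h: "strict_mono h" "continuous_on UNIV h" "range h \<subseteq> range q"
    and match: "\<And>x. x \<in> N \<Longrightarrow> (\<exists>u v. u < v \<and> q u = h (p x) \<and> q v = h (p x)) \<longleftrightarrow>
      (\<exists>u\<in>N. \<exists>v\<in>N. u < v \<and> p u = p x \<and> p v = p x)"
  shows "\<exists>e :: 'a \<Rightarrow> 'a. strict_mono_on N e \<and> continuous_on N e \<and> (\<forall>x\<in>N. q (e x) = h (p x))"
proof -
  have fib: "closed (q -` {h r})" "q -` {h r} \<noteq> {}" for r
    using q(2) h(3) by (auto simp: continuous_on_closed_vimage[OF closed_UNIV] image_subset_iff)
      (metis imageE vimage_singleton_eq empty_iff)
  obtain lo where lo: "\<And>r. q (lo r) = h r" "\<And>r x. q x = h r \<Longrightarrow> lo r \<le> x"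
    using closed_has_min[OF fib] by (metis vimage_singleton_eq)
  obtain hi where hi: "\<And>r. q (hi r) = h r" "\<And>r x. q x = h r \<Longrightarrow> x \<le> hi r"
    using closed_has_max[OF fib] by (metis vimage_singleton_eq)
  have q_less: "x < y" if "q x < q y" for x y
    using monoD[OF q(1), of y x] that by (meson leD le_less_linear)
  define up where "up x \<longleftrightarrow> (\<exists>y\<in>N. x < y \<and> p y = p x)" for x
  define e where "e x = (if up x then lo (p x) else hi (p x))" for x
  have qe: "q (e x) = h (p x)" for x by (simp add: e_def lo hi)
  have sm: "strict_mono_on N e"
  proof (rule strict_mono_onI)
    fix x y assume xy: "x \<in> N" "y \<in> N" "x < y"
    have le: "p x \<le> p y" using mono_onD[OF p(1) xy(1,2)] xy(3) by simp
    show "e x < e y"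
    proof (cases "p x = p y")
      case False
      then have "h (p x) < h (p y)" using le strict_monoD[OF h(1)] by simp
      then show ?thesis using qe q_less by simp
    next
      case True
      have "up x" using xy True by (auto simp: up_def)
      moreover have "\<not> up y"
      proof
        assume "up y"
        then obtain z where "z \<in> N" "y < z" "p z = p y" by (auto simp: up_def)
        then show False using three[OF xy(1,2) _ xy(3)] True by force
      qed
      ultimately have exy: "e x = lo (p x)" "e y = hi (p x)" using True by (simp_all add: e_def)
      have "\<exists>u v. u < v \<and> q u = h (p x) \<and> q v = h (p x)" using match[OF xy(1)] xy True by metis
      then show ?thesis using lo(2) hi(2) unfolding exy by (meson le_less_trans less_le_trans)
    qed
  qed
  have mono_e: "e x \<le> e y" if "x \<in> N" "y \<in> N" "x \<le> y" for x y
    using strict_mono_onD[OF sm that(1,2)] that(3) by (auto simp: le_less)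
  have hp: "continuous_on N (\<lambda>x. h (p x))"
    by (rule continuous_on_compose2[OF h(2) p(2) subset_UNIV])
  have "continuous_on N e"
    unfolding continuous_on_def
  proof
    fix x assume x: "x \<in> N"
    have hpx: "((\<lambda>x. h (p x)) \<longlongrightarrow> h (p x)) (at x within N)"
      using hp x by (simp add: continuous_on_def)
    have inN: "eventually (\<lambda>z. z \<in> N) (at x within N)" by (simp add: eventually_at_topological) blast
    show "(e \<longlongrightarrow> e x) (at x within N)"
    proof (rule order_tendstoI)
      fix a assume a: "e x < a"
      show "eventually (\<lambda>z. e z < a) (at x within N)"
      proof (cases "up x")
        case True
        then obtain y where y: "y \<in> N" "x < y" "p y = p x" by (auto simp: up_def)
        have "eventually (\<lambda>z. z < y) (at x within N)"
          using order_tendstoD(2)[OF tendsto_ident_at y(2)] .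
        then show ?thesis
        proof (rule eventually_elim2[OF inN])
          fix z assume z: "z \<in> N" "z < y"
          then have "z \<le> x" using three[OF x z(1) y(1)] y(3) z(2) by (cases "x < z") simp_all
          then show "e z < a" using mono_e[OF z(1) x] a by simp
        qed
      next
        case False
        then have ex: "e x = hi (p x)" by (simp add: e_def)
        have "q (e x) \<le> q a" using monoD[OF q(1)] a by simp
        moreover have "q a \<noteq> h (p x)" using hi(2)[of a "p x"] a ex by auto
        ultimately have "h (p x) < q a" using qe by simp
        from order_tendstoD(2)[OF hpx this] show ?thesis
          by (rule eventually_mono) (simp add: qe q_less)
      qed
    next
      fix a assume a: "a < e x"
      show "eventually (\<lambda>z. a < e z) (at x within N)"
      proof (cases "\<exists>y\<in>N. y < x \<and> p y = p x")
        case True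
        then obtain y where y: "y \<in> N" "y < x" "p y = p x" by blast
        have "eventually (\<lambda>z. y < z) (at x within N)"
          using order_tendstoD(1)[OF tendsto_ident_at y(2)] .
        then show ?thesis
        proof (rule eventually_elim2[OF inN])
          fix z assume z: "z \<in> N" "y < z"
          then have "x \<le> z" using three[OF y(1) z(1) x] y(3) z(2) by (cases "z < x") simp_all
          then show "a < e z" using mono_e[OF x z(1)] a by simp
        qed
      next
        case False
        have ex: "e x = lo (p x)"
        proof (cases "up x")
          case False
          have "\<not> (\<exists>u\<in>N. \<exists>v\<in>N. u < v \<and> p u = p x \<and> p v = p x)"
          proof
            assume "\<exists>u\<in>N. \<exists>v\<in>N. u < v \<and> p u = p x \<and> p v = p x"
            then obtain u v where uv: "u \<in> N" "v \<in> N" "u < v" "p u = p x" "p v = p x" by blast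
            have "\<not> u < x" using uv \<open>\<not> (\<exists>y\<in>N. y < x \<and> p y = p x)\<close> by blast
            then have "x < v" using uv(3) by simp
            then show False using False uv by (auto simp: up_def)
          qed
          then have "\<not> (\<exists>u v. u < v \<and> q u = h (p x) \<and> q v = h (p x))" using match[OF x] by blast
          then have "lo (p x) = hi (p x)"
            using lo(1)[of "p x"] hi(1)[of "p x"] lo(2)[of "hi (p x)" "p x"] by (metis le_less)
          then show ?thesis by (simp add: e_def)
        qed (simp add: e_def)
        have "q a \<le> q (e x)" using monoD[OF q(1)] a by simp
        moreover have "q a \<noteq> h (p x)" using lo(2)[of a "p x"] a ex by auto
        ultimately have "q a < h (p x)" using qe by simp
        from order_tendstoD(1)[OF hpx this] show ?thesis
          by (rule eventually_mono) (simp add: qe q_less)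
      qed
    qed
  qed
  with sm qe show ?thesis by blast
qed


section \<open>Absorbing the two factors\<close>

abbreviation C_line :: "('a \<Rightarrow> real) set" where
  "C_line \<equiv> C_on UNIV"

lemma embed_core:
  fixes q :: "'a \<Rightarrow> real"
  assumes BA and card: "|jumps :: 'a set| =o omega1"
    and q: "mono q" "continuous_on UNIV q" "{0<..<1} \<subseteq> range q"
    and A: "\<And>V. open V \<Longrightarrow> V \<noteq> {} \<Longrightarrow> V \<subseteq> {0<..<1} \<Longrightarrow>
      |{\<tau>. \<exists>x y. x < y \<and> q x = \<tau> \<and> q y = \<tau>} \<inter> V| =o omega1"
    and st: "0 \<le> s" "s < t" "t \<le> 1"
  shows "\<exists>e :: 'a \<Rightarrow> 'a. strict_mono_on (- jump_free) e \<and> continuous_on (- jump_free) e \<and>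
    (\<forall>x\<in>- jump_free. q (e x) \<in> {s<..<t})"
proof -
  obtain p :: "'a \<Rightarrow> real" where p: "mono_on (- jump_free) p" "continuous_on (- jump_free) p"
    and three: "\<And>x y z. x \<in> - jump_free \<Longrightarrow> y \<in> - jump_free \<Longrightarrow> z \<in> - jump_free \<Longrightarrow> x < y \<Longrightarrow> y < z \<Longrightarrow> p x < p z"
    and nowhere: "\<And>a b. a < b \<Longrightarrow> \<exists>t. a < t \<and> t < b \<and> t \<notin> p ` (- jump_free)"
    and jump: "\<And>x y. x \<in> - jump_free \<Longrightarrow> y \<in> - jump_free \<Longrightarrow> x < y \<Longrightarrow> p x = p y \<Longrightarrow> x \<in> jumps"
    using core_projection by blast
  define E where "E = p ` (- jump_free)"
  define B where "B = {\<tau>. \<exists>u\<in>- jump_free. \<exists>v\<in>- jump_free. u < v \<and> p u = \<tau> \<and> p v = \<tau>}"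
  have "compact (- jump_free)" using compact_Int_closed[OF compact_line, of "- jump_free"] open_jump_free by (simp add: closed_Compl)
  then have "closed E" unfolding E_def using p(2) by (intro compact_imp_closed compact_continuous_image)
  have "B \<subseteq> E" by (auto simp: B_def E_def)
  have "B \<subseteq> p ` jumps" using jump by (fastforce simp: B_def)
  then have "|B| \<le>o |p ` jumps|" by (rule card_of_mono1)
  also have "|p ` jumps| \<le>o |jumps :: 'a set|" by (rule card_of_image)
  also have "|jumps :: 'a set| \<le>o omega1" using card by (rule ordIso_imp_ordLeq)
  finally have cB: "|B| \<le>o omega1" .
  have "\<exists>h :: real \<Rightarrow> real. strict_mono h \<and> continuous_on UNIV h \<and> range h \<subseteq> {s<..<t} \<and>
      (\<forall>\<tau>\<in>E. h \<tau> \<in> {\<tau>. \<exists>x y. x < y \<and> q x = \<tau> \<and> q y = \<tau>} \<longleftrightarrow> \<tau> \<in> B)"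
    using BA_embedding[OF \<open>BA\<close> st A \<open>closed E\<close> _ \<open>B \<subseteq> E\<close> cB] nowhere unfolding E_def by blast
  then obtain h :: "real \<Rightarrow> real" where h: "strict_mono h" "continuous_on UNIV h" "range h \<subseteq> {s<..<t}"
    and hA: "\<And>\<tau>. \<tau> \<in> E \<Longrightarrow> (\<exists>x y. x < y \<and> q x = h \<tau> \<and> q y = h \<tau>) \<longleftrightarrow> \<tau> \<in> B"
    by (elim exE conjE) simp
  have "\<exists>e :: 'a \<Rightarrow> 'a. strict_mono_on (- jump_free) e \<and> continuous_on (- jump_free) e \<and> (\<forall>x\<in>- jump_free. q (e x) = h (p x))"
  proof (rule lift_embedding[OF p three q(1,2) h(1,2)])
    have "{s<..<t} \<subseteq> {0<..<1}" using st by auto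
    then show "range h \<subseteq> range q" using h(3) q(3) by (meson subset_trans)
    show "(\<exists>u v. u < v \<and> q u = h (p x) \<and> q v = h (p x)) \<longleftrightarrow>
      (\<exists>u\<in>- jump_free. \<exists>v\<in>- jump_free. u < v \<and> p u = p x \<and> p v = p x)" if "x \<in> - jump_free" for x
    proof -
      have "p x \<in> E" using that by (simp add: E_def)
      from hA[OF this] show ?thesis by (simp add: B_def)
    qed
  qed
  then obtain e :: "'a \<Rightarrow> 'a" where e: "strict_mono_on (- jump_free) e" "continuous_on (- jump_free) e"
    and qe: "\<And>x. x \<in> - jump_free \<Longrightarrow> q (e x) = h (p x)"
    by blast
  have "q (e x) \<in> {s<..<t}" if "x \<in> - jump_free" for x
    unfolding qe[OF that] using h(3) by blast
  with e show ?thesis by blast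
qed

text \<open>The copies \<open>e n ` N\<close> lie over disjoint intervals increasing to \<open>1/2\<close>, and converge to the least
  point \<open>w\<close> of the fibre over \<open>1/2\<close>. Thus \<open>M\<close> is compact, and the shift \<open>\<sigma>\<close> from each copy to the
  next one is a homeomorphism of \<open>M\<close> onto the complement of the first copy.\<close>
lemma core_absorbed:
  assumes BA and card: "|jumps :: 'a set| =o omega1"
  shows "C_line \<simeq> C_line \<otimes> C_on (- jump_free)"
proof -
  define N where "N = - jump_free"
  have "closed N" using open_jump_free by (simp add: N_def closed_Compl)
  then have cN: "compact N" using compact_Int_closed[OF compact_line, of N] by simp
  from omega1_dense_quotient[OF card] obtain q :: "'a \<Rightarrow> real" where
    q: "mono q" "continuous_on UNIV q" "{0<..<1} \<subseteq> range q"
    and A: "\<And>V. open V \<Longrightarrow> V \<noteq> {} \<Longrightarrow> V \<subseteq> {0<..<1} \<Longrightarrow>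
      |{\<tau>. \<exists>x y. x < y \<and> q x = \<tau> \<and> q y = \<tau>} \<inter> V| =o omega1"
    by (elim exE conjE) simp
  define u where "u n = 1 / 2 - 1 / real (n + 2)" for n :: nat
  have u_mono: "u m \<le> u n" if "m \<le> n" for m n using that by (auto simp: u_def field_simps)
  have u_less: "u n < u (Suc n)" for n by (auto simp: u_def field_simps)
  have u01: "0 \<le> u n" "u n < 1 / 2" for n by (auto simp: u_def field_simps)
  have u_lim: "\<exists>n. r < u n" if r: "r < 1 / 2" for r
  proof -
    obtain n where "inverse (real (Suc n)) < 1 / 2 - r" using reals_Archimedean[of "1 / 2 - r"] r by auto
    moreover have "1 / real (n + 2) \<le> inverse (real (Suc n))" by (auto simp: field_simps)
    ultimately show ?thesis by (intro exI[of _ n]) (simp add: u_def)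
  qed
  have "\<exists>e :: 'a \<Rightarrow> 'a. strict_mono_on N e \<and> continuous_on N e \<and> (\<forall>x\<in>N. q (e x) \<in> {u n<..<u (Suc n)})" for n
    unfolding N_def
    by (rule embed_core[OF \<open>BA\<close> card q A]) (use u01[of n] u_less[of n] u01[of "Suc n"] in simp_all)
  then obtain e :: "nat \<Rightarrow> 'a \<Rightarrow> 'a" where
    e: "\<And>n. strict_mono_on N (e n)" "\<And>n. continuous_on N (e n)"
    and qe: "\<And>n x. x \<in> N \<Longrightarrow> u n < q (e n x) \<and> q (e n x) < u (Suc n)"
    by (metis greaterThanLessThan_iff)
  have inj: "inj_on (e n) N" for n using e(1) by (rule strict_mono_on_imp_inj_on)
  have cl: "closed (q -` {1 / 2})" using q(2) by (simp add: continuous_on_closed_vimage[OF closed_UNIV])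
  have "(1 / 2 :: real) \<in> range q" using q(3) by force
  then have "q -` {1 / 2} \<noteq> {}" by (metis imageE vimage_singleton_eq empty_iff)
  from closed_has_min[OF cl this] obtain w where "w \<in> q -` {1 / 2}" "\<forall>x\<in>q -` {1 / 2}. w \<le> x" ..
  then have w: "q w = 1 / 2" "\<And>x. q x = 1 / 2 \<Longrightarrow> w \<le> x" by auto
  have q_less: "x < y" if "q x < q y" for x y
    using monoD[OF q(1), of y x] that by (meson leD le_less_linear)
  have near_w: "\<exists>n. \<forall>x. u n < q x \<longrightarrow> q x < 1 / 2 \<longrightarrow> x \<in> U" if U: "open U" "w \<in> U" for U
  proof -
    have "(1 / 4 :: real) \<in> range q" using q(3) by force
    then obtain y0 where "q y0 = 1 / 4" by (metis imageE)
    then have "y0 < w" using w(1) by (intro q_less) simp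
    then obtain y where y: "y < w" "{y<..w} \<subseteq> U" using open_left[OF U] by blast
    have "q y \<le> 1 / 2" using monoD[OF q(1), of y w] y(1) w(1) by simp
    moreover have "q y \<noteq> 1 / 2" using w(2)[of y] y(1) by auto
    ultimately obtain n where n: "q y < u n" using u_lim[of "q y"] by auto
    have "x \<in> U" if "u n < q x" "q x < 1 / 2" for x
    proof -
      have "y < x" using n that by (intro q_less) simp
      moreover have "x < w" using that w(1) by (intro q_less) simp
      ultimately show ?thesis using y(2) by auto
    qed
    then show ?thesis by blast
  qed
  define M where "M = insert w (\<Union>n. e n ` N)"
  have M_half: "q (e n x) < 1 / 2" if "x \<in> N" for n x using qe[OF that, of n] u01(2)[of "Suc n"] by simp
  have idx: "n = m" if "x \<in> N" "u m < q (e n x)" "q (e n x) < u (Suc m)" for n m x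
  proof (rule ccontr)
    assume "n \<noteq> m"
    then consider "Suc n \<le> m" | "Suc m \<le> n" by linarith
    then show False using qe[OF that(1), of n] that(2,3) u_mono by cases force+
  qed
  have cM: "compact M"
  proof (rule compactI)
    fix \<C> :: "'a set set" assume \<C>: "\<forall>t\<in>\<C>. open t" "M \<subseteq> \<Union>\<C>"
    then obtain U where U: "U \<in> \<C>" "w \<in> U" by (auto simp: M_def)
    then obtain n where n: "\<And>x. u n < q x \<Longrightarrow> q x < 1 / 2 \<Longrightarrow> x \<in> U" using near_w[of U] \<C>(1) by blast
    have "compact (\<Union>m\<in>{..n}. e m ` N)"
      by (intro compact_UN) (auto intro: compact_continuous_image e(2) cN)
    moreover have "(\<Union>m\<in>{..n}. e m ` N) \<subseteq> \<Union>\<C>" using \<C>(2) by (auto simp: M_def)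
    ultimately obtain \<D> where \<D>: "\<D> \<subseteq> \<C>" "finite \<D>" "(\<Union>m\<in>{..n}. e m ` N) \<subseteq> \<Union>\<D>"
      using compactE \<C>(1) by metis
    have "M \<subseteq> \<Union>(insert U \<D>)"
    proof
      fix x assume "x \<in> M"
      then consider "x = w" | m z where "z \<in> N" "x = e m z" by (auto simp: M_def)
      then show "x \<in> \<Union>(insert U \<D>)"
      proof cases
        case 1
        then show ?thesis using U by blast
      next
        case 2
        show ?thesis
        proof (cases "m \<le> n")
          case True
          then show ?thesis using \<D>(3) 2 by blast
        next
          case False
          then have "u n < q x" using qe[OF 2(1), of m] u_mono[of n m] 2(2) by simp
          then have "x \<in> U" using n M_half 2 by blast
          then show ?thesis by blast
        qed
      qed
    qed
    then show "\<exists>\<C>'\<subseteq>\<C>. finite \<C>' \<and> M \<subseteq> \<Union>\<C>'"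
      using U(1) \<D>(1,2) by (intro exI[of _ "insert U \<D>"]) auto
  qed
  define ix where "ix x = (THE n. x \<in> e n ` N)" for x
  have ix: "ix (e n z) = n" if "z \<in> N" for n z
    unfolding ix_def
  proof (rule the_equality)
    fix m assume "e n z \<in> e m ` N"
    then obtain z' where "z' \<in> N" "e n z = e m z'" by blast
    then show "m = n" using qe[OF that, of n] idx[of z' n m] by simp
  qed (use that in blast)
  define \<sigma> where "\<sigma> x = (if x = w then w else e (Suc (ix x)) (inv_into N (e (ix x)) x))" for x
  have \<sigma>w: "\<sigma> w = w" by (simp add: \<sigma>_def)
  have \<sigma>e: "\<sigma> (e n z) = e (Suc n) z" if "z \<in> N" for n z
  proof -
    have "e n z \<noteq> w" using M_half[OF that, of n] w(1) by auto
    then show ?thesis using that inj by (simp add: \<sigma>_def ix inv_into_f_f)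
  qed
  have image: "\<sigma> ` M = insert w (\<Union>n. e (Suc n) ` N)"
    unfolding M_def by (auto simp: \<sigma>w \<sigma>e image_UN image_image)
  have "e 0 ` N \<inter> \<sigma> ` M = {}"
  proof (rule ccontr)
    assume "e 0 ` N \<inter> \<sigma> ` M \<noteq> {}"
    then obtain z where z: "z \<in> N" "e 0 z \<in> \<sigma> ` M" by blast
    then consider "e 0 z = w" | n z' where "z' \<in> N" "e 0 z = e (Suc n) z'" unfolding image by blast
    then show False
    proof cases
      case 1
      then show ?thesis using M_half[OF z(1), of 0] w(1) by simp
    next
      case 2
      then show ?thesis using ix[OF z(1), of 0] ix[OF 2(1), of "Suc n"] by simp
    qed
  qed
  moreover have "e 0 ` N \<union> \<sigma> ` M = M"
  proof -
    have "(\<Union>n. e n ` N) = e 0 ` N \<union> (\<Union>n. e (Suc n) ` N)"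
      by (auto simp: image_iff) (metis not0_implies_Suc)
    then show ?thesis unfolding image by (auto simp: M_def)
  qed
  moreover have "inj_on \<sigma> M"
  proof (rule inj_onI)
    fix x y assume xy: "x \<in> M" "y \<in> M" "\<sigma> x = \<sigma> y"
    have ne: "e n z \<noteq> w" if "z \<in> N" for n z using M_half[OF that, of n] w(1) by auto
    have "x = w \<or> (\<exists>n. \<exists>z\<in>N. x = e n z)" "y = w \<or> (\<exists>n. \<exists>z\<in>N. y = e n z)"
      using xy by (auto simp: M_def)
    then show "x = y"
    proof (elim disjE exE bexE)
      fix n z m z' assume *: "z \<in> N" "x = e n z" "z' \<in> N" "y = e m z'"
      then have eq: "e (Suc n) z = e (Suc m) z'" using xy(3) \<sigma>e by simp
      then have "n = m" using ix[OF *(1), of "Suc n"] ix[OF *(3), of "Suc m"] by simp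
      then show ?thesis using * eq inj_onD[OF inj] by blast
    qed (use xy(3) \<sigma>w \<sigma>e ne in \<open>auto dest: sym\<close>)
  qed
  moreover have "continuous_on M \<sigma>"
    unfolding continuous_on_def
  proof
    fix x assume "x \<in> M"
    then consider "x = w" | n z where "z \<in> N" "x = e n z" by (auto simp: M_def)
    then show "(\<sigma> \<longlongrightarrow> \<sigma> x) (at x within M)"
    proof cases
      case 1
      show ?thesis
      proof (rule topological_tendstoI)
        fix U assume "open U" "\<sigma> x \<in> U"
        then have "open U" "w \<in> U" using 1 \<sigma>w by auto
        then obtain n where n: "\<And>x. u n < q x \<Longrightarrow> q x < 1 / 2 \<Longrightarrow> x \<in> U" using near_w by blast
        have "open (q -` {u n<..})" using q(2) by (intro open_vimage) auto
        moreover have "x \<in> q -` {u n<..}" using 1 w(1) u01(2)[of n] by simp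
        moreover have "\<sigma> y \<in> U" if y: "y \<in> M" "y \<in> q -` {u n<..}" for y
        proof -
          from y(1) consider "y = w" | m z where "z \<in> N" "y = e m z" by (auto simp: M_def)
          then show ?thesis
          proof cases
            case 1
            then show ?thesis using \<sigma>w \<open>w \<in> U\<close> by simp
          next
            case 2
            have "u n < u (Suc m)" using y(2) 2 qe[OF 2(1), of m] by simp
            then have "u n < q (e (Suc m) z)" using qe[OF 2(1), of "Suc m"] by simp
            then have "e (Suc m) z \<in> U" using n M_half[OF 2(1)] by blast
            then show ?thesis using 2 \<sigma>e by simp
          qed
        qed
        ultimately show "eventually (\<lambda>y. \<sigma> y \<in> U) (at x within M)"
          unfolding eventually_at_topological by blast
      qed
    next
      case 2
      define W where "W = q -` {u n<..<u (Suc n)}"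
      have "open W" unfolding W_def using q(2) by (intro open_vimage) auto
      have "M \<inter> W = e n ` N"
      proof (intro equalityI subsetI)
        fix y assume y: "y \<in> M \<inter> W"
        then have "u n < q y" "q y < u (Suc n)" by (auto simp: W_def)
        moreover have "y \<noteq> w" using calculation w(1) u01(2)[of "Suc n"] by auto
        moreover obtain m z where "z \<in> N" "y = e m z" using y \<open>y \<noteq> w\<close> by (auto simp: M_def)
        ultimately show "y \<in> e n ` N" using idx by blast
      next
        fix y assume "y \<in> e n ` N"
        then show "y \<in> M \<inter> W" using qe by (auto simp: M_def W_def)
      qed
      moreover have "x \<in> W" using 2 qe by (auto simp: W_def)
      ultimately have at: "at x within M = at x within (e n ` N)"
        using \<open>open W\<close> by (intro at_within_nhd[of x W]) auto
      have "continuous_on (e n ` N) (inv_into N (e n))"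
        by (rule continuous_on_inv[OF e(2) cN]) (use inj in \<open>auto simp: inv_into_f_f\<close>)
      then have "continuous_on (e n ` N) (\<lambda>y. e (Suc n) (inv_into N (e n) y))"
        by (rule continuous_on_compose2[OF e(2)]) (auto intro: inv_into_into)
      then have "continuous_on (e n ` N) \<sigma>"
        by (rule continuous_on_cong[THEN iffD1, OF refl, rotated]) (use inj in \<open>auto simp: \<sigma>e inv_into_f_f\<close>)
      then show ?thesis using 2 at by (simp add: continuous_on_def)
    qed
  qed
  ultimately have "C_on M \<simeq> C_on M \<otimes> C_on N"
    using C_on_split[OF cM cN e(2) inj] by blast
  then show ?thesis
    using absorb_summand[OF C_on_decompose[OF compact_line compact_imp_closed[OF cM]]] unfolding N_def by blast
qed

lemma dense_in_jump_free:
  assumes "u < v" "jumps \<inter> {u..<v} = {}"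
  shows "\<exists>d\<in>D. u < d \<and> d < v"
proof -
  have "{u<..<v} \<noteq> {}" using assms by (auto simp: jumps_def)
  then show ?thesis by (rule dense_between)
qed

text \<open>On a jump-free interval the points of \<open>D\<close> are densely ordered, hence there is a monotone continuous function
  on the whole line which is strictly increasing on those points. A sum over the countably many intervals with ends in \<open>D\<close>
  treats all jump-free points at once.\<close>
lemma jump_free_chart:
  shows "\<exists>g :: 'a \<Rightarrow> real. mono g \<and> continuous_on UNIV g \<and> (\<forall>x\<in>jump_free. \<forall>y. g x = g y \<longrightarrow> x = y)"
proof -
  define I where "I = {(d, d') \<in> D \<times> D. d < d' \<and> jumps \<inter> {d..<d'} = {}}"
  have "countable I" by (rule countable_subset[of _ "D \<times> D"]) (use countable_D in \<open>auto simp: I_def\<close>)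
  have "\<exists>q :: 'a \<Rightarrow> real. mono q \<and> continuous_on UNIV q \<and> range q \<subseteq> {0..1} \<and>
      (\<forall>x\<in>D. \<forall>y\<in>D. d < x \<longrightarrow> x < y \<longrightarrow> y < d' \<longrightarrow> q x < q y)" if dd': "(d, d') \<in> I" for d d'
  proof -
    have d: "d < d'" "jumps \<inter> {d..<d'} = {}" using dd' by (auto simp: I_def)
    define D1 where "D1 = {x\<in>D. d < x \<and> x < d'}"
    have btw: "\<exists>z\<in>D1. x < z \<and> z < y" if xy: "d \<le> x" "x < y" "y \<le> d'" for x y
    proof -
      have "{x..<y} \<subseteq> {d..<d'}" using xy by auto
      then have "jumps \<inter> {x..<y} = {}" using d(2) by blast
      then obtain z where "z \<in> D" "x < z" "z < y" using dense_in_jump_free[OF xy(2)] by blast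
      then show ?thesis using xy by (intro bexI[of _ z]) (auto simp: D1_def)
    qed
    have "\<exists>\<phi> :: 'a \<Rightarrow> real. strict_mono_on D1 \<phi> \<and> \<phi> ` D1 \<subseteq> {0<..<1} \<and>
      (\<forall>s t. 0 \<le> s \<longrightarrow> s < t \<longrightarrow> t \<le> 1 \<longrightarrow> (\<exists>x\<in>D1. s < \<phi> x \<and> \<phi> x < t))"
    proof (rule countable_dense_order_embedding)
      show "countable D1" using countable_D by (simp add: D1_def)
      show "D1 \<noteq> {}" using btw[of d d'] d(1) by auto
      show "\<exists>z\<in>D1. x < z \<and> z < y" if "x \<in> D1" "y \<in> D1" "x < y" for x y
        using btw[of x y] that by (simp add: D1_def less_imp_le)
      show "\<exists>y\<in>D1. x < y" if "x \<in> D1" for x using btw[of x d'] that by (auto simp: D1_def less_imp_le)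
      show "\<exists>y\<in>D1. y < x" if "x \<in> D1" for x using btw[of d x] that by (auto simp: D1_def less_imp_le)
    qed
    then obtain \<phi> :: "'a \<Rightarrow> real" where \<phi>: "strict_mono_on D1 \<phi>" "\<phi> ` D1 \<subseteq> {0<..<1}"
      "\<And>s t. 0 \<le> s \<Longrightarrow> s < t \<Longrightarrow> t \<le> 1 \<Longrightarrow> \<exists>x\<in>D1. s < \<phi> x \<and> \<phi> x < t" by blast
    obtain q where q: "mono q" "continuous_on UNIV q" "range q \<subseteq> {0..1}" "\<And>x. x \<in> D1 \<Longrightarrow> q x = \<phi> x"
      using monotone_continuous_extension[OF \<phi>(1,2) zero_less_one \<phi>(3)] by blast
    have "q x < q y" if "x \<in> D" "y \<in> D" "d < x" "x < y" "y < d'" for x y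
      using strict_mono_onD[OF \<phi>(1), of x y] q(4) that by (auto simp: D1_def)
    then show ?thesis using q(1-3) by blast
  qed
  then have "\<exists>Q :: 'a \<times> 'a \<Rightarrow> 'a \<Rightarrow> real. \<forall>i\<in>I. mono (Q i) \<and> continuous_on UNIV (Q i) \<and> range (Q i) \<subseteq> {0..1} \<and>
      (\<forall>x\<in>D. \<forall>y\<in>D. fst i < x \<longrightarrow> x < y \<longrightarrow> y < snd i \<longrightarrow> Q i x < Q i y)"
    by (intro bchoice) auto
  then obtain Q :: "'a \<times> 'a \<Rightarrow> 'a \<Rightarrow> real" where
    Q: "\<And>i. i \<in> I \<Longrightarrow> mono (Q i) \<and> continuous_on UNIV (Q i) \<and> range (Q i) \<subseteq> {0..1}"
    and Qless: "\<And>i x y. i \<in> I \<Longrightarrow> x \<in> D \<Longrightarrow> y \<in> D \<Longrightarrow> fst i < x \<Longrightarrow> x < y \<Longrightarrow> y < snd i \<Longrightarrow> Q i x < Q i y"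
    by blast
  have "\<exists>p :: 'a \<Rightarrow> real. mono_on UNIV p \<and> continuous_on UNIV p \<and>
    (\<forall>x\<in>UNIV. \<forall>y\<in>UNIV. x < y \<longrightarrow> (p x < p y \<longleftrightarrow> (\<exists>f\<in>Q ` I. f x < f y)))"
    using Q \<open>countable I\<close> by (intro countable_monotone_sum) auto
  then obtain g :: "'a \<Rightarrow> real" where g: "mono g" "continuous_on UNIV g"
    and gless: "\<And>x y. x < y \<Longrightarrow> g x < g y \<longleftrightarrow> (\<exists>f\<in>Q ` I. f x < f y)"
    by (elim exE conjE) simp
  have strict: "g x < g y" if "x \<le> u" "u < v" "v \<le> y" and J: "jumps \<inter> {u..<v} = {}" for x y u v
  proof -
    have btw: "\<exists>d\<in>D. a < d \<and> d < v" if "u \<le> a" "a < v" for a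
    proof (rule dense_in_jump_free[OF that(2)])
      have "{a..<v} \<subseteq> {u..<v}" using that by auto
      then show "jumps \<inter> {a..<v} = {}" using J by blast
    qed
    \<comment> \<open>The outer points \<open>d\<close>, \<open>d'\<close> choose a summand, and the inner points \<open>a\<close>, \<open>b\<close> are separated by it.\<close>
    obtain d where d: "d \<in> D" "u < d" "d < v" using btw[of u] \<open>u < v\<close> by blast
    then have "u \<le> d" by simp
    then obtain a where a: "a \<in> D" "d < a" "a < v" using btw d(3) by blast
    then have "u \<le> a" using \<open>u \<le> d\<close> by simp
    then obtain b where b: "b \<in> D" "a < b" "b < v" using btw a(3) by blast
    then have "u \<le> b" using \<open>u \<le> a\<close> by simp
    then obtain d' where d': "d' \<in> D" "b < d'" "d' < v" using btw b(3) by blast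
    have "{d..<d'} \<subseteq> {u..<v}" using \<open>u \<le> d\<close> d'(3) by auto
    then have "jumps \<inter> {d..<d'} = {}" using J by blast
    then have i: "(d, d') \<in> I" using a b d d' by (auto simp: I_def)
    then have "Q (d, d') a < Q (d, d') b" using Qless[OF i a(1) b(1)] a b d' by simp
    then have "g a < g b" using gless[OF b(2)] i by blast
    moreover have "g x \<le> g a" "g b \<le> g y" using monoD[OF g(1)] that a b d by auto
    ultimately show ?thesis by linarith
  qed
  have "x = y" if x: "x \<in> jump_free" and eq: "g x = g y" for x y
  proof -
    obtain a b where ab: "a < x" "x < b" "jumps \<inter> {a..<b} = {}" using x unfolding jump_free_def by blast
    have "g x < g y" if "x < y"
    proof (rule strict[of x x "min y b"])
      have "{x..<min y b} \<subseteq> {a..<b}" using ab by auto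
      then show "jumps \<inter> {x..<min y b} = {}" using ab(3) by blast
    qed (use that ab in auto)
    moreover have "g y < g x" if "y < x"
    proof (rule strict[of y "max y a" x])
      have "{max y a..<x} \<subseteq> {a..<b}" using ab by auto
      then show "jumps \<inter> {max y a..<x} = {}" using ab(3) by blast
    qed (use that ab in auto)
    ultimately show ?thesis using eq by (cases x y rule: linorder_cases) auto
  qed
  then show ?thesis using g by blast
qed

text \<open>The last point with value at most \<open>\<tau>\<close> and the first point with value at least \<open>\<tau>\<close> would
  form a jump if they were different.\<close>
lemma jump_free_ivt:
  fixes g :: "'a \<Rightarrow> real"
  assumes g: "mono g" "continuous_on UNIV g" and "a < b" and J: "jumps \<inter> {a..<b} = {}"
    and \<tau>: "g a < \<tau>" "\<tau> < g b"
  shows "\<exists>x. a < x \<and> x < b \<and> g x = \<tau>"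
proof -
  define L where "L = {a..b} \<inter> g -` {..\<tau>}"
  define U where "U = {a..b} \<inter> g -` {\<tau>..}"
  have cl: "closed (g -` {..\<tau>})" "closed (g -` {\<tau>..})"
    using g(2) by (simp_all add: continuous_on_closed_vimage[OF closed_UNIV])
  then have "closed L" "closed U" by (simp_all add: L_def U_def closed_Int)
  moreover have "a \<in> L" "b \<in> U" using \<open>a < b\<close> \<tau> by (auto simp: L_def U_def)
  ultimately obtain c d where c: "c \<in> L" "\<And>x. x \<in> L \<Longrightarrow> x \<le> c" and d: "d \<in> U" "\<And>x. x \<in> U \<Longrightarrow> d \<le> x"
    using closed_has_max[of L] closed_has_min[of U] by blast
  have "\<not> c < d"
  proof
    assume "c < d"
    have "{c<..<d} = {}"
    proof (rule ccontr)
      assume "{c<..<d} \<noteq> {}"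
      then obtain z where z: "c < z" "z < d" by auto
      then have "z \<in> L \<or> z \<in> U" using c(1) d(1) by (auto simp: L_def U_def)
      then show False using c(2)[of z] d(2)[of z] z by auto
    qed
    then have "c \<in> jumps \<inter> {a..<b}" using \<open>c < d\<close> c(1) d(1) by (auto simp: jumps_def L_def U_def)
    with J show False by blast
  qed
  then have "g d \<le> g c" using monoD[OF g(1)] by simp
  then have "g c = \<tau>" using c(1) d(1) by (auto simp: L_def U_def)
  moreover have "a < c" "c < b" using c(1) \<tau> \<open>g c = \<tau>\<close> by (auto simp: L_def le_less)
  ultimately show ?thesis by blast
qed

text \<open>A jump-free interval of the line maps onto an interval of reals, which by \<open>absorbing_open_subset\<close>
  contains an open set \<open>W\<close> absorbing \<open>V\<close>. Pulling \<open>W\<close> and \<open>V\<close> back gives a summand of the space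
  which absorbs \<open>C_van jump_free\<close>.\<close>
lemma jump_free_absorbed:
  "C_line \<simeq> C_line \<otimes> C_van jump_free"
proof (cases "jump_free = {}")
  case True
  then have "C_van jump_free = {\<lambda>_. 0}" by (auto simp: C_van_def)
  show ?thesis unfolding \<open>C_van jump_free = {\<lambda>_. 0}\<close> by (rule prod_space_zero)
next
  case False
  obtain g :: "'a \<Rightarrow> real" where g: "mono g" "continuous_on UNIV g"
    and inj: "\<And>x y. x \<in> jump_free \<Longrightarrow> g x = g y \<Longrightarrow> x = y"
    using jump_free_chart by blast
  have sm: "g x < g y" if "x \<in> jump_free \<or> y \<in> jump_free" "x < y" for x y
    using monoD[OF g(1), of x y] inj[of x y] inj[of y x] that by (auto simp: le_less)
  have hit: "{g a<..<g b} \<subseteq> g ` {a<..<b}" if ab: "a < b" "jumps \<inter> {a..<b} = {}" for a b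
  proof
    fix \<tau> assume "\<tau> \<in> {g a<..<g b}"
    then have "g a < \<tau>" "\<tau> < g b" by auto
    from jump_free_ivt[OF g ab this] show "\<tau> \<in> g ` {a<..<b}" by auto
  qed
  have sub: "{a<..<b} \<subseteq> jump_free" if "jumps \<inter> {a..<b} = {}" for a b
    using that by (auto intro: jump_freeI)
  define V where "V = g ` jump_free"
  have "open V"
  proof -
    have "\<exists>T. open T \<and> \<tau> \<in> T \<and> T \<subseteq> V" if \<tau>: "\<tau> \<in> V" for \<tau>
    proof -
      obtain x where x: "x \<in> jump_free" "\<tau> = g x" using \<tau> by (auto simp: V_def)
      then obtain a b where ab: "a < x" "x < b" "jumps \<inter> {a..<b} = {}" unfolding jump_free_def by blast
      have "\<tau> \<in> {g a<..<g b}" using sm[of a x] sm[of x b] x ab by auto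
      moreover have "{g a<..<g b} \<subseteq> V" using hit[of a b] sub[OF ab(3)] ab unfolding V_def by force
      ultimately show ?thesis by (intro exI[of _ "{g a<..<g b}"]) auto
    qed
    then show ?thesis by (subst open_subopen) blast
  qed
  have "compact (range g)" by (rule compact_continuous_image[OF g(2) compact_line])
  then have "bounded V" by (rule bounded_subset[OF compact_imp_bounded]) (auto simp: V_def)
  have vim: "g -` V = jump_free"
  proof (intro equalityI subsetI)
    fix x assume "x \<in> g -` V"
    then obtain y where "y \<in> jump_free" "g y = g x" unfolding V_def by force
    then show "x \<in> jump_free" using inj by blast
  qed (auto simp: V_def)
  have transport: "C_van (g -` W) \<simeq> C_van W" if "open W" "W \<subseteq> V" for W
  proof (rule C_van_transport[OF compact_line g(2) that(1)])
    show "W \<subseteq> range g" using that(2) by (auto simp: V_def)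
    show "x = y" if "g x \<in> W" "g x = g y" for x y
    proof -
      have "x \<in> g -` V" using that(1) \<open>W \<subseteq> V\<close> by blast
      then show ?thesis using inj that(2) unfolding vim by blast
    qed
  qed
  obtain x a b where ab: "a < x" "x < b" "jumps \<inter> {a..<b} = {}" and x: "x \<in> jump_free"
    using False unfolding jump_free_def by blast
  have "g a < g b" using sm[of a x] sm[of x b] x ab by simp
  from absorbing_open_subset[OF \<open>open V\<close> \<open>bounded V\<close> this] obtain W :: "real set"
    where "open W \<and> W \<subseteq> {g a<..<g b} \<and> C_van W \<simeq> C_van W \<otimes> C_van V" ..
  then have W: "open W" "W \<subseteq> {g a<..<g b}" "C_van W \<simeq> C_van W \<otimes> C_van V" by simp_all
  have "{g a<..<g b} \<subseteq> V" using hit[of a b] sub[OF ab(3)] ab unfolding V_def by force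
  then have "W \<subseteq> V" using W(2) by (rule subset_trans[rotated])
  define P where "P = g -` W"
  have PW: "C_van P \<simeq> C_van W" unfolding P_def by (rule transport[OF W(1) \<open>W \<subseteq> V\<close>])
  have SV: "C_van jump_free \<simeq> C_van V" using transport[OF \<open>open V\<close> order_refl] unfolding vim .
  have PS: "C_van P \<simeq> C_van P \<otimes> C_van jump_free"
    by (rule cl_iso_trans[OF cl_iso_trans[OF PW W(3)] prod_space_cong[OF cl_iso_sym[OF PW] cl_iso_sym[OF SV]]])
  have "open P" unfolding P_def using W(1) g(2) by (rule open_vimage)
  then have "C_line \<simeq> C_on (- P) \<otimes> C_van P"
    using C_on_decompose[OF compact_line, of "- P"] by (simp add: closed_Compl)
  then have "C_line \<simeq> C_van P \<otimes> C_on (- P)"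
    by (rule cl_iso_trans[OF _ prod_space_commute])
  then show ?thesis by (rule absorb_summand[OF _ PS])
qed

lemma C_line_squared:
  assumes BA and card: "|jumps :: 'a set| =o omega1"
  shows "C_line \<simeq> C_line \<otimes> C_line"
proof -
  have dec: "C_line \<simeq> C_on (- jump_free) \<otimes> C_van jump_free"
    using C_on_decompose[OF compact_line, of "- jump_free"] open_jump_free by (simp add: closed_Compl)
  note jump_free_absorbed
  also have "C_line \<otimes> C_van jump_free \<simeq> (C_line \<otimes> C_on (- jump_free)) \<otimes> C_van jump_free"
    by (rule prod_space_cong[OF core_absorbed[OF assms] cl_iso_refl])
  also have "\<dots> \<simeq> C_line \<otimes> (C_on (- jump_free) \<otimes> C_van jump_free)" by (rule prod_space_assoc)
  also have "\<dots> \<simeq> C_line \<otimes> C_line" by (rule prod_space_cong[OF cl_iso_refl cl_iso_sym[OF dec]])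
  finally show ?thesis .
qed

end

theorem corollary3p20:
  assumes "BA"
    and "compact_line TYPE('a::linorder_topology)"
    and "separable_space (euclidean :: 'a topology)"
    and "weight_is TYPE('a) omega1"
  shows "\<exists>T :: 'a Cp \<Rightarrow> 'a Cp \<times> 'a Cp. linear_homeomorphism T"
proof -
  obtain D :: "'a set" where D: "countable D" "euclidean closure_of D = (UNIV :: 'a set)"
    using assms(3) unfolding separable_space_def by auto
  interpret separable_compact_line D
  proof
    show "compact (UNIV :: 'a set)" using assms(2) by (simp add: compact_line_def)
    show "countable D" by fact
    show "\<exists>d\<in>D. d \<in> U" if U: "open U" "U \<noteq> {}" for U :: "'a set"
    proof -
      obtain x where "x \<in> U" using U(2) by blast
      moreover have "x \<in> euclidean closure_of D" using D(2) by simp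
      ultimately show ?thesis using U(1) unfolding in_closure_of by auto
    qed
  qed
  have "C_line \<simeq> C_line \<otimes> C_line"
    by (rule C_line_squared[OF assms(1) card_jumps_eq_omega1[OF assms(4)]])
  then show ?thesis
    using linear_homeomorphism_from_cl_iso[where 'a = 'a] by (simp add: C_on_def)
qed

end
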